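(* There exists $E\in\mathcal{I}_{\mathcal{R}}$ such that $p\cdot E\neq A_{\operatorname{diam}E}$ for all $p\in\mathbb{H}^n$.
   Context: Let $n\ge 1$. The Heisenberg group is $\mathbb{H}^n=\mathbb{C}^n\times\mathbb{R}\approx\mathbb{R}^{2n+1}$ with points $[z,t]$, $z=(z_1,\dots,z_n)$, $z_j=x_j+iy_j$, and group law $[z,t]\cdot[z',t']=[z+z',\,t+t'+2\operatorname{Im} z\overline{z}']$, where $\operatorname{Im} z\overline z'=\sum_j\operatorname{Im} z_j\overline{z}'_j$. Put $X_j=\partial_{x_j}+2y_j\partial_t$, $Y_j=\partial_{y_j}-2x_j\partial_t$. A curve is horizontal if it is absolutely continuous and its tangent vector lies a.e. in $\operatorname{span}\{X_j,Y_j\}_{j}$. Fix the left-invariant Riemannian metric making $(X_1,\dots,X_n,Y_1,\dots,Y_n,\partial_t)$ orthonormal; the Carnot-Carathéodory distance $d(p,q)$ is the infimum of the Riemannian lengths of horizontal curves joining $p$ to $q$. Diameters are with respect to $d$; $\mathcal{L}^{2n+1}$ is Lebesgue (outer) measure on $\mathbb{R}^{2n+1}$; $\|z\|=(\sum_j|z_j|^2)^{1/2}$; $p\cdot E=\{p\cdot q : q\in E\}$. For $\theta\in\mathbb{R}^n$ let $r_\theta([z,t])=[(e^{i\theta_1}z_1,\dots,e^{i\theta_n}z_n),t]$, and let $\mathcal{R}=\{F\subset\mathbb{H}^n : r_\theta(F)\subset F\text{ for all }\theta\in\mathbb{R}^n\}$ (rotationally invariant sets). $C_{I,\mathcal{R}}=\sup\{\mathcal{L}^{2n+1}(F)/(\operatorname{diam}F)^{2n+2}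 : F\in\mathcal{R},\ 0<\operatorname{diam}F<+\infty\}$, and $\mathcal{I}_{\mathcal{R}}=\{E\in\mathcal{R} : E\text{ compact},\ \operatorname{diam}E>0,\ \mathcal{L}^{2n+1}(E)=C_{I,\mathcal{R}}(\operatorname{diam}E)^{2n+2}\}$. The sets $A_\lambda$: let $\rho:[0,\pi]\to[0,1]$, $\rho(\varphi)=\frac{\sin\varphi}{\varphi}$ for $\varphi>0$, $\rho(0)=1$ (a decreasing bijection); let $g(\varphi)=\frac{2\varphi-\sin(2\varphi)}{2\varphi^2}$ for $0<\varphi\le\pi$, $g(0)=0$; let $h=g\circ\rho^{-1}:[0,1]\to\mathbb{R}$ and, for $\mu>0$ and $r\in[0,\mu]$, $h_\mu(r)=\mu^2h(r/\mu)$. For $\lambda>0$ set $l_\lambda(r)=\frac{\lambda^2}{2\pi}$ if $r\in[0,\lambda/\pi]$ and $l_\lambda(r)=h_{\lambda/2}(r)$ if $r\in[\lambda/\pi,\lambda/2]$, and $A_\lambda=\{[z,t]\in\mathbb{H}^n : 2\|z\|\le\lambda,\ |t|\le l_\lambda(\|z\|)\}$. *)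

theory Defs
  imports "HOL-Analysis.Analysis"
begin

section \<open>The Heisenberg group\<close>

text \<open>
  The points \<open>[z, t]\<close> of the Heisenberg group \<open>\<complex>\<^sup>n \<times> \<real>\<close> are pairs; \<open>n\<close> is the cardinality of the
  index type. The Euclidean structure of this type (inner product, topology, \<^const>\<open>lebesgue\<close>) is
  that of \<open>\<real>\<^sup>2\<^sup>n\<^sup>+\<^sup>1\<close> with coordinates \<open>(x\<^sub>j, y\<^sub>j, t)\<close>.
\<close>

type_synonym 'n heis = "(complex, 'n) vec \<times> real"

definition heis_mult :: "'n::finite heis \<Rightarrow> 'n heis \<Rightarrow> 'n heis" (infixl "\<odot>" 70) where
  "p \<odot> q = (fst p + fst q, snd p + snd q + 2 * Im (\<Sum>j\<in>UNIV. fst p $ j * cnj (fst q $ j)))"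

definition fieldX :: "'n::finite \<Rightarrow> 'n heis \<Rightarrow> 'n heis" where
  "fieldX j p = (axis j 1, 2 * Im (fst p $ j))"

definition fieldY :: "'n::finite \<Rightarrow> 'n heis \<Rightarrow> 'n heis" where
  "fieldY j p = (axis j \<i>, - 2 * Re (fst p $ j))"

definition fieldT :: "'n::finite heis \<Rightarrow> 'n heis" where
  "fieldT p = (0, 1)"

section \<open>The Riemannian metric\<close>

text \<open>
  A tangent vector \<open>(w, s)\<close> at \<open>p\<close> is \<open>\<Sum>\<^sub>j Re w\<^sub>j X\<^sub>j(p) + \<Sum>\<^sub>j Im w\<^sub>j Y\<^sub>j(p) + c \<partial>\<^sub>t\<close>, where \<open>c\<close> is given by
  \<open>vert_coord\<close>. Hence the following formula; it is confirmed by \<open>riem_inner_frame\<close> and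
  \<open>riem_inner_unique\<close> below.
\<close>

definition vert_coord :: "'n::finite heis \<Rightarrow> 'n heis \<Rightarrow> real" where
  "vert_coord p v = snd v - (\<Sum>j\<in>UNIV. 2 * Im (fst p $ j) * Re (fst v $ j)
                                    - 2 * Re (fst p $ j) * Im (fst v $ j))"

definition riem_inner :: "'n::finite heis \<Rightarrow> 'n heis \<Rightarrow> 'n heis \<Rightarrow> real" where
  "riem_inner p u v = fst u \<bullet> fst v + vert_coord p u * vert_coord p v"

definition riem_norm :: "'n::finite heis \<Rightarrow> 'n heis \<Rightarrow> real" where
  "riem_norm p v = sqrt (riem_inner p v v)"

definition frame :: "'n::finite heis \<Rightarrow> 'n heis set" where
  "frame p = range (\<lambda>j. fieldX j p) \<union> range (\<lambda>j. fieldY j p) \<union> {fieldT p}"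

lemma sum_Re_Im_axis:
  fixes j :: "'n::finite" and a :: complex and f g :: "'n \<Rightarrow> real"
  shows "(\<Sum>k\<in>UNIV. f k * Re (axis j a $ k) - g k * Im (axis j a $ k)) = f j * Re a - g j * Im a"
proof -
  have "(\<Sum>k\<in>UNIV. f k * Re (axis j a $ k) - g k * Im (axis j a $ k))
      = (\<Sum>k\<in>UNIV. if k = j then f k * Re a - g k * Im a else 0)"
    by (rule sum.cong) (auto simp: axis_def)
  then show ?thesis by simp
qed

lemma vert_coord_frame:
  "vert_coord p (fieldX j p) = 0" "vert_coord p (fieldY j p) = 0" "vert_coord p (fieldT p) = 1"
  by (simp_all add: vert_coord_def fieldX_def fieldY_def fieldT_def sum_Re_Im_axis)

lemma axis_1_neq_axis_ii: "axis j (1::complex) \<noteq> axis k \<i>"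
  by (auto simp: axis_def vec_eq_iff complex_eq_iff)

lemma riem_inner_frame:
  assumes "u \<in> frame p" "v \<in> frame p"
  shows "riem_inner p u v = (if u = v then 1 else 0)"
  using assms unfolding frame_def riem_inner_def
  by (auto simp: vert_coord_frame)
     (auto simp: fieldX_def fieldY_def fieldT_def inner_axis_axis axis_eq_axis
        axis_1_neq_axis_ii axis_1_neq_axis_ii[symmetric] inner_complex_def)

lemma bilinear_riem_inner: "bilinear (riem_inner p)"
proof -
  have lin: "linear (vert_coord p)"
    by (rule linearI) (simp_all add: vert_coord_def algebra_simps sum.distrib sum_subtractf
        sum_distrib_left)
  have "linear (riem_inner p u)" "linear (\<lambda>u. riem_inner p u v)" for u v
    by (rule linearI; simp only: riem_inner_def linear_add[OF lin] linear_cmul[OF lin];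
        simp add: algebra_simps inner_add_left inner_add_right)+
  then show ?thesis
    unfolding bilinear_def by simp
qed

lemma span_frame: "span (frame p) = UNIV"
proof -
  have T: "(0, s) \<in> span (frame p)" for s
  proof -
    have "s *\<^sub>R fieldT p \<in> span (frame p)"
      by (rule span_mul, rule span_base) (simp add: frame_def)
    then show ?thesis by (simp add: fieldT_def)
  qed
  have A: "(axis j a, 0) \<in> span (frame p)" for j and a :: complex
  proof -
    have "Re a *\<^sub>R fieldX j p + Im a *\<^sub>R fieldY j p
        + (0, - 2 * Im (fst p $ j) * Re a + 2 * Re (fst p $ j) * Im a) \<in> span (frame p)"
      by (intro span_add span_mul T) (auto intro!: span_base simp: frame_def)
    also have "Re a *\<^sub>R fieldX j p + Im a *\<^sub>R fieldY j p
        + (0, - 2 * Im (fst p $ j) * Re a + 2 * Re (fst p $ j) * Im a) = (axis j a, 0)"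
      by (auto simp: fieldX_def fieldY_def axis_def vec_eq_iff complex_eq_iff)
    finally show ?thesis .
  qed
  have "v \<in> span (frame p)" for v
  proof -
    have "fst v = (\<Sum>j\<in>UNIV. axis j (fst v $ j))"
      by (simp add: vec_eq_iff axis_def)
    then have "v = (\<Sum>j\<in>UNIV. (axis j (fst v $ j), 0)) + (0, snd v)"
      by (simp add: prod_eq_iff fst_sum snd_sum)
    moreover have "(\<Sum>j\<in>UNIV. (axis j (fst v $ j), 0)) + (0, snd v) \<in> span (frame p)"
      by (intro span_add span_sum A T)
    ultimately show ?thesis by simp
  qed
  then show ?thesis by auto
qed

lemma riem_inner_unique:
  assumes "bilinear b"
    and "\<And>u v. u \<in> frame p \<Longrightarrow> v \<in> frame p \<Longrightarrow> b u v = (if u = v then 1 else 0)"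
  shows "b = riem_inner p"
proof (intro ext)
  fix x y
  show "b x y = riem_inner p x y"
    by (rule bilinear_eq[OF assms(1) bilinear_riem_inner, of UNIV "frame p" UNIV "frame p"])
       (auto simp: span_frame assms(2) riem_inner_frame)
qed

section \<open>Horizontal curves and the Carnot-Caratheodory distance\<close>

text \<open>
  \<open>I\<close> ranges over the finite sets of non-overlapping subintervals of \<open>[a, b]\<close>, an interval being
  given by its pair of endpoints.
\<close>

definition abs_cont_on :: "real \<Rightarrow> real \<Rightarrow> (real \<Rightarrow> 'a::real_normed_vector) \<Rightarrow> bool" where
  "abs_cont_on a b \<gamma> \<longleftrightarrow>
    (\<forall>\<epsilon>>0. \<exists>\<delta>>0. \<forall>I :: (real \<times> real) set.
       finite I \<and> (\<forall>(u, v)\<in>I. a \<le> u \<and> u \<le> v \<and> v \<le> b) \<and>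
       pairwise (\<lambda>(u, v) (u', v'). {u<..<v} \<inter> {u'<..<v'} = {}) I \<and>
       (\<Sum>(u, v)\<in>I. v - u) < \<delta>
       \<longrightarrow> (\<Sum>(u, v)\<in>I. norm (\<gamma> v - \<gamma> u)) < \<epsilon>)"

definition horizontal_curve :: "real \<Rightarrow> real \<Rightarrow> (real \<Rightarrow> 'n::finite heis) \<Rightarrow> bool" where
  "horizontal_curve a b \<gamma> \<longleftrightarrow>
    abs_cont_on a b \<gamma> \<and>
    (AE s in lebesgue. s \<in> {a..b} \<longrightarrow>
       (\<exists>v \<in> span (range (\<lambda>j. fieldX j (\<gamma> s)) \<union> range (\<lambda>j. fieldY j (\<gamma> s))).
          (\<gamma> has_vector_derivative v) (at s)))"

definition has_riem_length :: "real \<Rightarrow> real \<Rightarrow> (real \<Rightarrow> 'n::finite heis) \<Rightarrow> real \<Rightarrow> bool" where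
  "has_riem_length a b \<gamma> L \<longleftrightarrow>
    ((\<lambda>s. riem_norm (\<gamma> s) (vector_derivative \<gamma> (at s))) has_integral L) {a..b}"

definition cc_dist :: "'n::finite heis \<Rightarrow> 'n heis \<Rightarrow> real" where
  "cc_dist p q = Inf {L. \<exists>a b \<gamma>. a < b \<and> horizontal_curve a b \<gamma> \<and> \<gamma> a = p \<and> \<gamma> b = q \<and>
                                 has_riem_length a b \<gamma> L}"

text \<open>
  The library's \<^const>\<open>diameter\<close> refers to the Euclidean distance of the type. The diameter below
  is \<open>0\<close> for the empty set and \<open>\<infinity>\<close> for sets that are unbounded with respect to \<^const>\<open>cc_dist\<close>.
\<close>

definition cc_diam :: "'n::finite heis set \<Rightarrow> ennreal" where
  "cc_diam E = (SUP p\<in>E. SUP q\<in>E. ennreal (cc_dist p q))"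

section \<open>The isodiametric problem for rotationally invariant sets\<close>

definition rot :: "real ^ 'n \<Rightarrow> 'n::finite heis \<Rightarrow> 'n heis" where
  "rot \<theta> p = ((\<chi> j. exp (\<i> * of_real (\<theta> $ j)) * fst p $ j), snd p)"

definition rot_inv :: "'n::finite heis set set" where
  "rot_inv = {F. \<forall>\<theta>. rot \<theta> ` F \<subseteq> F}"

text \<open>
  The sets \<open>F\<close> need not be measurable, hence the outer measure.
\<close>

definition isodiam_const_rot :: "'n::finite itself \<Rightarrow> ennreal" where
  "isodiam_const_rot _ =
    (SUP F \<in> {F :: 'n heis set. F \<in> rot_inv \<and> 0 < cc_diam F \<and> cc_diam F < \<infinity>}.
       outer_measure_of lebesgue F / cc_diam F ^ (2 * CARD('n) + 2))"

definition isodiam_rot :: "'n::finite heis set set" where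
  "isodiam_rot =
    {E \<in> rot_inv. compact E \<and> cc_diam E > 0 \<and>
       outer_measure_of lebesgue E = isodiam_const_rot TYPE('n) * cc_diam E ^ (2 * CARD('n) + 2)}"

section \<open>The sets \<open>A\<^sub>\<lambda>\<close>\<close>

definition rho :: "real \<Rightarrow> real" where
  "rho \<phi> = (if \<phi> = 0 then 1 else sin \<phi> / \<phi>)"

definition g_fun :: "real \<Rightarrow> real" where
  "g_fun \<phi> = (if \<phi> = 0 then 0 else (2 * \<phi> - sin (2 * \<phi>)) / (2 * \<phi>\<^sup>2))"

text \<open>Here \<^const>\<open>rho\<close> is inverted as a decreasing bijection from \<open>[0, \<pi>]\<close> onto \<open>[0, 1]\<close>.\<close>

definition h_fun :: "real \<Rightarrow> real" where
  "h_fun r = g_fun (inv_into {0..pi} rho r)"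

definition h_scaled :: "real \<Rightarrow> real \<Rightarrow> real" where
  "h_scaled \<mu> r = \<mu>\<^sup>2 * h_fun (r / \<mu>)"

text \<open>
  Only the values for \<open>r \<in> [0, \<lambda>/2]\<close> matter. At \<open>r = \<lambda>/\<pi>\<close> the two branches agree, because
  \<open>rho (\<pi>/2) = g_fun (\<pi>/2) = 2/\<pi>\<close>.
\<close>

definition l_fun :: "real \<Rightarrow> real \<Rightarrow> real" where
  "l_fun lam r = (if r \<le> lam / pi then lam\<^sup>2 / (2 * pi) else h_scaled (lam / 2) r)"

definition A_set :: "real \<Rightarrow> 'n::finite heis set" where
  "A_set lam = {p. 2 * norm (fst p) \<le> lam \<and> \<bar>snd p\<bar> \<le> l_fun lam (norm (fst p))}"

end

theory Submission
  imports Defs "HOL-Real_Asymp.Real_Asymp"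
begin

text \<open>
  If a rotationally invariant set \<open>F\<close> of diameter \<open>\<lambda>\<close> contains \<open>[z, t]\<close> and \<open>[z, s]\<close>, then it also
  contains \<open>[e\<^sup>i\<^sup>\<alpha> z, s]\<close> for every \<open>\<alpha>\<close>. Dido's inequality for these pairs, with the best \<open>\<alpha>\<close>, gives
  \<open>|s - t| \<le> 2 l\<^sub>\<lambda>(\<parallel>z\<parallel>)\<close>, and Fubini bounds the volume of \<open>F\<close>. The bound depends only on the lengths of
  the vertical slices, so moving every slice of \<open>A\<^sub>\<lambda>\<close> by an amount depending on \<open>\<parallel>z\<parallel>\<close> keeps the set
  optimal as long as the diameter does not grow. For \<open>\<lambda> = 2\<pi>\<close> the slices over \<open>\<parallel>z\<parallel> < 2\<close> have room for
  the shift \<open>(1 - \<parallel>z\<parallel>\<^sup>2/4)\<^sup>2\<close>: two points are joined by a circular arc to the axis \<open>z = 0\<close>, another arc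
  from the axis, and an arc of a circle about the axis, of total length at most \<open>2\<pi>\<close>.

  Dido's inequality is needed for absolutely continuous curves. It is proved by a calibration: with the
  arc length \<open>l\<close>, the function \<open>l/k - cot(k l + \<eta>) \<parallel>z\<parallel>\<^sup>2 \<plusminus> t\<close> is nondecreasing along horizontal
  curves that start at the origin.
\<close>

section \<open>Increments of functions on an interval\<close>

text \<open>The slice bound compares points of one slice up to rotation. A shift by a function of
  \<parallel>z\<parallel> cancels for such pairs, so only pairs at different distances from the axis
  feel it. With \<lambda> = 2\<pi>, the length of a unit circle, write these distances as 2 sin x
  and 2 sin y with x \<le> y \<le> \<pi>/2. The slack left by the three-arc path tends to 0 as x
  \<rightarrow> y, with slope 8 sin y (1 - sin y). So the shift has to be flat on the axis and at
  \<parallel>z\<parallel> = 2, where the constant part of the profile ends;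
  \<open>(1 - \<parallel>z\<parallel>\<^sup>2/4)\<^sup>2\<close> is a polynomial of this kind. It
  vanishes beyond, so the rim still determines a translation onto \<open>A_set\<close>, while the
  slice over the axis is off centre. In the upper bound the set F need not be measurable. Its
  diameter is used only through a family of inequalities that are closed conditions in the Euclidean
  coordinates. They pass to the closure, where Fubini applies, without a comparison of the two
  topologies.\<close>

text \<open>
  The part of absolute continuity that survives for indefinite gauge integrals without further work:
  the increments over fine intervals tagged in \<open>N\<close> (a null set below) are negligible.
\<close>

definition small_var :: "(real \<Rightarrow> 'a::real_normed_vector) \<Rightarrow> real set \<Rightarrow> real \<Rightarrow> real \<Rightarrow> bool" where
  "small_var f N a b \<longleftrightarrow>
    (\<forall>e>0. \<exists>g. gauge g \<and>
      (\<forall>p. p tagged_partial_division_of {a..b} \<and> g fine p \<and> fst ` p \<subseteq> N \<longrightarrow>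
        (\<Sum>(x, K)\<in>p. norm (f (Sup K) - f (Inf K))) < e))"

lemma tagged_partial_division_real:
  fixes a b :: real
  assumes "p tagged_partial_division_of {a..b}" "(x, K) \<in> p"
  shows "K = {Inf K..Sup K}" "Inf K \<le> x" "x \<le> Sup K" "a \<le> Inf K" "Sup K \<le> b"
    "measure lborel K = Sup K - Inf K"
proof -
  obtain u v where K: "K = cbox u v"
    using tagged_partial_division_ofD(4)[OF assms] by blast
  have x: "x \<in> K" "K \<subseteq> {a..b}"
    using tagged_partial_division_ofD(2,3)[OF assms] by auto
  have "u \<le> v" using x K by auto
  then have e: "Inf K = u" "Sup K = v" using K by auto
  show "K = {Inf K..Sup K}" "Inf K \<le> x" "x \<le> Sup K" "a \<le> Inf K" "Sup K \<le> b"
    "measure lborel K = Sup K - Inf K"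
    using K x e \<open>u \<le> v\<close> by auto
qed

lemma small_var_abs_cont:
  fixes f :: "real \<Rightarrow> 'a::real_normed_vector"
  assumes ac: "abs_cont_on a b f" and N: "negligible N"
  shows "small_var f N a b"
  unfolding small_var_def
proof (intro allI impI)
  fix e :: real assume "e > 0"
  then obtain \<delta> where \<delta>: "\<delta> > 0" and ac': "\<And>I. finite I \<Longrightarrow>
      (\<forall>(u, v)\<in>I. a \<le> u \<and> u \<le> v \<and> v \<le> b) \<Longrightarrow>
      pairwise (\<lambda>(u, v) (u', v'). {u<..<v} \<inter> {u'<..<v'} = {}) I \<Longrightarrow>
      (\<Sum>(u, v)\<in>I. v - u) < \<delta> \<Longrightarrow> (\<Sum>(u, v)\<in>I. norm (f v - f u)) < e"
    using ac[unfolded abs_cont_on_def, rule_format, OF \<open>e > 0\<close>] by blast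
  have "N \<in> sets lebesgue" using N by (simp add: negligible_imp_sets)
  then obtain T where T: "open T" "N \<subseteq> T" "T - N \<in> lmeasurable" "emeasure lebesgue (T - N) < ennreal \<delta>"
    using sets_lebesgue_outer_open[OF _ \<delta>] by blast
  have "N \<in> lmeasurable" "measure lebesgue N = 0"
    using N by (auto simp: negligible_iff_measure)
  have Tm: "T \<in> lmeasurable"
  proof -
    have "(T - N) \<union> N \<in> lmeasurable" using T(3) \<open>N \<in> lmeasurable\<close> by blast
    then show ?thesis using T(2) by (simp add: Un_absorb2)
  qed
  have Tl: "measure lebesgue T < \<delta>"
  proof -
    have "measure lebesgue (T - N) = measure lebesgue T"
      using measurable_measure_Diff[OF Tm fmeasurableD[OF \<open>N \<in> lmeasurable\<close>] T(2)] \<open>measure lebesgue N = 0\<close>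
      by simp
    moreover have "measure lebesgue (T - N) < \<delta>"
      using T(4) by (simp add: emeasure_eq_measure2[OF T(3)] ennreal_less_iff)
    ultimately show ?thesis by simp
  qed
  \<comment> \<open>Intervals tagged in \<open>N\<close> are confined to \<open>T\<close>, so their
    total length stays below \<open>\<delta>\<close>.\<close>
  define g where "g x = (if x \<in> N then T else UNIV)" for x
  have "gauge g" using T by (auto simp: gauge_def g_def)
  moreover have "(\<Sum>(x, K)\<in>p. norm (f (Sup K) - f (Inf K))) < e"
    if p: "p tagged_partial_division_of {a..b}" "g fine p" "fst ` p \<subseteq> N" for p
  proof -
    note pr = tagged_partial_division_real[OF p(1)]
    have fin: "finite p" using tagged_partial_division_ofD(1)[OF p(1)] .
    let ?h = "\<lambda>(x, K). (Inf K, Sup K) :: real \<times> real"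
    have disj: "{Inf K<..<Sup K} \<inter> {Inf L<..<Sup L} = {}"
      if "(x, K) \<in> p" "(y, L) \<in> p" "(x, K) \<noteq> (y, L)" for x y K L
    proof -
      have "interior K \<inter> interior L = {}"
        using tagged_partial_division_ofD(5)[OF p(1)] that by blast
      moreover have "interior K = {Inf K<..<Sup K}" "interior L = {Inf L<..<Sup L}"
        using pr(1)[OF that(1)] pr(1)[OF that(2)] interior_atLeastAtMost_real by metis+
      ultimately show ?thesis by simp
    qed
    \<comment> \<open>Distinct members of \<open>p\<close> share their endpoints only if these
      coincide. Such members contribute nothing, so sums over \<open>p\<close> and over the set of
      endpoint pairs agree.\<close>
    have zero: "Inf K = Sup K" if "(x, K) \<in> p" "(y, L) \<in> p" "(x, K) \<noteq> (y, L)" 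
      "?h (x, K) = ?h (y, L)" for x y K L
    proof -
      have "{Inf K<..<Sup K} = {}" using disj[OF that(1-3)] that(4) by auto
      then show ?thesis using pr(2,3)[OF that(1)] by force
    qed
    have re: "(\<Sum>(u, v)\<in>?h ` p. \<phi> u v) = (\<Sum>(x, K)\<in>p. \<phi> (Inf K) (Sup K))"
      if "\<And>u. \<phi> u u = 0" for \<phi> :: "real \<Rightarrow> real \<Rightarrow> real"
    proof -
      have "sum (\<lambda>(u, v). \<phi> u v) (?h ` p) = sum ((\<lambda>(u, v). \<phi> u v) \<circ> ?h) p"
        by (rule sum.reindex_nontrivial[OF fin], clarsimp, metis (no_types, lifting) zero that prod.inject case_prod_conv)
      also have "\<dots> = (\<Sum>(x, K)\<in>p. \<phi> (Inf K) (Sup K))"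
        by (rule sum.cong) auto
      finally show ?thesis .
    qed
    have "(\<Sum>(u, v)\<in>?h ` p. v - u) < \<delta>"
    proof -
      have div: "snd ` p division_of \<Union>(snd ` p)"
        by (rule partial_division_of_tagged_division[OF p(1)])
      have "(\<Sum>(u, v)\<in>?h ` p. v - u) = (\<Sum>(x, K)\<in>p. measure lborel K)"
        by (subst re) (auto intro!: sum.cong simp: pr(6))
      also have "\<dots> = (\<Sum>K\<in>snd ` p. measure lborel K)"
      proof -
        have "sum (measure lborel) (snd ` p) = sum (measure lborel \<circ> snd) p"
        proof (rule sum.reindex_nontrivial[OF fin])
          fix z w assume zw: "z \<in> p" "w \<in> p" "z \<noteq> w" "snd z = snd w"
          have "Inf (snd z) = Sup (snd z)"
            using zero zw by (cases z; cases w) auto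
          then show "measure lborel (snd z) = 0"
            using pr(6)[of "fst z" "snd z"] zw by (cases z) auto
        qed
        then show ?thesis by (simp add: case_prod_beta comp_def)
      qed
      also have "\<dots> = measure lebesgue (\<Union>(snd ` p))"
        unfolding content_division[OF div, symmetric]
      proof (rule sum.cong[OF refl])
        fix K assume "K \<in> snd ` p"
        then obtain u v where "K = cbox u v" using division_ofD(4)[OF div] by blast
        then show "measure lborel K = measure lebesgue K" by simp
      qed
      also have "\<dots> \<le> measure lebesgue T"
      proof (rule measure_mono_fmeasurable)
        show "\<Union>(snd ` p) \<subseteq> T"
        proof clarify
          fix y x K assume K: "(x, K) \<in> p" "y \<in> snd (x, K)"
          have "x \<in> N" using p(3) K(1) by force
          moreover have "K \<subseteq> g x" using p(2) K(1) by (auto simp: fine_def)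
          ultimately show "y \<in> T" using K(2) by (auto simp: g_def)
        qed
        show "\<Union>(snd ` p) \<in> sets lebesgue"
        proof (rule sets.finite_Union)
          show "finite (snd ` p)" using fin by simp
          show "snd ` p \<subseteq> sets lebesgue"
          proof clarify
            fix x K assume "(x, K) \<in> p"
            then have "K = {Inf K..Sup K}" by (rule pr(1))
            then show "snd (x, K) \<in> sets lebesgue" by (metis snd_conv sets_completionI_sets sets_lborel atLeastAtMost_borel)
          qed
        qed
      qed (rule Tm)
      finally show ?thesis using Tl by simp
    qed
    then have "(\<Sum>(u, v)\<in>?h ` p. norm (f v - f u)) < e"
    proof (rule ac'[rotated 3])
      show "finite (?h ` p)" using fin by simp
      show "\<forall>(u, v)\<in>?h ` p. a \<le> u \<and> u \<le> v \<and> v \<le> b"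
        using pr(2-5) order_trans by (auto, blast+)
      show "pairwise (\<lambda>(u, v) (u', v'). {u<..<v} \<inter> {u'<..<v'} = {}) (?h ` p)"
        unfolding pairwise_def
      proof (intro ballI impI)
        fix z w assume "z \<in> ?h ` p" "w \<in> ?h ` p" "z \<noteq> w"
        then obtain x K y L where zw: "(x, K) \<in> p" "(y, L) \<in> p" "z = (Inf K, Sup K)" "w = (Inf L, Sup L)"
          by auto
        then have "(x, K) \<noteq> (y, L)" using \<open>z \<noteq> w\<close> by auto
        from disj[OF zw(1,2) this] zw
        show "(case z of (u, v) \<Rightarrow> \<lambda>(u', v'). {u<..<v} \<inter> {u'<..<v'} = {}) w" by simp
      qed
    qed
    then show ?thesis by (subst (asm) re) auto
  qed
  ultimately show "\<exists>g. gauge g \<and>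
      (\<forall>p. p tagged_partial_division_of {a..b} \<and> g fine p \<and> fst ` p \<subseteq> N \<longrightarrow>
        (\<Sum>(x, K)\<in>p. norm (f (Sup K) - f (Inf K))) < e)"
    by (intro exI[of _ g] conjI allI impI) simp_all
qed

text \<open>Once \<open>f\<close> is set to 0 on \<open>N\<close>, this is Henstock's lemma: the
  terms content times value vanish at tags in \<open>N\<close>, and the increments of the integral
  remain.\<close>

lemma small_var_integral:
  fixes f :: "real \<Rightarrow> real"
  assumes f: "f integrable_on {a..b}" and N: "negligible N"
  shows "small_var (\<lambda>s. integral {a..s} f) N a b"
  unfolding small_var_def
proof (intro allI impI)
  fix e :: real assume "e > 0"
  define f0 where "f0 x = (if x \<in> N then 0 else f x)" for x
  have int0: "integral K f0 = integral K f" for K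
    by (rule integral_spike[OF N]) (auto simp: f0_def)
  have "f0 integrable_on {a..b}"
    by (rule integrable_spike[OF f N]) (auto simp: f0_def)
  then obtain g where g: "gauge g" and less: "\<And>p. \<lbrakk>p tagged_partial_division_of {a..b}; g fine p\<rbrakk> \<Longrightarrow>
       (\<Sum>(x, K)\<in>p. norm (measure lborel K *\<^sub>R f0 x - integral K f0)) < e"
    using Henstock_lemma[of f0 a b e] \<open>e > 0\<close> by (auto simp: cbox_interval)
  have "(\<Sum>(x, K)\<in>p. norm (integral {a..Sup K} f - integral {a..Inf K} f)) < e"
    if p: "p tagged_partial_division_of {a..b}" "g fine p" "fst ` p \<subseteq> N" for p
  proof -
    have "(\<Sum>(x, K)\<in>p. norm (integral {a..Sup K} f - integral {a..Inf K} f))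
        = (\<Sum>(x, K)\<in>p. norm (measure lborel K *\<^sub>R f0 x - integral K f0))"
    proof (rule sum.cong[OF refl], clarify)
      fix x K assume K: "(x, K) \<in> p"
      note pr = tagged_partial_division_real[OF p(1) K]
      have "integral {a..Inf K} f + integral {Inf K..Sup K} f = integral {a..Sup K} f"
        using pr f by (intro Henstock_Kurzweil_Integration.integral_combine) (auto intro: integrable_subinterval_real)
      moreover have "f0 x = 0" using p(3) K by (force simp: f0_def)
      ultimately show "norm (integral {a..Sup K} f - integral {a..Inf K} f)
          = norm (measure lborel K *\<^sub>R f0 x - integral K f0)"
        using pr(1) int0[of K] by (simp flip: norm_minus_cancel[of "integral K f"])
    qed
    also have "\<dots> < e" by (rule less[OF p(1,2)])
    finally show ?thesis .
  qed
  with g show "\<exists>g. gauge g \<and>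
      (\<forall>p. p tagged_partial_division_of {a..b} \<and> g fine p \<and> fst ` p \<subseteq> N \<longrightarrow>
        (\<Sum>(x, K)\<in>p. norm (integral {a..Sup K} f - integral {a..Inf K} f)) < e)"
    by (intro exI[of _ g] conjI allI impI) simp_all
qed

text \<open>Serves the calibration function, which depends in a Lipschitz way on the curve and its
  arc length.\<close>

lemma small_var_combine:
  fixes f :: "real \<Rightarrow> 'a::real_normed_vector" and h :: "real \<Rightarrow> 'b::real_normed_vector"
    and F :: "real \<Rightarrow> 'c::real_normed_vector"
  assumes f: "small_var f N a b" and h: "small_var h N a b"
    and F: "\<And>u v. \<lbrakk>u \<in> {a..b}; v \<in> {a..b}\<rbrakk> \<Longrightarrow> norm (F v - F u) \<le> C * (norm (f v - f u) + norm (h v - h u))"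
  shows "small_var F N a b"
  unfolding small_var_def
proof (intro allI impI)
  fix e :: real assume e: "e > 0"
  define C' where "C' = max C 1"
  have C': "C' > 0" "C \<le> C'" by (auto simp: C'_def)
  define e' where "e' = e / (2 * C')"
  have e': "e' > 0" using e C' by (simp add: e'_def)
  obtain g1 where g1: "gauge g1" "\<And>p. p tagged_partial_division_of {a..b} \<Longrightarrow> g1 fine p \<Longrightarrow> fst ` p \<subseteq> N \<Longrightarrow>
        (\<Sum>(x, K)\<in>p. norm (f (Sup K) - f (Inf K))) < e'"
    using f e' unfolding small_var_def by metis
  obtain g2 where g2: "gauge g2" "\<And>p. p tagged_partial_division_of {a..b} \<Longrightarrow> g2 fine p \<Longrightarrow> fst ` p \<subseteq> N \<Longrightarrow>
        (\<Sum>(x, K)\<in>p. norm (h (Sup K) - h (Inf K))) < e'"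
    using h e' unfolding small_var_def by metis
  have "(\<Sum>(x, K)\<in>p. norm (F (Sup K) - F (Inf K))) < e"
    if p: "p tagged_partial_division_of {a..b}" "(\<lambda>x. g1 x \<inter> g2 x) fine p" "fst ` p \<subseteq> N" for p
  proof -
    have "(\<Sum>(x, K)\<in>p. norm (F (Sup K) - F (Inf K)))
        \<le> (\<Sum>(x, K)\<in>p. C' * norm (f (Sup K) - f (Inf K)) + C' * norm (h (Sup K) - h (Inf K)))"
    proof (rule sum_mono, clarify)
      fix x K assume K: "(x, K) \<in> p"
      note pr = tagged_partial_division_real[OF p(1) K]
      have "norm (F (Sup K) - F (Inf K)) \<le> C * (norm (f (Sup K) - f (Inf K)) + norm (h (Sup K) - h (Inf K)))"
        using pr by (intro F) auto
      also have "\<dots> \<le> C' * (norm (f (Sup K) - f (Inf K)) + norm (h (Sup K) - h (Inf K)))"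
        using C' by (intro mult_right_mono) auto
      finally show "norm (F (Sup K) - F (Inf K)) \<le> C' * norm (f (Sup K) - f (Inf K)) + C' * norm (h (Sup K) - h (Inf K))"
        by (simp add: distrib_left)
    qed
    also have "\<dots> = C' * (\<Sum>(x, K)\<in>p. norm (f (Sup K) - f (Inf K))) + C' * (\<Sum>(x, K)\<in>p. norm (h (Sup K) - h (Inf K)))"
      by (simp add: case_prod_beta sum.distrib sum_distrib_left)
    also have "\<dots> < C' * e' + C' * e'"
      using g1(2)[OF p(1)] g2(2)[OF p(1)] p(2,3) C' by (intro add_strict_mono mult_strict_left_mono) (auto simp: fine_Int)
    also have "\<dots> = e" using C' by (simp add: e'_def)
    finally show ?thesis .
  qed
  moreover have "gauge (\<lambda>x. g1 x \<inter> g2 x)" using g1 g2 by (intro gauge_Int) 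
  ultimately show "\<exists>g. gauge g \<and>
      (\<forall>p. p tagged_partial_division_of {a..b} \<and> g fine p \<and> fst ` p \<subseteq> N \<longrightarrow>
        (\<Sum>(x, K)\<in>p. norm (F (Sup K) - F (Inf K))) < e)"
    by (intro exI[of _ "\<lambda>x. g1 x \<inter> g2 x"] conjI allI impI) simp_all
qed

text \<open>
  Only an upper bound of the difference quotients is required off \<open>N\<close>. Hence the lemma applies to
  functions of the arc length, whose differentiability almost everywhere is never established.
\<close>

lemma increment_le_integral:
  fixes f g :: "real \<Rightarrow> real"
  assumes ab: "a \<le> b" and g: "(g has_integral I) {a..b}" and N: "negligible N"
    and sv: "small_var f N a b"
    and loc: "\<And>x e. \<lbrakk>x \<in> {a..b}; x \<notin> N; e > 0\<rbrakk> \<Longrightarrow>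
      \<exists>\<delta>>0. \<forall>u v. a \<le> u \<and> u \<le> x \<and> x \<le> v \<and> v \<le> b \<and> v - u < \<delta> \<longrightarrow> f v - f u \<le> (g x + e) * (v - u)"
  shows "f b - f a \<le> I"
proof (rule field_le_epsilon)
  fix e0 :: real assume e0: "e0 > 0"
  \<comment> \<open>One \<open>e\<close> pays for the tags in \<open>N\<close>, one for the Riemann
    sum, and \<open>e\<close> per unit length for the local estimates.\<close>
  define e where "e = e0 / (2 + (b - a))"
  have e: "e > 0" using e0 ab by (simp add: e_def)
  \<comment> \<open>On \<open>N\<close> the values of \<open>g\<close> are arbitrary and unrelated
    to the increments of \<open>f\<close>, which are left to \<open>small_var\<close> there.\<close>
  define g0 where "g0 x = (if x \<in> N then 0 else g x)" for x
  have "(g0 has_integral I) {a..b}"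
    by (rule has_integral_spike[OF N _ g]) (auto simp: g0_def)
  then obtain d1 where d1: "gauge d1" "\<And>p. p tagged_division_of {a..b} \<Longrightarrow> d1 fine p \<Longrightarrow>
      norm ((\<Sum>(x, K)\<in>p. measure lborel K *\<^sub>R g0 x) - I) < e"
    using e unfolding cbox_interval[symmetric] has_integral by metis
  obtain d2 where d2: "gauge d2" "\<And>p. p tagged_partial_division_of {a..b} \<Longrightarrow> d2 fine p \<Longrightarrow> fst ` p \<subseteq> N \<Longrightarrow>
        (\<Sum>(x, K)\<in>p. norm (f (Sup K) - f (Inf K))) < e"
    using sv e unfolding small_var_def by metis
  have "\<exists>\<delta>>0. x \<in> {a..b} - N \<longrightarrow> (\<forall>u v. a \<le> u \<and> u \<le> x \<and> x \<le> v \<and> v \<le> b \<and> v - u < \<delta> \<longrightarrow> f v - f u \<le> (g x + e) * (v - u))" for x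
    using loc[of x e] e by (cases "x \<in> {a..b} - N") (auto intro: exI[of _ 1])
  then obtain \<delta> where \<delta>: "\<And>x. \<delta> x > (0::real)"
    "\<And>x u v. x \<in> {a..b} - N \<Longrightarrow> a \<le> u \<Longrightarrow> u \<le> x \<Longrightarrow> x \<le> v \<Longrightarrow> v \<le> b \<Longrightarrow> v - u < \<delta> x \<Longrightarrow> f v - f u \<le> (g x + e) * (v - u)"
    by metis
  define d3 where "d3 x = ball x (\<delta> x / 2)" for x
  have "gauge d3" using \<delta>(1) by (auto simp: gauge_def d3_def)
  then have "gauge (\<lambda>x. d1 x \<inter> d2 x \<inter> d3 x)" using d1 d2 by (intro gauge_Int)
  then obtain p where p: "p tagged_division_of {a..b}" "(\<lambda>x. d1 x \<inter> d2 x \<inter> d3 x) fine p"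
    using fine_division_exists_real by blast
  have fine: "d1 fine p" "d2 fine p" "d3 fine p" using p(2) by (auto simp: fine_def)
  have pp: "p tagged_partial_division_of {a..b}" using p(1) by (simp add: tagged_division_of_def)
  have fin: "finite p" using tagged_partial_division_ofD(1)[OF pp] .
  note pr = tagged_partial_division_real[OF pp]
  let ?P = "{(x, K). (x, K) \<in> p \<and> x \<in> N}" and ?Q = "{(x, K). (x, K) \<in> p \<and> x \<notin> N}"
  have split: "sum \<phi> p = sum \<phi> ?P + sum \<phi> ?Q" for \<phi> :: "real \<times> real set \<Rightarrow> real"
    using fin by (subst sum.union_disjoint[symmetric]) (auto intro!: sum.cong finite_subset[OF _ fin])
  have "f b - f a = (\<Sum>(x, K)\<in>p. f (Sup K) - f (Inf K))"
    using additive_tagged_division_1[OF ab p(1)] by metis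
  also have "\<dots> = (\<Sum>(x, K)\<in>?P. f (Sup K) - f (Inf K)) + (\<Sum>(x, K)\<in>?Q. f (Sup K) - f (Inf K))"
    by (rule split)
  also have "(\<Sum>(x, K)\<in>?P. f (Sup K) - f (Inf K)) \<le> (\<Sum>(x, K)\<in>?P. norm (f (Sup K) - f (Inf K)))"
    by (rule sum_mono) auto
  also have "(\<Sum>(x, K)\<in>?P. norm (f (Sup K) - f (Inf K))) \<le> e"
  proof (rule less_imp_le, rule d2(2))
    show "?P tagged_partial_division_of {a..b}"
      by (rule tagged_partial_division_subset[OF pp]) auto
    show "d2 fine ?P" using fine(2) by (auto simp: fine_def)
  qed auto
  also have "(\<Sum>(x, K)\<in>?Q. f (Sup K) - f (Inf K)) \<le> (\<Sum>(x, K)\<in>?Q. measure lborel K * g0 x + e * measure lborel K)"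
  proof (rule sum_mono, clarify)
    fix x K assume K: "(x, K) \<in> p" "x \<notin> N"
    note pr' = pr[OF K(1)]
    have "K \<subseteq> ball x (\<delta> x / 2)" using fine(3) K by (auto simp: fine_def d3_def)
    then have "Inf K \<in> ball x (\<delta> x / 2)" "Sup K \<in> ball x (\<delta> x / 2)"
      using pr' by (metis atLeastAtMost_iff order_refl order_trans subsetD)+
    then have "Sup K - Inf K < \<delta> x" unfolding mem_ball dist_real_def by linarith
    then have "f (Sup K) - f (Inf K) \<le> (g x + e) * (Sup K - Inf K)"
      using pr' K by (intro \<delta>(2)) auto
    then show "f (Sup K) - f (Inf K) \<le> measure lborel K * g0 x + e * measure lborel K"
      unfolding pr'(6) using K by (simp add: g0_def algebra_simps)
  qed
  also have "(\<Sum>(x, K)\<in>?Q. measure lborel K * g0 x + e * measure lborel K)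
     \<le> (\<Sum>(x, K)\<in>?P. measure lborel K * g0 x + e * measure lborel K) + (\<Sum>(x, K)\<in>?Q. measure lborel K * g0 x + e * measure lborel K)"
    using e by (auto intro!: sum_nonneg simp: g0_def)
  also have "\<dots> = (\<Sum>(x, K)\<in>p. measure lborel K * g0 x + e * measure lborel K)"
    by (rule split[symmetric])
  also have "\<dots> = (\<Sum>(x, K)\<in>p. measure lborel K * g0 x) + e * (\<Sum>(x, K)\<in>p. measure lborel K)"
    by (simp add: case_prod_beta sum.distrib sum_distrib_left)
  also have "(\<Sum>(x, K)\<in>p. measure lborel K) = b - a"
    using additive_content_tagged_division[of p a b] p(1) ab by (simp add: cbox_interval)
  also have "(\<Sum>(x, K)\<in>p. measure lborel K * g0 x) \<le> I + e"
    using d1(2)[OF p(1) fine(1)] by simp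
  finally have "f b - f a \<le> I + e * (2 + (b - a))" by (simp add: algebra_simps)
  also have "e * (2 + (b - a)) = e0" using ab by (simp add: e_def)
  finally show "f b - f a \<le> I + e0" by simp
qed

lemma abs_cont_on_subset:
  assumes "abs_cont_on a b f" "a \<le> c" "d \<le> b"
  shows "abs_cont_on c d f"
  unfolding abs_cont_on_def
proof (intro allI impI)
  fix e :: real assume "e > 0"
  from assms(1)[unfolded abs_cont_on_def, rule_format, OF this]
  obtain \<delta> where "\<delta> > 0" and \<delta>: "\<forall>I. finite I \<and> (\<forall>(u, v)\<in>I. a \<le> u \<and> u \<le> v \<and> v \<le> b) \<and>
       pairwise (\<lambda>(u, v) (u', v'). {u<..<v} \<inter> {u'<..<v'} = {}) I \<and>
       (\<Sum>(u, v)\<in>I. v - u) < \<delta> \<longrightarrow> (\<Sum>(u, v)\<in>I. norm (f v - f u)) < e"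
    by blast
  show "\<exists>\<delta>>0. \<forall>I. finite I \<and> (\<forall>(u, v)\<in>I. c \<le> u \<and> u \<le> v \<and> v \<le> d) \<and>
       pairwise (\<lambda>(u, v) (u', v'). {u<..<v} \<inter> {u'<..<v'} = {}) I \<and>
       (\<Sum>(u, v)\<in>I. v - u) < \<delta> \<longrightarrow> (\<Sum>(u, v)\<in>I. norm (f v - f u)) < e"
  proof (intro exI[of _ \<delta>] conjI allI impI)
    fix I assume I: "finite I \<and> (\<forall>(u, v)\<in>I. c \<le> u \<and> u \<le> v \<and> v \<le> d) \<and>
       pairwise (\<lambda>(u, v) (u', v'). {u<..<v} \<inter> {u'<..<v'} = {}) I \<and> (\<Sum>(u, v)\<in>I. v - u) < \<delta>"
    then have "\<forall>(u, v)\<in>I. a \<le> u \<and> u \<le> v \<and> v \<le> b" using assms(2,3) by force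
    with I show "(\<Sum>(u, v)\<in>I. norm (f v - f u)) < e" using \<delta> by simp
  qed (rule \<open>\<delta> > 0\<close>)
qed

text \<open>The estimates to the left and right of \<open>x\<close> add up because
  \<open>u \<le> x \<le> v\<close>, the position of a tag in its interval. For intervals on one side
  of \<open>x\<close> the derivative at \<open>x\<close> would give no such bound.\<close>

lemma increment_bound_deriv:
  fixes h :: "real \<Rightarrow> real"
  assumes "(h has_real_derivative D) (at x)" "D \<le> c" "e > 0"
  shows "\<exists>\<delta>>0. \<forall>u v. u \<le> x \<and> x \<le> v \<and> v - u < \<delta> \<longrightarrow> h v - h u \<le> (c + e) * (v - u)"
proof -
  obtain \<delta> where \<delta>: "\<delta> > 0" "\<And>y. \<bar>y - x\<bar> < \<delta> \<Longrightarrow> \<bar>h y - h x - D * (y - x)\<bar> \<le> e * \<bar>y - x\<bar>"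
    using assms(1,3) unfolding has_field_derivative_def has_derivative_at_alt by (auto simp: mult.commute)
  have "h v - h u \<le> (c + e) * (v - u)" if "u \<le> x" "x \<le> v" "v - u < \<delta>" for u v
  proof -
    have "h v - h x \<le> D * (v - x) + e * (v - x)" using \<delta>(2)[of v] that by simp
    moreover have "h x - h u \<le> D * (x - u) + e * (x - u)"
      using \<delta>(2)[of u] that by (simp add: algebra_simps abs_le_iff)
    moreover have "D * (v - u) \<le> c * (v - u)" using that assms(2) by (intro mult_right_mono) auto
    ultimately show ?thesis by (simp add: algebra_simps)
  qed
  with \<delta>(1) show ?thesis by blast
qed

text \<open>A substitute for the derivative of the arc length: chords are no longer than arcs, so
  this bounds the increments of arc length around \<open>x\<close> from below.\<close>

lemma norm_increment_ge_deriv: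
  fixes z :: "real \<Rightarrow> 'a::real_normed_vector"
  assumes "(z has_vector_derivative w) (at x)" "e > 0"
  shows "\<exists>\<delta>>0. \<forall>y. \<bar>y - x\<bar> < \<delta> \<longrightarrow> (norm w - e) * \<bar>y - x\<bar> \<le> norm (z y - z x)"
proof -
  obtain \<delta> where \<delta>: "\<delta> > 0" "\<And>y. \<bar>y - x\<bar> < \<delta> \<Longrightarrow> norm (z y - z x - (y - x) *\<^sub>R w) \<le> e * \<bar>y - x\<bar>"
    using assms unfolding has_vector_derivative_def has_derivative_at_alt by auto
  have "(norm w - e) * \<bar>y - x\<bar> \<le> norm (z y - z x)" if "\<bar>y - x\<bar> < \<delta>" for y
  proof -
    have "norm ((y - x) *\<^sub>R w) - norm (z y - z x) \<le> norm (z y - z x - (y - x) *\<^sub>R w)"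
      by (metis norm_minus_commute norm_triangle_ineq2)
    with \<delta>(2)[OF that] have "\<bar>y - x\<bar> * norm w - norm (z y - z x) \<le> e * \<bar>y - x\<bar>"
      unfolding norm_scaleR by linarith
    moreover have "(norm w - e) * \<bar>y - x\<bar> = \<bar>y - x\<bar> * norm w - e * \<bar>y - x\<bar>"
      by (simp add: algebra_simps)
    ultimately show ?thesis by linarith
  qed
  with \<delta>(1) show ?thesis by blast
qed

section \<open>Calibration of horizontal curves\<close>

text \<open>The complex structure, with the sign for which a horizontal vector at \<open>z\<close>
  with projection \<open>w\<close> has vertical component
  \<open>2 * (rotJ z \<bullet> w)\<close>.\<close>

definition rotJ :: "(complex, 'n::finite) vec \<Rightarrow> (complex, 'n) vec" where
  "rotJ z = (\<chi> j. - \<i> * z $ j)"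

lemma inner_rotJ: "rotJ z \<bullet> w = (\<Sum>j\<in>UNIV. Im (z $ j) * Re (w $ j) - Re (z $ j) * Im (w $ j))"
  by (simp add: rotJ_def inner_vec_def inner_complex_def)

lemma inner_rotJ_self [simp]: "rotJ z \<bullet> z = 0"
  by (simp add: inner_rotJ)

lemma norm_rotJ [simp]: "norm (rotJ z) = norm z"
  by (simp add: rotJ_def norm_vec_def L2_set_def norm_mult)

lemma vert_coord_rotJ: "vert_coord p v = snd v - 2 * (rotJ (fst p) \<bullet> fst v)"
  by (simp add: vert_coord_def inner_rotJ sum_distrib_left algebra_simps sum_subtractf)

lemma vert_coord_horizontal:
  assumes "v \<in> span (range (\<lambda>j. fieldX j p) \<union> range (\<lambda>j. fieldY j p))"
  shows "vert_coord p v = 0"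
  using assms
proof (induction rule: span_induct_alt)
  case base show ?case by (simp add: vert_coord_def)
next
  case (step c x y)
  have "vert_coord p x = 0" using step(1) vert_coord_frame by fastforce
  moreover have "vert_coord p (c *\<^sub>R x + y) = c * vert_coord p x + vert_coord p y"
    by (simp add: vert_coord_rotJ inner_add_right algebra_simps)
  ultimately show ?case using step(2) by simp
qed

lemma riem_norm_horizontal:
  "vert_coord p v = 0 \<Longrightarrow> riem_norm p v = norm (fst v)"
  by (simp add: riem_norm_def riem_inner_def norm_eq_sqrt_inner)

text \<open>\<open>z\<close> and \<open>rotJ z\<close> are orthogonal and equally long, so
  \<open>q\<^sup>2 = (1 + c\<^sup>2) * (norm z)\<^sup>2\<close> for the length \<open>q\<close> of
  the vector paired with \<open>w\<close>. The rest is Cauchy-Schwarz and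
  \<open>2 * q \<le> 1 / k + k * q\<^sup>2\<close>. It expresses that the calibration does not
  decrease when arc length grows at speed \<open>norm w\<close>.\<close>

lemma horizontal_slope_bound:
  fixes z w :: "(complex, 'n::finite) vec"
  assumes "k > 0" "\<bar>s\<bar> = (1::real)"
  shows "2 * c * (z \<bullet> w) + 2 * s * (rotJ z \<bullet> w) \<le> (1 / k + k * (1 + c\<^sup>2) * (norm z)\<^sup>2) * norm w"
proof -
  define q where "q = norm (c *\<^sub>R z + s *\<^sub>R rotJ z)"
  have s2: "s * s = 1" using assms(2) by (metis abs_mult_self_eq mult_1)
  have "q\<^sup>2 = (1 + c\<^sup>2) * (norm z)\<^sup>2"
  proof -
    have "q\<^sup>2 = c * c * (z \<bullet> z) + s * s * (rotJ z \<bullet> rotJ z)"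
      unfolding q_def power2_norm_eq_inner
      by (simp add: inner_add_left inner_add_right inner_commute[of z "rotJ z"])
    also have "rotJ z \<bullet> rotJ z = (norm z)\<^sup>2" by (simp flip: power2_norm_eq_inner)
    finally show ?thesis
      by (simp add: s2 power2_norm_eq_inner algebra_simps power2_eq_square[of c])
  qed
  moreover have "2 * q \<le> 1 / k + k * q\<^sup>2"
  proof -
    have "0 \<le> (1 - k * q)\<^sup>2 / k" using assms(1) by simp
    also have "\<dots> = 1 / k + k * q\<^sup>2 - 2 * q"
      using assms(1) by (simp add: power2_eq_square field_simps)
    finally show ?thesis by simp
  qed
  ultimately have "2 * q * norm w \<le> (1 / k + k * (1 + c\<^sup>2) * (norm z)\<^sup>2) * norm w"
    by (intro mult_right_mono) (auto simp: mult.assoc)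
  moreover have "(c *\<^sub>R z + s *\<^sub>R rotJ z) \<bullet> w \<le> q * norm w"
    unfolding q_def by (rule norm_cauchy_schwarz)
  ultimately show ?thesis by (simp add: inner_add_left)
qed

lemma horizontal_curve_regular:
  assumes "horizontal_curve a b \<gamma>"
  obtains N where "negligible N"
    "\<And>s. s \<in> {a..b} \<Longrightarrow> s \<notin> N \<Longrightarrow> (\<gamma> has_vector_derivative vector_derivative \<gamma> (at s)) (at s) \<and>
      vert_coord (\<gamma> s) (vector_derivative \<gamma> (at s)) = 0"
proof -
  have "AE s in lebesgue. s \<in> {a..b} \<longrightarrow>
       (\<exists>v \<in> span (range (\<lambda>j. fieldX j (\<gamma> s)) \<union> range (\<lambda>j. fieldY j (\<gamma> s))).
          (\<gamma> has_vector_derivative v) (at s))"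
    using assms by (simp add: horizontal_curve_def)
  then obtain N where N: "N \<in> null_sets lebesgue" "\<And>s. s \<notin> N \<Longrightarrow> s \<in> {a..b} \<Longrightarrow>
       (\<exists>v \<in> span (range (\<lambda>j. fieldX j (\<gamma> s)) \<union> range (\<lambda>j. fieldY j (\<gamma> s))).
          (\<gamma> has_vector_derivative v) (at s))"
    by (rule AE_E3) auto
  show thesis
  proof
    show "negligible N" using N(1) by (simp add: negligible_iff_null_sets)
    fix s assume "s \<in> {a..b}" "s \<notin> N"
    then obtain v where v: "v \<in> span (range (\<lambda>j. fieldX j (\<gamma> s)) \<union> range (\<lambda>j. fieldY j (\<gamma> s)))"
      "(\<gamma> has_vector_derivative v) (at s)" using N(2) by blast
    then show "(\<gamma> has_vector_derivative vector_derivative \<gamma> (at s)) (at s) \<and>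
      vert_coord (\<gamma> s) (vector_derivative \<gamma> (at s)) = 0"
      using vert_coord_horizontal[OF v(1)] vector_derivative_at[OF v(2)] by simp
  qed
qed

text \<open>
  The hypothesis on \<open>c\<close> is the Riccati equation of \<open>cot (k x + \<eta>)\<close>; the shift \<open>\<eta> > 0\<close> avoids the pole
  at the start of the curve. The arc length \<open>l\<close> enters through \<open>\<bar>z(v) - z(u)\<bar> \<le> l(v) - l(u)\<close>
  only, since \<open>\<Phi>\<close> is nondecreasing in it.
\<close>

lemma horizontal_curve_calibration:
  fixes \<gamma> :: "real \<Rightarrow> 'n::finite heis" and c :: "real \<Rightarrow> real"
  assumes ab: "a \<le> b" and hor: "horizontal_curve a b \<gamma>" and len: "has_riem_length a b \<gamma> L"
    and start: "\<gamma> a = 0" and k: "k > 0" and s: "\<bar>s\<bar> = (1::real)"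
    and c: "\<And>x. x \<in> {0..L} \<Longrightarrow> (c has_real_derivative - k * (1 + (c x)\<^sup>2)) (at x)"
  shows "s * snd (\<gamma> b) \<le> L / k - c L * (norm (fst (\<gamma> b)))\<^sup>2"
proof -
  define f where "f x = riem_norm (\<gamma> x) (vector_derivative \<gamma> (at x))" for x
  define l where "l x = integral {a..x} f" for x
  define z where "z x = fst (\<gamma> x)" for x
  define t where "t x = snd (\<gamma> x)" for x
  obtain N where N: "negligible N" and
    reg: "\<And>x. x \<in> {a..b} \<Longrightarrow> x \<notin> N \<Longrightarrow> (\<gamma> has_vector_derivative vector_derivative \<gamma> (at x)) (at x) \<and>
      vert_coord (\<gamma> x) (vector_derivative \<gamma> (at x)) = 0"
    using horizontal_curve_regular[OF hor] by metis
  define w where "w x = fst (vector_derivative \<gamma> (at x))" for x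
  have zder: "(z has_vector_derivative w x) (at x)" if "x \<in> {a..b}" "x \<notin> N" for x
    unfolding z_def w_def using reg[OF that]
    by (intro bounded_linear.has_vector_derivative[OF bounded_linear_fst]) simp
  have tder: "(t has_real_derivative 2 * (rotJ (z x) \<bullet> w x)) (at x)" if "x \<in> {a..b}" "x \<notin> N" for x
  proof -
    have "(t has_vector_derivative snd (vector_derivative \<gamma> (at x))) (at x)"
      unfolding t_def using reg[OF that]
      by (intro bounded_linear.has_vector_derivative[OF bounded_linear_snd]) simp
    then show ?thesis
      using reg[OF that] by (simp add: has_real_derivative_iff_has_vector_derivative vert_coord_rotJ z_def w_def)
  qed
  have fw: "f x = norm (w x)" if "x \<in> {a..b}" "x \<notin> N" for x
    using reg[OF that] by (simp add: f_def w_def riem_norm_horizontal)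
  have ac: "abs_cont_on a b \<gamma>" using hor by (simp add: horizontal_curve_def)
  have fint: "(f has_integral L) {a..b}" using len by (simp add: has_riem_length_def f_def[abs_def])
  have fi: "f integrable_on {u..v}" if "a \<le> u" "v \<le> b" for u v
    using fint that by (auto intro: integrable_subinterval_real)
  have f0: "0 \<le> f x" for x
    by (simp add: f_def riem_norm_def riem_inner_def)
  have ldiff: "l v - l u = integral {u..v} f" if "a \<le> u" "u \<le> v" "v \<le> b" for u v
  proof -
    have "integral {a..u} f + integral {u..v} f = integral {a..v} f"
      using that by (intro Henstock_Kurzweil_Integration.integral_combine fi) auto
    then show ?thesis by (simp add: l_def)
  qed
  have lmono: "l u \<le> l v" if "a \<le> u" "u \<le> v" "v \<le> b" for u v
  proof -
    have "0 \<le> integral {u..v} f"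
      by (intro Henstock_Kurzweil_Integration.integral_nonneg fi that f0)
    then show ?thesis using ldiff[OF that] by simp
  qed
  have la: "l a = 0" by (simp add: l_def)
  have lb: "l b = L" using fint by (simp add: l_def integral_unique)
  have l01: "l u \<in> {0..L}" if "u \<in> {a..b}" for u
    using lmono[of a u] lmono[of u b] that la lb by auto
  have zl: "norm (z v - z u) \<le> l v - l u" if uv: "a \<le> u" "u \<le> v" "v \<le> b" for u v
  proof (cases "z v = z u")
    case True then show ?thesis using lmono[OF uv] by simp
  next
    case False
    \<comment> \<open>A unit vector along the chord turns the chord length into the increment of a
      real function whose slope is at most the speed.\<close>
    define e where "e = (z v - z u) /\<^sub>R norm (z v - z u)"
    have e1: "norm e = 1" using False by (simp add: e_def)
    define h where "h x = e \<bullet> z x" for x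
    have "small_var \<gamma> N u v"
      by (rule small_var_abs_cont[OF abs_cont_on_subset[OF ac] N]) (use uv in auto)
    then have "small_var h N u v"
    proof (rule small_var_combine)
      show "small_var \<gamma> N u v" by fact
      fix x y
      have "norm (h y - h x) \<le> norm e * norm (z y - z x)"
        unfolding h_def inner_diff_right[symmetric] real_norm_def by (rule Cauchy_Schwarz_ineq2)
      also have "norm (z y - z x) \<le> norm (\<gamma> y - \<gamma> x)"
        unfolding z_def by (metis fst_diff norm_fst_le prod.collapse)
      finally show "norm (h y - h x) \<le> 1 * (norm (\<gamma> y - \<gamma> x) + norm (\<gamma> y - \<gamma> x))"
        using e1 by (simp add: add_increasing)
    qed
    then have "h v - h u \<le> integral {u..v} f"
    proof (rule increment_le_integral[OF uv(2) integrable_integral[OF fi[OF uv(1,3)]] N])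
      fix x \<epsilon> :: real assume x: "x \<in> {u..v}" "x \<notin> N" "\<epsilon> > 0"
      then have x': "x \<in> {a..b}" using uv by auto
      have "(h has_real_derivative e \<bullet> w x) (at x)"
        unfolding h_def has_real_derivative_iff_has_vector_derivative
        by (rule bounded_linear.has_vector_derivative[OF bounded_linear_inner_right zder[OF x' x(2)]])
      moreover have "e \<bullet> w x \<le> f x"
        unfolding fw[OF x' x(2)] using norm_cauchy_schwarz[of e "w x"] e1 by simp
      ultimately show "\<exists>\<delta>>0. \<forall>u' v'. u \<le> u' \<and> u' \<le> x \<and> x \<le> v' \<and> v' \<le> v \<and> v' - u' < \<delta> \<longrightarrow>
         h v' - h u' \<le> (f x + \<epsilon>) * (v' - u')"
        using increment_bound_deriv[of h "e \<bullet> w x" x "f x" \<epsilon>] x(3) by blast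
    qed
    moreover have "h v - h u = norm (z v - z u)"
      unfolding h_def inner_diff_right[symmetric] e_def
      using False by (simp add: power2_norm_eq_inner[symmetric] power2_eq_square)
    ultimately show ?thesis using ldiff[OF uv] by simp
  qed
  have za: "z a = 0" "t a = 0" using start by (simp_all add: z_def t_def zero_prod_def)
  have L0: "0 \<le> L" using l01[of a] ab by auto
  have zL: "norm (z u) \<le> L" if "u \<in> {a..b}" for u
    using zl[of a u] za la l01[OF that] that by auto
  have ccont: "continuous_on {0..L} c"
    using c by (intro continuous_at_imp_continuous_on ballI) (meson DERIV_isCont)
  then have "bounded (c ` {0..L})"
    by (intro compact_imp_bounded compact_continuous_image) auto
  then obtain B where "\<forall>y\<in>c ` {0..L}. norm y \<le> B"
    unfolding bounded_iff by blast
  then have B: "\<bar>c x\<bar> \<le> B" if "x \<in> {0..L}" for x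
    using that by auto
  have B0: "0 \<le> B" using B[of 0] L0 by auto
  have clip: "\<bar>c y - c x\<bar> \<le> k * (1 + B\<^sup>2) * \<bar>y - x\<bar>" if "x \<in> {0..L}" "y \<in> {0..L}" for x y
  proof -
    have "norm (c y - c x) \<le> k * (1 + B\<^sup>2) * norm (y - x)"
    proof (rule field_differentiable_bound[where S = "{0..L}" and f' = "\<lambda>x. - k * (1 + (c x)\<^sup>2)"])
      fix u assume u: "u \<in> {0..L}"
      show "(c has_field_derivative - k * (1 + (c u)\<^sup>2)) (at u within {0..L})"
        using c[OF u] by (rule has_field_derivative_at_within)
      have "(c u)\<^sup>2 \<le> B\<^sup>2" using B[OF u] by (metis abs_ge_zero power2_abs power_mono)
      then show "norm (- k * (1 + (c u)\<^sup>2)) \<le> k * (1 + B\<^sup>2)"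
        using k by (simp add: abs_mult)
    qed (use that in auto)
    then show ?thesis by simp
  qed
  define \<Phi> where "\<Phi> y x = y / k - c y * (norm (z x))\<^sup>2 - s * t x" for y x
  define F where "F x = - \<Phi> (l x) x" for x
  have \<Phi>mono: "\<Phi> y x \<le> \<Phi> y' x" if "0 \<le> y" "y \<le> y'" "y' \<le> L" for y y' x
  proof (rule DERIV_nonneg_imp_nondecreasing[OF that(2)])
    fix u assume u: "y \<le> u" "u \<le> y'"
    have "((\<lambda>y. \<Phi> y x) has_real_derivative (1 / k - (- k * (1 + (c u)\<^sup>2)) * (norm (z x))\<^sup>2)) (at u)"
      unfolding \<Phi>_def using k u that by (auto intro!: derivative_eq_intros c)
    moreover have "0 \<le> 1 / k - (- k * (1 + (c u)\<^sup>2)) * (norm (z x))\<^sup>2"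
      using k by simp
    ultimately show "\<exists>D. ((\<lambda>y. \<Phi> y x) has_real_derivative D) (at u) \<and> 0 \<le> D" by blast
  qed
  have sv: "small_var F N a b"
  proof (rule small_var_combine[OF small_var_abs_cont[OF ac N] small_var_integral[OF fi[OF order_refl order_refl] N]])
    fix u v assume u: "u \<in> {a..b}" and v: "v \<in> {a..b}"
    define G where "G = norm (\<gamma> v - \<gamma> u)"
    define H where "H = \<bar>l v - l u\<bar>"
    have zG: "norm (z v - z u) \<le> G"
      unfolding z_def G_def by (metis fst_diff norm_fst_le prod.collapse)
    have tG: "\<bar>t v - t u\<bar> \<le> G"
      unfolding t_def G_def by (metis snd_diff norm_snd_le prod.collapse real_norm_def)
    have G0: "0 \<le> G" "0 \<le> H" by (simp_all add: G_def H_def)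
    have sq: "\<bar>(norm (z v))\<^sup>2 - (norm (z u))\<^sup>2\<bar> \<le> 2 * L * G"
    proof -
      have "\<bar>(norm (z v))\<^sup>2 - (norm (z u))\<^sup>2\<bar> = (norm (z v) + norm (z u)) * \<bar>norm (z v) - norm (z u)\<bar>"
        by (simp add: power2_eq_square square_diff_square_factored abs_mult)
      also have "\<dots> \<le> (2 * L) * G"
        using zL[OF u] zL[OF v] norm_triangle_ineq3[of "z v" "z u"] zG L0 by (intro mult_mono) auto
      finally show ?thesis .
    qed
    have "\<bar>c (l v) * (norm (z v))\<^sup>2 - c (l u) * (norm (z u))\<^sup>2\<bar>
        = \<bar>(c (l v) - c (l u)) * (norm (z v))\<^sup>2 + c (l u) * ((norm (z v))\<^sup>2 - (norm (z u))\<^sup>2)\<bar>"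
      by (simp add: algebra_simps)
    also have "\<dots> \<le> \<bar>c (l v) - c (l u)\<bar> * (norm (z v))\<^sup>2 + \<bar>c (l u)\<bar> * \<bar>(norm (z v))\<^sup>2 - (norm (z u))\<^sup>2\<bar>"
      by (rule order_trans[OF abs_triangle_ineq]) (simp add: abs_mult)
    also have "\<dots> \<le> (k * (1 + B\<^sup>2) * H) * L\<^sup>2 + B * (2 * L * G)"
      unfolding H_def using clip[OF l01[OF u] l01[OF v]] B[OF l01[OF u]] zL[OF v] sq B0 k
      by (intro add_mono mult_mono power_mono) auto
    finally have 1: "\<bar>c (l v) * (norm (z v))\<^sup>2 - c (l u) * (norm (z u))\<^sup>2\<bar> \<le> (k * (1 + B\<^sup>2) * L\<^sup>2) * H + 2 * B * L * G"
      by (simp add: algebra_simps)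
    have 2: "\<bar>s * t v - s * t u\<bar> \<le> G"
      using tG s by (simp add: abs_mult flip: right_diff_distrib)
    have 3: "\<bar>l v / k - l u / k\<bar> = (1 / k) * H"
      using k by (simp add: H_def abs_divide flip: diff_divide_distrib)
    define C where "C = 1 / k + k * (1 + B\<^sup>2) * L\<^sup>2 + 2 * B * L + 1"
    have "norm (F v - F u) \<le> (1 / k + k * (1 + B\<^sup>2) * L\<^sup>2) * H + (2 * B * L + 1) * G"
      using 1 2 3 unfolding F_def \<Phi>_def real_norm_def by (simp add: algebra_simps) 
    also have "\<dots> \<le> C * H + C * G"
      using k B0 L0 G0 by (intro add_mono mult_right_mono) (auto simp: C_def)
    finally show "norm (F v - F u) \<le> (1 / k + k * (1 + B\<^sup>2) * L\<^sup>2 + 2 * B * L + 1) *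
        (norm (\<gamma> v - \<gamma> u) + norm (integral {a..v} f - integral {a..u} f))"
      by (simp add: C_def G_def H_def l_def algebra_simps)
  qed
  have "F b - F a \<le> 0"
  proof (rule increment_le_integral[OF ab has_integral_0 N sv])
    fix x e :: real assume x: "x \<in> {a..b}" "x \<notin> N" "e > 0"
    define A where "A = 1 / k + k * (1 + (c (l x))\<^sup>2) * (norm (z x))\<^sup>2"
    have A: "A > 0" using k by (auto simp: A_def intro!: add_pos_nonneg)
    define \<epsilon> where "\<epsilon> = e / (2 * A)"
    have \<epsilon>: "\<epsilon> > 0" "A * \<epsilon> = e / 2" using A x(3) by (auto simp: \<epsilon>_def)
    \<comment> \<open>\<open>l\<close> need not be differentiable at \<open>x\<close>. Near
      \<open>x\<close> it lies above the line \<open>l x + m * (y - x)\<close> on the right and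
      below it on the left, so the increments of \<open>F\<close> across \<open>x\<close> are at
      most those of \<open>\<psi>\<close>, which is differentiable at \<open>x\<close>. The
      \<open>max 0\<close> keeps the line within \<open>{0..L}\<close>, where \<open>\<Phi>\<close>
      is monotone.\<close>
    define m where "m = max 0 (norm (w x) - \<epsilon>)"
    define \<psi> where "\<psi> y = - \<Phi> (l x + m * (y - x)) y" for y
    obtain \<delta>1 where \<delta>1: "\<delta>1 > 0" "\<And>y. \<bar>y - x\<bar> < \<delta>1 \<Longrightarrow> (norm (w x) - \<epsilon>) * \<bar>y - x\<bar> \<le> norm (z y - z x)"
      using norm_increment_ge_deriv[OF zder[OF x(1,2)] \<epsilon>(1)] by blast
    have sqder: "((\<lambda>y. (norm (z y))\<^sup>2) has_real_derivative 2 * (z x \<bullet> w x)) (at x)"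
    proof -
      have "((\<lambda>y. z y \<bullet> z y) has_vector_derivative (z x \<bullet> w x + w x \<bullet> z x)) (at x)"
        by (rule bounded_bilinear.has_vector_derivative[OF bounded_bilinear_inner zder[OF x(1,2)] zder[OF x(1,2)]])
      then show ?thesis
        by (simp add: has_real_derivative_iff_has_vector_derivative power2_norm_eq_inner inner_commute)
    qed
    have cder: "((\<lambda>y. c (l x + m * (y - x))) has_real_derivative (- k * (1 + (c (l x))\<^sup>2)) * m) (at x)"
    proof -
      have "((\<lambda>y. l x + m * (y - x)) has_real_derivative m) (at x)"
        by (auto intro!: derivative_eq_intros)
      then show ?thesis
        using DERIV_chain2[of c "- k * (1 + (c (l x))\<^sup>2)" "\<lambda>y. l x + m * (y - x)" x m UNIV] c[OF l01[OF x(1)]]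
        by simp
    qed
    have "(\<psi> has_real_derivative - (m / k - ((- k * (1 + (c (l x))\<^sup>2)) * m * (norm (z x))\<^sup>2 + 2 * (z x \<bullet> w x) * c (l x))
        - s * (2 * (rotJ (z x) \<bullet> w x)))) (at x)"
    proof -
      have lin: "((\<lambda>y. (l x + m * (y - x)) / k) has_real_derivative m / k) (at x)"
        using k by (auto intro!: derivative_eq_intros)
      have prod: "((\<lambda>y. c (l x + m * (y - x)) * (norm (z y))\<^sup>2) has_real_derivative
          (- k * (1 + (c (l x))\<^sup>2)) * m * (norm (z x))\<^sup>2 + 2 * (z x \<bullet> w x) * c (l x)) (at x)"
        using DERIV_mult[OF cder sqder] by simp
      show ?thesis
        unfolding \<psi>_def \<Phi>_def
        by (intro DERIV_minus DERIV_diff lin prod DERIV_cmult tder[OF x(1,2)])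
    qed
    also have "- (m / k - ((- k * (1 + (c (l x))\<^sup>2)) * m * (norm (z x))\<^sup>2 + 2 * (z x \<bullet> w x) * c (l x))
        - s * (2 * (rotJ (z x) \<bullet> w x))) = - (A * m - 2 * c (l x) * (z x \<bullet> w x) - 2 * s * (rotJ (z x) \<bullet> w x))"
      unfolding A_def by (simp add: algebra_simps)
    finally have \<psi>der: "(\<psi> has_real_derivative - (A * m - 2 * c (l x) * (z x \<bullet> w x) - 2 * s * (rotJ (z x) \<bullet> w x))) (at x)" .
    have "A * (norm (w x) - \<epsilon>) \<le> A * m" using A by (intro mult_left_mono) (auto simp: m_def)
    moreover have "2 * c (l x) * (z x \<bullet> w x) + 2 * s * (rotJ (z x) \<bullet> w x) \<le> A * norm (w x)"
      unfolding A_def by (rule horizontal_slope_bound[OF k s])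
    ultimately have "- (A * m - 2 * c (l x) * (z x \<bullet> w x) - 2 * s * (rotJ (z x) \<bullet> w x)) \<le> e / 2"
      using \<epsilon>(2) by (simp add: algebra_simps)
    from increment_bound_deriv[OF \<psi>der this, of "e / 2"] x(3)
    obtain \<delta>2 where \<delta>2: "\<delta>2 > 0" "\<And>u v. u \<le> x \<Longrightarrow> x \<le> v \<Longrightarrow> v - u < \<delta>2 \<Longrightarrow> \<psi> v - \<psi> u \<le> e * (v - u)"
      by auto
    show "\<exists>\<delta>>0. \<forall>u v. a \<le> u \<and> u \<le> x \<and> x \<le> v \<and> v \<le> b \<and> v - u < \<delta> \<longrightarrow> F v - F u \<le> (0 + e) * (v - u)"
    proof (intro exI[of _ "min \<delta>1 \<delta>2"] conjI allI impI)
      show "min \<delta>1 \<delta>2 > 0" using \<delta>1 \<delta>2 by simp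
      fix u v assume "a \<le> u \<and> u \<le> x \<and> x \<le> v \<and> v \<le> b \<and> v - u < min \<delta>1 \<delta>2"
      then have uv: "a \<le> u" "u \<le> x" "x \<le> v" "v \<le> b" "v - u < \<delta>1" "v - u < \<delta>2" by auto
      have "m * (v - x) \<le> l v - l x"
      proof (cases "norm (w x) - \<epsilon> \<le> 0")
        case True then show ?thesis using lmono[of x v] uv x(1) by (simp add: m_def)
      next
        case False
        then have "m * (v - x) \<le> norm (z v - z x)" using \<delta>1(2)[of v] uv by (simp add: m_def)
        then show ?thesis using zl[of x v] uv x(1) by simp
      qed
      then have v1: "F v \<le> \<psi> v"
        unfolding F_def \<psi>_def using l01[OF x(1)] l01[of v] uv by (auto intro!: \<Phi>mono simp: m_def)
      have "m * (x - u) \<le> l x - l u"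
      proof (cases "norm (w x) - \<epsilon> \<le> 0")
        case True then show ?thesis using lmono[of u x] uv x(1) by (simp add: m_def)
      next
        case False
        then have "m * (x - u) \<le> norm (z u - z x)" using \<delta>1(2)[of u] uv by (simp add: m_def)
        then show ?thesis using zl[of u x] uv x(1) by (simp add: norm_minus_commute)
      qed
      moreover have "0 \<le> m * (x - u)" using uv by (simp add: m_def)
      ultimately have u1: "\<psi> u \<le> F u"
        unfolding F_def \<psi>_def using l01[OF x(1)] l01[of u] uv by (auto intro!: \<Phi>mono simp: algebra_simps)
      show "F v - F u \<le> (0 + e) * (v - u)"
        using v1 u1 \<delta>2(2)[of u v] uv by simp
    qed
  qed
  then show ?thesis
    by (simp add: F_def \<Phi>_def la lb za algebra_simps) (simp add: z_def t_def)
qed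

section \<open>Complex multiples of a vector, and Lipschitz images of absolutely continuous
  functions\<close>

lemma heis_mult_rotJ:
  "p \<odot> q = (fst p + fst q, snd p + snd q + 2 * (rotJ (fst p) \<bullet> fst q))"
  by (simp add: heis_mult_def inner_rotJ algebra_simps)

lemma rotJ_add: "rotJ (z + w) = rotJ z + rotJ w"
  by (simp add: rotJ_def vec_eq_iff algebra_simps)

lemma rotJ_minus: "rotJ (- z) = - rotJ z"
  by (simp add: rotJ_def vec_eq_iff)

lemma norm_vector_scalar_mult:
  fixes w :: "(complex, 'n::finite) vec"
  shows "norm (a *s w) = norm a * norm w"
  by (simp add: norm_vec_def norm_mult L2_set_def power_mult_distrib real_sqrt_mult flip: sum_distrib_left)

lemma inner_rotJ_scalar_mult:
  fixes w :: "(complex, 'n::finite) vec"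
  shows "rotJ (a *s w) \<bullet> (c *s w) = Im (a * cnj c) * (norm w)\<^sup>2"
proof -
  have "(norm w)\<^sup>2 = (\<Sum>j\<in>UNIV. (Re (w $ j))\<^sup>2 + (Im (w $ j))\<^sup>2)"
    unfolding power2_norm_eq_inner by (simp add: inner_vec_def inner_complex_def power2_eq_square)
  then have "Im (a * cnj c) * (norm w)\<^sup>2 = (\<Sum>j\<in>UNIV. Im (a * cnj c) * ((Re (w $ j))\<^sup>2 + (Im (w $ j))\<^sup>2))"
    by (simp only: sum_distrib_left)
  also have "\<dots> = rotJ (a *s w) \<bullet> (c *s w)"
    unfolding inner_rotJ by (intro sum.cong refl) (simp add: algebra_simps power2_eq_square)
  finally show ?thesis by simp
qed

lemma bounded_linear_scalar_mult: "bounded_linear (\<lambda>a. a *s (w :: (complex, 'n::finite) vec))"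
  by (rule linear_conv_bounded_linear[THEN iffD1], rule linearI) (simp_all add: vec_eq_iff algebra_simps)

lemma abs_cont_on_lipschitz:
  fixes f :: "real \<Rightarrow> 'a::real_normed_vector" and g :: "real \<Rightarrow> 'b::real_normed_vector"
  assumes "abs_cont_on a b f"
    and "\<And>u v. u \<in> {a..b} \<Longrightarrow> v \<in> {a..b} \<Longrightarrow> norm (g v - g u) \<le> C * norm (f v - f u)"
  shows "abs_cont_on a b g"
  unfolding abs_cont_on_def
proof (intro allI impI)
  fix e :: real assume e: "e > 0"
  define C' where "C' = max C 1"
  have C': "C' > 0" "C \<le> C'" by (auto simp: C'_def)
  have "e / C' > 0" using e C' by simp
  from assms(1)[unfolded abs_cont_on_def, rule_format, OF this]
  obtain \<delta> where "\<delta> > 0" and \<delta>: "\<forall>I. finite I \<and> (\<forall>(u, v)\<in>I. a \<le> u \<and> u \<le> v \<and> v \<le> b) \<and>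
       pairwise (\<lambda>(u, v) (u', v'). {u<..<v} \<inter> {u'<..<v'} = {}) I \<and>
       (\<Sum>(u, v)\<in>I. v - u) < \<delta> \<longrightarrow> (\<Sum>(u, v)\<in>I. norm (f v - f u)) < e / C'"
    by blast
  show "\<exists>\<delta>>0. \<forall>I. finite I \<and> (\<forall>(u, v)\<in>I. a \<le> u \<and> u \<le> v \<and> v \<le> b) \<and>
       pairwise (\<lambda>(u, v) (u', v'). {u<..<v} \<inter> {u'<..<v'} = {}) I \<and>
       (\<Sum>(u, v)\<in>I. v - u) < \<delta> \<longrightarrow> (\<Sum>(u, v)\<in>I. norm (g v - g u)) < e"
  proof (intro exI[of _ \<delta>] conjI allI impI)
    fix I assume I: "finite I \<and> (\<forall>(u, v)\<in>I. a \<le> u \<and> u \<le> v \<and> v \<le> b) \<and>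
       pairwise (\<lambda>(u, v) (u', v'). {u<..<v} \<inter> {u'<..<v'} = {}) I \<and> (\<Sum>(u, v)\<in>I. v - u) < \<delta>"
    have "(\<Sum>(u, v)\<in>I. norm (g v - g u)) \<le> (\<Sum>(u, v)\<in>I. C' * norm (f v - f u))"
    proof (rule sum_mono, clarify)
      fix u v assume "(u, v) \<in> I"
      then have "a \<le> u" "u \<le> v" "v \<le> b" using I by auto
      then have "norm (g v - g u) \<le> C * norm (f v - f u)" by (intro assms(2)) auto
      also have "\<dots> \<le> C' * norm (f v - f u)" using C' by (intro mult_right_mono) auto
      finally show "norm (g v - g u) \<le> C' * norm (f v - f u)" .
    qed
    also have "\<dots> = C' * (\<Sum>(u, v)\<in>I. norm (f v - f u))" by (simp add: sum_distrib_left case_prod_beta)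
    also have "\<dots> < C' * (e / C')" using I \<delta> C' by (intro mult_strict_left_mono) auto
    also have "\<dots> = e" using C' by simp
    finally show "(\<Sum>(u, v)\<in>I. norm (g v - g u)) < e" .
  qed (rule \<open>\<delta> > 0\<close>)
qed

lemma abs_cont_on_id: "abs_cont_on a b (\<lambda>s::real. s)"
  unfolding abs_cont_on_def
proof (intro allI impI)
  fix e :: real assume e: "e > 0"
  show "\<exists>\<delta>>0. \<forall>I. finite I \<and> (\<forall>(u, v)\<in>I. a \<le> u \<and> u \<le> v \<and> v \<le> b) \<and>
       pairwise (\<lambda>(u, v) (u', v'). {u<..<v} \<inter> {u'<..<v'} = {}) I \<and>
       (\<Sum>(u, v)\<in>I. v - u) < \<delta> \<longrightarrow> (\<Sum>(u, v)\<in>I. norm (v - u)) < e"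
  proof (intro exI[of _ e] conjI allI impI)
    fix I :: "(real \<times> real) set" assume I: "finite I \<and> (\<forall>(u, v)\<in>I. a \<le> u \<and> u \<le> v \<and> v \<le> b) \<and>
       pairwise (\<lambda>(u, v) (u', v'). {u<..<v} \<inter> {u'<..<v'} = {}) I \<and> (\<Sum>(u, v)\<in>I. v - u) < e"
    have "(\<Sum>(u, v)\<in>I. norm (v - u)) = (\<Sum>(u, v)\<in>I. v - u)"
      using I by (intro sum.cong) auto
    then show "(\<Sum>(u, v)\<in>I. norm (v - u)) < e" using I by simp
  qed (rule e)
qed

section \<open>Left translations\<close>

lemma heis_mult_derivative:
  assumes "(\<gamma> has_vector_derivative v) (at s)"
  shows "((\<lambda>s. p \<odot> \<gamma> s) has_vector_derivative (fst v, snd v + 2 * (rotJ (fst p) \<bullet> fst v))) (at s)"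
proof -
  have f: "((\<lambda>s. fst (\<gamma> s)) has_vector_derivative fst v) (at s)"
    by (rule bounded_linear.has_vector_derivative[OF bounded_linear_fst assms])
  have g: "((\<lambda>s. snd (\<gamma> s)) has_vector_derivative snd v) (at s)"
    by (rule bounded_linear.has_vector_derivative[OF bounded_linear_snd assms])
  have h: "((\<lambda>s. 2 * (rotJ (fst p) \<bullet> fst (\<gamma> s))) has_vector_derivative 2 * (rotJ (fst p) \<bullet> fst v)) (at s)"
    by (rule bounded_linear.has_vector_derivative[OF bounded_linear_mult_right
          bounded_linear.has_vector_derivative[OF bounded_linear_inner_right f]])
  show ?thesis
    unfolding heis_mult_rotJ
    using has_vector_derivative_Pair[OF has_vector_derivative_add[OF has_vector_derivative_const f]
        has_vector_derivative_add[OF has_vector_derivative_add[OF has_vector_derivative_const g] h]]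
    by simp
qed

text \<open>The pair is the differential of the translation by \<open>p\<close>, applied to
  \<open>v\<close>. So the vertical covector is left invariant, and with it horizontality and
  length.\<close>

lemma vert_coord_translate:
  "vert_coord (p \<odot> q) (fst v, snd v + 2 * (rotJ (fst p) \<bullet> fst v)) = vert_coord q v"
  by (simp add: vert_coord_rotJ heis_mult_rotJ rotJ_add inner_add_left)

text \<open>Translations are affine, hence globally Lipschitz for the Euclidean norm; this carries
  absolute continuity over.\<close>

lemma norm_heis_mult_diff:
  "norm (p \<odot> q - p \<odot> r) \<le> (2 + 2 * norm (fst p)) * norm (q - r)"
proof -
  have "p \<odot> q - p \<odot> r = (fst (q - r), snd (q - r) + 2 * (rotJ (fst p) \<bullet> fst (q - r)))"
    by (simp add: heis_mult_rotJ inner_diff_right)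
  also have "norm \<dots> \<le> norm (fst (q - r)) + norm (snd (q - r) + 2 * (rotJ (fst p) \<bullet> fst (q - r)))"
    by (metis norm_Pair_le)
  also have "\<dots> \<le> norm (fst (q - r)) + (norm (snd (q - r)) + 2 * (norm (fst p) * norm (fst (q - r))))"
    using Cauchy_Schwarz_ineq2[of "rotJ (fst p)" "fst (q - r)"] by (simp add: abs_mult)
  also have "\<dots> \<le> norm (q - r) + (norm (q - r) + 2 * (norm (fst p) * norm (q - r)))"
  proof -
    have "norm (fst (q - r)) \<le> norm (q - r)" "norm (snd (q - r)) \<le> norm (q - r)"
      by (metis norm_fst_le prod.collapse, metis norm_snd_le prod.collapse)
    then show ?thesis by (intro add_mono mult_left_mono) auto
  qed
  finally show ?thesis by (simp add: algebra_simps)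
qed

lemma span_horizontal:
  assumes "vert_coord p v = 0"
  shows "v \<in> span (range (\<lambda>j. fieldX j p) \<union> range (\<lambda>j. fieldY j p))"
proof -
  have v: "v = (\<Sum>j\<in>UNIV. Re (fst v $ j) *\<^sub>R fieldX j p + Im (fst v $ j) *\<^sub>R fieldY j p)"
  proof (rule prod_eqI)
    show "fst v = fst (\<Sum>j\<in>UNIV. Re (fst v $ j) *\<^sub>R fieldX j p + Im (fst v $ j) *\<^sub>R fieldY j p)"
    proof -
      have "(\<Sum>j\<in>UNIV. Re (fst v $ j) *\<^sub>R axis j 1 + Im (fst v $ j) *\<^sub>R axis j \<i>) $ i = fst v $ i" for i
      proof -
        have "(\<Sum>j\<in>UNIV. Re (fst v $ j) *\<^sub>R axis j 1 + Im (fst v $ j) *\<^sub>R axis j \<i>) $ i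
          = (\<Sum>j\<in>UNIV. if j = i then Re (fst v $ i) *\<^sub>R 1 + Im (fst v $ i) *\<^sub>R \<i> else 0)"
          unfolding sum_component by (intro sum.cong refl) (simp add: axis_def)
        then show ?thesis by (simp add: complex_eq_iff)
      qed
      then show ?thesis
        by (simp add: fst_sum fieldX_def fieldY_def vec_eq_iff)
    qed
    show "snd v = snd (\<Sum>j\<in>UNIV. Re (fst v $ j) *\<^sub>R fieldX j p + Im (fst v $ j) *\<^sub>R fieldY j p)"
      using assms by (simp add: vert_coord_def snd_sum fieldX_def fieldY_def mult_ac)
  qed
  show ?thesis
    by (subst v, intro span_sum span_add span_mul) (auto intro: span_base)
qed

lemma horizontal_curve_translate:
  assumes "horizontal_curve a b \<gamma>"
  shows "horizontal_curve a b (\<lambda>s. p \<odot> \<gamma> s)"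
  unfolding horizontal_curve_def
proof
  show "abs_cont_on a b (\<lambda>s. p \<odot> \<gamma> s)"
    using assms unfolding horizontal_curve_def
    by (blast intro: abs_cont_on_lipschitz norm_heis_mult_diff)
  have "AE s in lebesgue. s \<in> {a..b} \<longrightarrow>
       (\<exists>v \<in> span (range (\<lambda>j. fieldX j (\<gamma> s)) \<union> range (\<lambda>j. fieldY j (\<gamma> s))).
          (\<gamma> has_vector_derivative v) (at s))"
    using assms by (simp add: horizontal_curve_def)
  then show "AE s in lebesgue. s \<in> {a..b} \<longrightarrow>
       (\<exists>v \<in> span (range (\<lambda>j. fieldX j (p \<odot> \<gamma> s)) \<union> range (\<lambda>j. fieldY j (p \<odot> \<gamma> s))).
          ((\<lambda>s. p \<odot> \<gamma> s) has_vector_derivative v) (at s))"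
  proof (rule AE_mp, intro AE_I2 impI)
    fix s assume "s \<in> {a..b} \<longrightarrow>
       (\<exists>v \<in> span (range (\<lambda>j. fieldX j (\<gamma> s)) \<union> range (\<lambda>j. fieldY j (\<gamma> s))).
          (\<gamma> has_vector_derivative v) (at s))" "s \<in> {a..b}"
    then obtain v where v: "v \<in> span (range (\<lambda>j. fieldX j (\<gamma> s)) \<union> range (\<lambda>j. fieldY j (\<gamma> s)))"
          "(\<gamma> has_vector_derivative v) (at s)" by blast
    show "\<exists>v \<in> span (range (\<lambda>j. fieldX j (p \<odot> \<gamma> s)) \<union> range (\<lambda>j. fieldY j (p \<odot> \<gamma> s))).
          ((\<lambda>s. p \<odot> \<gamma> s) has_vector_derivative v) (at s)"
    proof (rule bexI)
      show "((\<lambda>s. p \<odot> \<gamma> s) has_vector_derivative (fst v, snd v + 2 * (rotJ (fst p) \<bullet> fst v))) (at s)"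
        by (rule heis_mult_derivative[OF v(2)])
    qed (rule span_horizontal, simp add: vert_coord_translate vert_coord_horizontal[OF v(1)])
  qed
qed

lemma has_riem_length_translate:
  assumes "horizontal_curve a b \<gamma>" "has_riem_length a b \<gamma> L"
  shows "has_riem_length a b (\<lambda>s. p \<odot> \<gamma> s) L"
proof -
  obtain N where N: "negligible N" and
    reg: "\<And>s. s \<in> {a..b} \<Longrightarrow> s \<notin> N \<Longrightarrow> (\<gamma> has_vector_derivative vector_derivative \<gamma> (at s)) (at s) \<and>
      vert_coord (\<gamma> s) (vector_derivative \<gamma> (at s)) = 0"
    using horizontal_curve_regular[OF assms(1)] by metis
  have eq: "riem_norm (p \<odot> \<gamma> s) (vector_derivative (\<lambda>s. p \<odot> \<gamma> s) (at s)) = riem_norm (\<gamma> s) (vector_derivative \<gamma> (at s))"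
    if "s \<in> {a..b}" "s \<notin> N" for s
  proof -
    note r = reg[OF that]
    show ?thesis
      using vector_derivative_at[OF heis_mult_derivative[OF conjunct1[OF r]], of p]
      by (simp add: riem_norm_def riem_inner_def vert_coord_translate)
  qed
  show ?thesis
    unfolding has_riem_length_def
    by (rule has_integral_spike[OF N _ assms(2)[unfolded has_riem_length_def]]) (use eq in auto)
qed

section \<open>Piecewise smooth horizontal curves of unit speed\<close>

text \<open>Explicit curves for upper bounds of \<open>cc_dist\<close>. Unit speed makes the length
  of the parameter interval the Riemannian length; Lipschitz continuity and a finite exceptional set
  survive concatenation.\<close>

definition reach :: "'n::finite heis \<Rightarrow> 'n heis \<Rightarrow> real \<Rightarrow> bool" where
  "reach p q L \<longleftrightarrow> 0 \<le> L \<and> (\<exists>\<gamma> C S. C-lipschitz_on {0..L} \<gamma> \<and> \<gamma> 0 = p \<and> \<gamma> L = q \<and> finite S \<and>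
     (\<forall>s\<in>{0..L} - S. \<exists>v. (\<gamma> has_vector_derivative v) (at s) \<and> vert_coord (\<gamma> s) v = 0 \<and> norm (fst v) = 1))"

lemma reach_refl: "reach p p 0"
  unfolding reach_def
  by (intro conjI exI[of _ "\<lambda>_. p"] exI[of _ 0] exI[of _ "{0}"]) (auto intro: lipschitz_intros)

lemma vert_coord_minus: "vert_coord p (- v) = - vert_coord p v"
  by (simp add: vert_coord_rotJ)

lemma reach_sym:
  assumes "reach p q L" shows "reach q p L"
proof -
  obtain \<gamma> C S where \<gamma>: "0 \<le> L" "C-lipschitz_on {0..L} \<gamma>" "\<gamma> 0 = p" "\<gamma> L = q" "finite S"
     "\<And>s. s \<in> {0..L} - S \<Longrightarrow> \<exists>v. (\<gamma> has_vector_derivative v) (at s) \<and> vert_coord (\<gamma> s) v = 0 \<and> norm (fst v) = 1"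
    using assms unfolding reach_def by blast
  define \<beta> where "\<beta> s = \<gamma> (L - s)" for s
  have "C-lipschitz_on {0..L} \<beta>"
  proof (rule lipschitz_onI)
    show "0 \<le> C" using \<gamma>(2) by (rule lipschitz_on_nonneg)
    fix x y assume "x \<in> {0..L}" "y \<in> {0..L}"
    then have "dist (\<gamma> (L - x)) (\<gamma> (L - y)) \<le> C * dist (L - x) (L - y)"
      by (intro lipschitz_onD[OF \<gamma>(2)]) auto
    then show "dist (\<beta> x) (\<beta> y) \<le> C * dist x y" by (simp add: \<beta>_def dist_real_def abs_minus_commute)
  qed
  moreover have "\<exists>v. (\<beta> has_vector_derivative v) (at s) \<and> vert_coord (\<beta> s) v = 0 \<and> norm (fst v) = 1"
    if s: "s \<in> {0..L} - (\<lambda>x. L - x) ` S" for s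
  proof -
    have "L - s \<in> {0..L} - S" using s by (auto simp: image_iff)
    then obtain v where v: "(\<gamma> has_vector_derivative v) (at (L - s))" "vert_coord (\<gamma> (L - s)) v = 0" "norm (fst v) = 1"
      using \<gamma>(6) by blast
    have "((\<lambda>s. L - s) has_vector_derivative -1) (at s)"
      by (auto intro!: derivative_eq_intros)
    from vector_diff_chain_at[OF this v(1)]
    have "(\<beta> has_vector_derivative - v) (at s)" by (simp add: \<beta>_def[abs_def] comp_def)
    then show ?thesis using v by (intro exI[of _ "- v"]) (simp add: \<beta>_def vert_coord_minus)
  qed
  ultimately show ?thesis
    unfolding reach_def using \<gamma>(1,3,4,5)
    by (intro conjI exI[of _ \<beta>] exI[of _ C] exI[of _ "(\<lambda>x. L - x) ` S"]) (auto simp: \<beta>_def)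
qed

lemma reach_trans:
  assumes "reach p q L" "reach q r M" shows "reach p r (L + M)"
proof -
  obtain \<gamma> C S where \<gamma>: "0 \<le> L" "C-lipschitz_on {0..L} \<gamma>" "\<gamma> 0 = p" "\<gamma> L = q" "finite S"
     "\<And>s. s \<in> {0..L} - S \<Longrightarrow> \<exists>v. (\<gamma> has_vector_derivative v) (at s) \<and> vert_coord (\<gamma> s) v = 0 \<and> norm (fst v) = 1"
    using assms(1) unfolding reach_def by blast
  obtain \<beta> D T where \<beta>: "0 \<le> M" "D-lipschitz_on {0..M} \<beta>" "\<beta> 0 = q" "\<beta> M = r" "finite T"
     "\<And>s. s \<in> {0..M} - T \<Longrightarrow> \<exists>v. (\<beta> has_vector_derivative v) (at s) \<and> vert_coord (\<beta> s) v = 0 \<and> norm (fst v) = 1"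
    using assms(2) unfolding reach_def by blast
  define \<sigma> where "\<sigma> s = (if s \<le> L then \<gamma> s else \<beta> (s - L))" for s
  define U where "U = S \<union> (\<lambda>x. x + L) ` T \<union> {L}"
  have "D-lipschitz_on {L..L + M} (\<lambda>s. \<beta> (s - L))"
  proof (rule lipschitz_onI)
    show "0 \<le> D" using \<beta>(2) by (rule lipschitz_on_nonneg)
    fix x y assume "x \<in> {L..L+M}" "y \<in> {L..L+M}"
    then have "dist (\<beta> (x - L)) (\<beta> (y - L)) \<le> D * dist (x - L) (y - L)"
      by (intro lipschitz_onD[OF \<beta>(2)]) auto
    then show "dist (\<beta> (x - L)) (\<beta> (y - L)) \<le> D * dist x y" by (simp add: dist_real_def)
  qed
  then have lip: "(max C D)-lipschitz_on {0..L + M} \<sigma>"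
    unfolding \<sigma>_def using lipschitz_on_concat_max[OF \<gamma>(2)] \<gamma>(4) \<beta>(3) by simp
  have der: "\<exists>v. (\<sigma> has_vector_derivative v) (at s) \<and> vert_coord (\<sigma> s) v = 0 \<and> norm (fst v) = 1"
    if s: "s \<in> {0..L + M} - U" for s
  proof (cases "s < L")
    case True
    then have "s \<in> {0..L} - S" using s by (auto simp: U_def)
    then obtain v where v: "(\<gamma> has_vector_derivative v) (at s)" "vert_coord (\<gamma> s) v = 0" "norm (fst v) = 1"
      using \<gamma>(6) by blast
    have "(\<sigma> has_vector_derivative v) (at s)"
      by (rule has_vector_derivative_transform_within_open[OF v(1), of "{..<L}"]) (use True in \<open>auto simp: \<sigma>_def\<close>)
    then show ?thesis using v True by (intro exI[of _ v]) (simp add: \<sigma>_def)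
  next
    case False
    then have sL: "s > L" using s by (auto simp: U_def)
    have "s - L \<in> {0..M} - T" using s sL by (auto simp: U_def image_iff)
    then obtain v where v: "(\<beta> has_vector_derivative v) (at (s - L))" "vert_coord (\<beta> (s - L)) v = 0" "norm (fst v) = 1"
      using \<beta>(6) by blast
    have "((\<lambda>s. s - L) has_vector_derivative 1) (at s)"
      by (auto intro!: derivative_eq_intros)
    from vector_diff_chain_at[OF this v(1)]
    have "((\<lambda>s. \<beta> (s - L)) has_vector_derivative v) (at s)" by (simp add: comp_def)
    then have "(\<sigma> has_vector_derivative v) (at s)"
      by (rule has_vector_derivative_transform_within_open[of _ _ _ "{L<..}"]) (use sL in \<open>auto simp: \<sigma>_def\<close>)
    then show ?thesis using v sL by (intro exI[of _ v]) (simp add: \<sigma>_def)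
  qed
  have "\<sigma> (L + M) = r" using \<gamma>(1,4) \<beta>(1,3,4) by (auto simp: \<sigma>_def)
  then show ?thesis
    unfolding reach_def using \<gamma>(1,3,5) \<beta>(1,5) lip der
    by (intro conjI exI[of _ \<sigma>] exI[of _ "max C D"] exI[of _ U]) (auto simp: \<sigma>_def U_def)
qed

lemma reach_translate:
  assumes "reach p q L" shows "reach (w \<odot> p) (w \<odot> q) L"
proof -
  obtain \<gamma> C S where \<gamma>: "0 \<le> L" "C-lipschitz_on {0..L} \<gamma>" "\<gamma> 0 = p" "\<gamma> L = q" "finite S"
     "\<And>s. s \<in> {0..L} - S \<Longrightarrow> \<exists>v. (\<gamma> has_vector_derivative v) (at s) \<and> vert_coord (\<gamma> s) v = 0 \<and> norm (fst v) = 1"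
    using assms unfolding reach_def by blast
  have C: "0 \<le> C" using \<gamma>(2) by (rule lipschitz_on_nonneg)
  have "((2 + 2 * norm (fst w)) * C)-lipschitz_on {0..L} (\<lambda>s. w \<odot> \<gamma> s)"
  proof (rule lipschitz_onI)
    fix x y assume "x \<in> {0..L}" "y \<in> {0..L}"
    then have "norm (\<gamma> x - \<gamma> y) \<le> C * dist x y" using lipschitz_onD[OF \<gamma>(2)] by (simp add: dist_norm)
    then have "(2 + 2 * norm (fst w)) * norm (\<gamma> x - \<gamma> y) \<le> (2 + 2 * norm (fst w)) * (C * dist x y)"
      by (intro mult_left_mono) auto
    then show "dist (w \<odot> \<gamma> x) (w \<odot> \<gamma> y) \<le> (2 + 2 * norm (fst w)) * C * dist x y"
      using norm_heis_mult_diff[of w "\<gamma> x" "\<gamma> y"] by (simp add: dist_norm mult.assoc)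
  qed (use C in auto)
  moreover have "\<exists>v. ((\<lambda>s. w \<odot> \<gamma> s) has_vector_derivative v) (at s) \<and> vert_coord (w \<odot> \<gamma> s) v = 0 \<and> norm (fst v) = 1"
    if s: "s \<in> {0..L} - S" for s
  proof -
    obtain v where v: "(\<gamma> has_vector_derivative v) (at s)" "vert_coord (\<gamma> s) v = 0" "norm (fst v) = 1"
      using \<gamma>(6)[OF s] by blast
    show ?thesis using heis_mult_derivative[OF v(1), of w] v(2,3)
      by (intro exI[of _ "(fst v, snd v + 2 * (rotJ (fst w) \<bullet> fst v))"]) (simp add: vert_coord_translate)
  qed
  ultimately show ?thesis
    unfolding reach_def using \<gamma>(1,3,4,5)
    by (intro conjI exI[of _ "\<lambda>s. w \<odot> \<gamma> s"] exI[of _ "(2 + 2 * norm (fst w)) * C"] exI[of _ S]) auto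
qed

lemma reach_curve:
  assumes "reach p q L"
  shows "\<exists>a b \<gamma>. a < b \<and> horizontal_curve a b \<gamma> \<and> \<gamma> a = p \<and> \<gamma> b = q \<and> has_riem_length a b \<gamma> L"
proof -
  obtain \<gamma> C S where \<gamma>: "0 \<le> L" "C-lipschitz_on {0..L} \<gamma>" "\<gamma> 0 = p" "\<gamma> L = q" "finite S"
     "\<And>s. s \<in> {0..L} - S \<Longrightarrow> \<exists>v. (\<gamma> has_vector_derivative v) (at s) \<and> vert_coord (\<gamma> s) v = 0 \<and> norm (fst v) = 1"
    using assms unfolding reach_def by blast
  show ?thesis
  proof (cases "L = 0")
    case True
    \<comment> \<open>\<open>cc_dist\<close> demands \<open>a < b\<close>, so a path of length 0
      becomes a constant curve on \<open>{0..1}\<close>.\<close>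
    define \<beta> where "\<beta> = (\<lambda>s::real. p)"
    have der: "(\<beta> has_vector_derivative 0) (at s)" for s by (simp add: \<beta>_def)
    have "abs_cont_on 0 1 \<beta>"
      by (rule abs_cont_on_lipschitz[OF abs_cont_on_id, of _ _ _ 0]) (simp add: \<beta>_def)
    then have "horizontal_curve 0 1 \<beta>"
      unfolding horizontal_curve_def using der span_zero by (auto intro!: AE_I2)
    moreover have "has_riem_length 0 1 \<beta> L"
      unfolding has_riem_length_def using vector_derivative_at[OF der] True
      by (simp add: riem_norm_def riem_inner_def vert_coord_rotJ)
    ultimately show ?thesis using \<gamma>(3,4) True by (intro exI[of _ 0] exI[of _ 1] exI[of _ \<beta>]) (simp add: \<beta>_def)
  next
    case False
    then have L: "0 < L" using \<gamma>(1) by simp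
    have ac: "abs_cont_on 0 L \<gamma>"
      by (rule abs_cont_on_lipschitz[OF abs_cont_on_id, of _ _ _ C])
         (use lipschitz_onD[OF \<gamma>(2)] in \<open>simp add: dist_norm\<close>)
    have "AE s in lebesgue. s \<notin> S"
      by (rule AE_not_in) (use \<gamma>(5) in \<open>simp add: finite_imp_null_set_lborel null_sets_completionI\<close>)
    then have ae: "AE s in lebesgue. s \<in> {0..L} \<longrightarrow>
       (\<exists>v \<in> span (range (\<lambda>j. fieldX j (\<gamma> s)) \<union> range (\<lambda>j. fieldY j (\<gamma> s))).
          (\<gamma> has_vector_derivative v) (at s))"
    proof (rule AE_mp, intro AE_I2 impI)
      fix s assume "s \<notin> S" "s \<in> {0..L}"
      then show "\<exists>v \<in> span (range (\<lambda>j. fieldX j (\<gamma> s)) \<union> range (\<lambda>j. fieldY j (\<gamma> s))).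
          (\<gamma> has_vector_derivative v) (at s)"
        using \<gamma>(6)[of s] span_horizontal by blast
    qed
    have "((\<lambda>_. 1::real) has_integral L) {0..L}"
      using has_integral_const_real[of "1::real" 0 L] L by simp
    then have "has_riem_length 0 L \<gamma> L"
      unfolding has_riem_length_def
    proof (rule has_integral_spike[rotated 2])
      show "negligible S" using \<gamma>(5) by (rule negligible_finite)
      fix s assume "s \<in> {0..L} - S"
      then obtain v where v: "(\<gamma> has_vector_derivative v) (at s)" "vert_coord (\<gamma> s) v = 0" "norm (fst v) = 1"
        using \<gamma>(6) by blast
      then show "riem_norm (\<gamma> s) (vector_derivative \<gamma> (at s)) = 1"
        by (simp add: vector_derivative_at riem_norm_horizontal)
    qed
    with ac ae \<gamma>(3,4) L show ?thesis
      unfolding horizontal_curve_def by blast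
  qed
qed

lemma has_riem_length_nonneg: "has_riem_length a b \<gamma> L \<Longrightarrow> 0 \<le> L"
  unfolding has_riem_length_def
  by (erule has_integral_nonneg) (simp add: riem_norm_def riem_inner_def)

lemma cc_dist_le_reach:
  assumes "reach p q L" shows "cc_dist p q \<le> L"
  unfolding cc_dist_def
proof (rule cInf_lower)
  show "bdd_below {L. \<exists>a b \<gamma>. a < b \<and> horizontal_curve a b \<gamma> \<and> \<gamma> a = p \<and> \<gamma> b = q \<and>
                                 has_riem_length a b \<gamma> L}"
    by (rule bdd_belowI[of _ 0]) (auto dest: has_riem_length_nonneg)
qed (use reach_curve[OF assms] in blast)

lemma reachI_smooth:
  assumes "0 \<le> L" "\<And>s. s \<in> {0..L} \<Longrightarrow> (\<gamma> has_vector_derivative v s) (at s)"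
    "\<And>s. s \<in> {0..L} \<Longrightarrow> vert_coord (\<gamma> s) (v s) = 0"
    "\<And>s. s \<in> {0..L} \<Longrightarrow> norm (fst (v s)) = 1"
    "\<And>s. s \<in> {0..L} \<Longrightarrow> \<bar>snd (v s)\<bar> \<le> C"
  shows "reach (\<gamma> 0) (\<gamma> L) L"
proof -
  have C: "0 \<le> C" using assms(1) assms(5)[of 0] by simp
  have "(1 + C)-lipschitz_on {0..L} \<gamma>"
  proof (rule lipschitz_onI)
    fix x y assume xy: "x \<in> {0..L}" "y \<in> {0..L}"
    have "norm (\<gamma> x - \<gamma> y) \<le> (1 + C) * norm (x - y)"
    proof (rule differentiable_bound[where S = "{0..L}" and f' = "\<lambda>s h. h *\<^sub>R v s"])
      fix s assume s: "s \<in> {0..L}"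
      show "(\<gamma> has_derivative (\<lambda>h. h *\<^sub>R v s)) (at s within {0..L})"
        using has_vector_derivative_at_within[OF assms(2)[OF s]] by (simp add: has_vector_derivative_def)
      have "norm (v s) \<le> 1 + C"
        using norm_Pair_le[of "fst (v s)" "snd (v s)"] assms(4,5)[OF s] by simp
      then show "onorm (\<lambda>h. h *\<^sub>R v s) \<le> 1 + C"
        by (intro onorm_le) (simp add: mult_left_mono mult.commute)
    qed (use xy in auto)
    then show "dist (\<gamma> x) (\<gamma> y) \<le> (1 + C) * dist x y" by (simp add: dist_norm)
  qed (use C in simp)
  moreover have "\<exists>v'. (\<gamma> has_vector_derivative v') (at s) \<and> vert_coord (\<gamma> s) v' = 0 \<and> norm (fst v') = 1"
    if "s \<in> {0..L}" for s
    using assms(2-4)[OF that] by (intro exI[of _ "v s"]) simp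
  ultimately show ?thesis
    unfolding reach_def using assms(1)
    by (intro conjI exI[of _ \<gamma>] exI[of _ "1 + C"] exI[of _ "{}"]) simp_all
qed

text \<open>The lift of a circle in the complex line of \<open>w\<close>, with centre
  \<open>(b - 1) w\<close> and radius \<open>norm w\<close>. It is applied with
  \<open>b = 0\<close>, a circle through the axis, and \<open>b = 1\<close>, a circle about the
  axis. Counterclockwise motion then lowers \<open>t\<close>, hence the sign of
  \<open>\<omega>\<close> in the applications.\<close>

lemma reach_arc:
  fixes w :: "(complex, 'n::finite) vec"
  assumes "0 \<le> L" "\<bar>\<omega>\<bar> * norm w = 1"
  shows "reach (complex_of_real b *s w, t0)
    ((complex_of_real (b - 1) + cis (\<omega> * L)) *s w,
      t0 - 2 * (norm w)\<^sup>2 * (\<omega> * L + (b - 1) * sin (\<omega> * L))) L"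
proof -
  define \<gamma> where "\<gamma> s = ((complex_of_real (b - 1) + cis (\<omega> * s)) *s w,
      t0 - 2 * (norm w)\<^sup>2 * (\<omega> * s + (b - 1) * sin (\<omega> * s)))" for s
  define v where "v s = ((\<i> * \<omega> * cis (\<omega> * s)) *s w, - 2 * (norm w)\<^sup>2 * (\<omega> + (b - 1) * (\<omega> * cos (\<omega> * s))))" for s
  have "reach (\<gamma> 0) (\<gamma> L) L"
  proof (rule reachI_smooth[OF assms(1), where v = v])
    fix s
    have "((\<lambda>s. cis (\<omega> * s)) has_vector_derivative \<i> * \<omega> * cis (\<omega> * s)) (at s)"
    proof -
      have "((\<lambda>s. exp (s *\<^sub>R (\<i> * \<omega>))) has_vector_derivative exp (s *\<^sub>R (\<i> * \<omega>)) * (\<i> * \<omega>)) (at s)"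
        by (rule exp_scaleR_has_vector_derivative_right)
      moreover have "exp (s *\<^sub>R (\<i> * \<omega>)) = cis (\<omega> * s)" for s
        by (simp add: cis_conv_exp scaleR_conv_of_real mult_ac)
      ultimately show ?thesis by (simp add: mult_ac)
    qed
    then have "((\<lambda>s. complex_of_real (b - 1) + cis (\<omega> * s)) has_vector_derivative \<i> * \<omega> * cis (\<omega> * s)) (at s)"
      by (auto intro!: derivative_eq_intros)
    then have 1: "((\<lambda>s. (complex_of_real (b - 1) + cis (\<omega> * s)) *s w) has_vector_derivative (\<i> * \<omega> * cis (\<omega> * s)) *s w) (at s)"
      by (rule bounded_linear.has_vector_derivative[OF bounded_linear_scalar_mult])
    have 2: "((\<lambda>s. t0 - 2 * (norm w)\<^sup>2 * (\<omega> * s + (b - 1) * sin (\<omega> * s))) has_vector_derivative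
        - 2 * (norm w)\<^sup>2 * (\<omega> + (b - 1) * (\<omega> * cos (\<omega> * s)))) (at s)"
      unfolding has_real_derivative_iff_has_vector_derivative[symmetric]
      by (auto intro!: derivative_eq_intros simp: algebra_simps)
    show "(\<gamma> has_vector_derivative v s) (at s)"
      unfolding \<gamma>_def v_def by (rule has_vector_derivative_Pair[OF 1 2])
    have im: "Im ((complex_of_real (b - 1) + cis (\<omega> * s)) * cnj (\<i> * \<omega> * cis (\<omega> * s)))
        = - (\<omega> + (b - 1) * (\<omega> * cos (\<omega> * s)))"
    proof -
      have "sin (\<omega> * s) * sin (\<omega> * s) = 1 - cos (\<omega> * s) * cos (\<omega> * s)"
        using sin_cos_squared_add[of "\<omega> * s"] by (simp add: power2_eq_square)
      then show ?thesis by (simp add: algebra_simps)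
    qed
    show "vert_coord (\<gamma> s) (v s) = 0"
      unfolding vert_coord_rotJ \<gamma>_def v_def fst_conv snd_conv inner_rotJ_scalar_mult im
      by (simp add: algebra_simps)
    show "norm (fst (v s)) = 1"
      using assms(2) by (simp add: v_def norm_vector_scalar_mult norm_mult)
    have "\<bar>\<omega> + (b - 1) * (\<omega> * cos (\<omega> * s))\<bar> \<le> \<bar>\<omega>\<bar> + \<bar>b - 1\<bar> * (\<bar>\<omega>\<bar> * 1)"
      by (rule order_trans[OF abs_triangle_ineq]) (auto simp: abs_mult mult_left_le intro!: mult_left_mono)
    then have "2 * (norm w)\<^sup>2 * \<bar>\<omega> + (b - 1) * (\<omega> * cos (\<omega> * s))\<bar> \<le> 2 * (norm w)\<^sup>2 * (\<bar>\<omega>\<bar> + \<bar>b - 1\<bar> * (\<bar>\<omega>\<bar> * 1))"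
      by (intro mult_left_mono) auto
    then show "\<bar>snd (v s)\<bar> \<le> 2 * (norm w)\<^sup>2 * (\<bar>\<omega>\<bar> + \<bar>b - 1\<bar> * (\<bar>\<omega>\<bar> * 1))"
      by (simp add: v_def abs_mult)
  qed
  then show ?thesis by (simp add: \<gamma>_def cis_conv_exp)
qed

lemma reach_segment: "reach (0, t) (z, t) (norm z)"
proof (cases "z = 0")
  case True then show ?thesis by (simp add: reach_refl)
next
  case False
  have "reach ((0 / norm z) *\<^sub>R z, t) ((norm z / norm z) *\<^sub>R z, t) (norm z)"
  proof (rule reachI_smooth[where \<gamma> = "\<lambda>s. ((s / norm z) *\<^sub>R z, t)" and v = "\<lambda>s. ((1 / norm z) *\<^sub>R z, 0)" and C = 0])
    fix s
    have "((\<lambda>s. s / norm z) has_real_derivative 1 / norm z) (at s)"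
      using False by (auto intro!: derivative_eq_intros)
    from has_vector_derivative_scaleR[OF this has_vector_derivative_const, of z]
    have "((\<lambda>s. (s / norm z) *\<^sub>R z) has_vector_derivative (1 / norm z) *\<^sub>R z) (at s)"
      by simp
    then show "((\<lambda>s. ((s / norm z) *\<^sub>R z, t)) has_vector_derivative ((1 / norm z) *\<^sub>R z, 0)) (at s)"
      by (intro has_vector_derivative_Pair) auto
    have "rotJ ((s / norm z) *\<^sub>R z) = (s / norm z) *\<^sub>R rotJ z"
      by (simp add: rotJ_def vec_eq_iff)
    then show "vert_coord ((s / norm z) *\<^sub>R z, t) ((1 / norm z) *\<^sub>R z, 0) = 0"
      by (simp add: vert_coord_rotJ)
    show "norm (fst ((1 / norm z) *\<^sub>R z, 0::real)) = 1" using False by (simp add: divide_simps)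
  qed auto
  then show ?thesis using False by simp
qed

text \<open>A full circle of radius \<open>R\<close> through the axis climbs four times its area,
  \<open>4 * pi * R\<^sup>2\<close>. This fixes \<open>R\<close>, and the length is
  \<open>2 * pi * R\<close>.\<close>

lemma reach_vertical: "reach (0, s) (0 :: (complex, 'n::finite) vec, t) (sqrt (pi * \<bar>t - s\<bar>))"
proof (cases "t = s")
  case True then show ?thesis by (simp add: reach_refl)
next
  case False
  define R where "R = sqrt (\<bar>t - s\<bar> / (4 * pi))"
  have R: "R > 0" "4 * pi * R\<^sup>2 = \<bar>t - s\<bar>" using False by (auto simp: R_def)
  obtain w :: "(complex, 'n) vec" where w: "norm w = R" using vector_choose_size[of R] R by auto
  define \<omega> where "\<omega> = - sgn (t - s) / R"
  have \<omega>: "\<bar>\<omega>\<bar> * norm w = 1" "\<omega> * (2 * pi * R) = - sgn (t - s) * (2 * pi)"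
    using R w False by (auto simp: \<omega>_def abs_divide sgn_if)
  have c: "cis (\<omega> * (2 * pi * R)) = 1" "sin (\<omega> * (2 * pi * R)) = 0"
    unfolding \<omega>(2) using False by (auto simp: sgn_if cis.code complex_eq_iff)
  have l: "2 * pi * R = sqrt (pi * \<bar>t - s\<bar>)"
  proof -
    have "(2 * pi * R)\<^sup>2 = pi * (4 * pi * R\<^sup>2)" by (simp add: power2_eq_square)
    then show ?thesis using R by (metis less_imp_le mult_nonneg_nonneg pi_ge_zero real_sqrt_unique zero_le_numeral)
  qed
  have eq: "s - 2 * (norm w)\<^sup>2 * (\<omega> * (2 * pi * R) + (0 - 1) * 0) = t"
  proof -
    have "2 * (norm w)\<^sup>2 * (\<omega> * (2 * pi * R)) = - sgn (t - s) * (4 * pi * R\<^sup>2)"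
      unfolding \<omega>(2) w by (simp add: algebra_simps)
    also have "\<dots> = s - t" unfolding R(2) by (simp add: sgn_if)
    finally show ?thesis by simp
  qed
  from reach_arc[OF _ \<omega>(1), of "2 * pi * R" 0 s, unfolded c eq] R(1) show ?thesis
    unfolding l[symmetric] by simp
qed

text \<open>Keeps the set in \<open>cc_dist\<close> nonempty, so that curves with length close to
  the infimum exist.\<close>

lemma reach_connected: "\<exists>L. reach p q L"
proof -
  have "\<exists>L. reach 0 q L" for q :: "'a heis"
    using reach_trans[OF reach_vertical[of 0 "snd q"] reach_segment[of "snd q" "fst q"]]
    by (auto simp: zero_prod_def)
  then obtain L where "reach 0 (fst q - fst p, snd q - snd p - 2 * (rotJ (fst p) \<bullet> fst q)) L" by blast
  from reach_translate[OF this, of p] show ?thesis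
    by (intro exI[of _ L]) (simp add: heis_mult_rotJ inner_diff_right)
qed

section \<open>The shape of Carnot-Caratheodory balls\<close>

text \<open>The dual form of Dido's inequality: every \<open>\<phi>\<close> is one calibration. With
  \<open>r\<close> the distance of the projections, minimising the right-hand side over
  \<open>\<phi>\<close> leads to \<open>rho \<phi> = r / lam\<close> and the value
  \<open>lam\<^sup>2 * g_fun \<phi>\<close>, the profile of the ball of radius
  \<open>lam\<close>.\<close>

lemma cc_dist_le_imp:
  assumes d: "cc_dist p q \<le> lam" and lam: "0 < lam" and \<phi>: "0 < \<phi>" "\<phi> < pi"
  shows "\<bar>snd q - snd p - 2 * (rotJ (fst p) \<bullet> fst q)\<bar> \<le> lam\<^sup>2 / \<phi> - cot \<phi> * (norm (fst q - fst p))\<^sup>2"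
proof -
  define \<Delta> where "\<Delta> = snd q - snd p - 2 * (rotJ (fst p) \<bullet> fst q)"
  define Z where "Z = fst q - fst p"
  define k where "k = \<phi> / lam"
  have k: "k > 0" "k * lam = \<phi>" using \<phi> lam by (auto simp: k_def)
  have main: "s * \<Delta> \<le> (lam + e) / k - cot (k * (lam + e)) * (norm Z)\<^sup>2"
    if e: "0 < e" "k * (lam + e) < pi" and s: "\<bar>s\<bar> = 1" for e s :: real
  proof -
    let ?S = "{L. \<exists>a b \<gamma>. a < b \<and> horizontal_curve a b \<gamma> \<and> \<gamma> a = p \<and> \<gamma> b = q \<and> has_riem_length a b \<gamma> L}"
    obtain L0 where "reach p q L0" using reach_connected by blast
    from reach_curve[OF this] have "L0 \<in> ?S" by (rule CollectI)
    then have "?S \<noteq> {}" by (metis (no_types) empty_iff)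
    moreover have "Inf ?S < lam + e" using d e by (simp add: cc_dist_def)
    ultimately have "\<exists>L\<in>?S. L < lam + e" by (rule cInf_lessD)
    then obtain L where "L \<in> ?S" "L < lam + e" by (rule bexE)
    then obtain a b \<gamma> where \<gamma>: "a < b" "horizontal_curve a b \<gamma>" "\<gamma> a = p" "\<gamma> b = q" "has_riem_length a b \<gamma> L"
      by auto
    have L: "0 \<le> L" using \<gamma>(5) by (rule has_riem_length_nonneg)
    define \<beta> where "\<beta> x = (- p) \<odot> \<gamma> x" for x
    have \<beta>: "horizontal_curve a b \<beta>" "has_riem_length a b \<beta> L"
      unfolding \<beta>_def using \<gamma> by (auto intro: horizontal_curve_translate has_riem_length_translate)
    have \<beta>ab: "\<beta> a = 0" "\<beta> b = (Z, \<Delta>)"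
      unfolding \<beta>_def \<gamma> by (simp_all add: heis_mult_rotJ rotJ_minus Z_def \<Delta>_def prod_eq_iff)
    \<comment> \<open>With this phase the argument of \<open>cot\<close> is positive at the start
      and equals \<open>k * (lam + e)\<close> at the end, whatever the length \<open>L\<close>
      is.\<close>
    define \<eta> where "\<eta> = k * (lam + e - L)"
    have \<eta>: "\<eta> > 0" "k * L + \<eta> = k * (lam + e)" unfolding \<eta>_def using k \<open>L < lam + e\<close>
      by (intro mult_pos_pos) (auto simp: algebra_simps)
    have "s * snd (\<beta> b) \<le> L / k - cot (k * L + \<eta>) * (norm (fst (\<beta> b)))\<^sup>2"
    proof (rule horizontal_curve_calibration[OF _ \<beta> \<beta>ab(1) k(1) s, where c = "\<lambda>x. cot (k * x + \<eta>)"])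
      show "a \<le> b" using \<gamma>(1) by simp
      fix x assume x: "x \<in> {0..L}"
      have "0 < k * x + \<eta>" using x k \<eta> by (auto intro!: add_nonneg_pos)
      moreover have "k * x + \<eta> \<le> k * L + \<eta>" using x k by simp
      ultimately have sin: "sin (k * x + \<eta>) \<noteq> 0"
        using \<eta> e sin_gt_zero[of "k * x + \<eta>"] by simp
      have "((\<lambda>x. cot (k * x + \<eta>)) has_real_derivative - inverse ((sin (k * x + \<eta>))\<^sup>2) * k) (at x)"
        by (rule DERIV_chain2[where g = "\<lambda>x. k * x + \<eta>", OF DERIV_cot[OF sin]]) (auto intro!: derivative_eq_intros)
      also have "- inverse ((sin (k * x + \<eta>))\<^sup>2) * k = - k * (1 + (cot (k * x + \<eta>))\<^sup>2)"
        using sin sin_cos_squared_add[of "k * x + \<eta>"] by (simp add: cot_def power_divide field_simps)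
      finally show "((\<lambda>x. cot (k * x + \<eta>)) has_real_derivative - k * (1 + (cot (k * x + \<eta>))\<^sup>2)) (at x)" .
    qed
    then have "s * \<Delta> \<le> L / k - cot (k * (lam + e)) * (norm Z)\<^sup>2"
      by (simp add: \<beta>ab \<eta>(2))
    also have "L / k \<le> (lam + e) / k" using \<open>L < lam + e\<close> k by (simp add: divide_right_mono)
    finally show ?thesis by simp
  qed
  \<comment> \<open>The infimum in \<open>cc_dist\<close> need not be attained, hence the limit
    \<open>e \<rightarrow> 0\<close>.\<close>
  have "s * \<Delta> \<le> lam / k - cot (k * lam) * (norm Z)\<^sup>2" if s: "\<bar>s\<bar> = 1" for s :: real
  proof (rule tendsto_lowerbound)
    have "sin (k * (lam + 0)) \<noteq> 0" using k \<phi> sin_gt_zero[of \<phi>] by simp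
    then have "((\<lambda>e. (lam + e) / k - cot (k * (lam + e)) * (norm Z)\<^sup>2) \<longlongrightarrow> (lam + 0) / k - cot (k * (lam + 0)) * (norm Z)\<^sup>2) (at_right 0)"
      using k by (intro tendsto_intros) auto
    then show "((\<lambda>e. (lam + e) / k - cot (k * (lam + e)) * (norm Z)\<^sup>2) \<longlongrightarrow> lam / k - cot (k * lam) * (norm Z)\<^sup>2) (at_right 0)"
      by simp
    have "0 < (pi - \<phi>) / k" using \<phi> k by simp
    then have "\<forall>\<^sub>F e in at_right 0. e < (pi - \<phi>) / k" "\<forall>\<^sub>F e in at_right 0. (0::real) < e"
      by (auto simp: eventually_at_right_less intro: eventually_at_right_real order_tendstoD)
    then show "\<forall>\<^sub>F e in at_right 0. s * \<Delta> \<le> (lam + e) / k - cot (k * (lam + e)) * (norm Z)\<^sup>2"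
    proof eventually_elim
      case (elim e)
      then have "k * (lam + e) < pi" using k by (simp add: field_simps)
      then show ?case using main[OF elim(2) _ s] by blast
    qed
  qed simp
  from this[of 1] this[of "-1"] have "\<bar>\<Delta>\<bar> \<le> lam / k - cot \<phi> * (norm Z)\<^sup>2"
    unfolding k(2) by (auto simp: abs_le_iff)
  moreover have "lam / k = lam\<^sup>2 / \<phi>" using lam \<phi> by (simp add: k_def power2_eq_square)
  ultimately show ?thesis by (simp add: \<Delta>_def Z_def)
qed

section \<open>Curves through the vertical axis\<close>

lemma x_cos_less_sin:
  assumes "0 < x" "x \<le> pi"
  shows "x * cos x < sin x"
proof -
  have "(\<lambda>x. sin x - x * cos x) 0 < (\<lambda>x. sin x - x * cos x) x"
  proof (rule DERIV_pos_imp_increasing_open[OF assms(1)])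
    fix u assume u: "0 < u" "u < x"
    have "((\<lambda>x. sin x - x * cos x) has_real_derivative u * sin u) (at u)"
      by (auto intro!: derivative_eq_intros)
    moreover have "0 < u * sin u" using u assms by (intro mult_pos_pos sin_gt_zero) auto
    ultimately show "\<exists>y. ((\<lambda>x. sin x - x * cos x) has_real_derivative y) (at u) \<and> 0 < y" by blast
  qed (auto intro!: continuous_intros)
  then show ?thesis by simp
qed

lemma sin_over_id_decreasing:
  assumes "0 < x" "x < y" "y \<le> pi"
  shows "sin y / y < sin x / x"
proof (rule DERIV_neg_imp_decreasing[OF assms(2)])
  fix u assume u: "x \<le> u" "u \<le> y"
  have "((\<lambda>x. sin x / x) has_real_derivative (u * cos u - sin u) / (u * u)) (at u)"
    using u assms by (auto intro!: derivative_eq_intros simp: field_simps)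
  moreover have "(u * cos u - sin u) / (u * u) < 0"
    using x_cos_less_sin[of u] u assms by (intro divide_neg_pos) auto
  ultimately show "\<exists>y. ((\<lambda>x. sin x / x) has_real_derivative y) (at u) \<and> y < 0" by blast
qed

lemma id_over_sin_mono:
  assumes "0 < x" "x \<le> y" "y < pi"
  shows "x / sin x \<le> y / sin y"
proof (cases "x = y")
  case False
  then have "sin y / y < sin x / x" using assms by (intro sin_over_id_decreasing) auto
  moreover have "0 < sin x" "0 < sin y" using assms by (auto intro: sin_gt_zero)
  ultimately show ?thesis using assms by (simp add: field_simps)
qed simp

lemma continuous_on_rho: "continuous_on S rho"
proof -
  have "isCont rho x" for x
  proof (cases "x = 0")
    case True
    have "((\<lambda>x. sin x / x) \<longlongrightarrow> 1) (at (0::real))"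
      using DERIV_D[OF DERIV_sin[of 0]] by simp
    then have "(rho \<longlongrightarrow> 1) (at 0)"
      by (rule Lim_transform_eventually) (auto simp: eventually_at_filter rho_def)
    then show ?thesis unfolding True isCont_def by (simp add: rho_def)
  next
    case False
    have "isCont (\<lambda>x. sin x / x) x" using False by (intro continuous_intros) auto
    moreover have "\<forall>\<^sub>F y in nhds x. sin y / y = rho y"
      using t1_space_nhds[OF False] by eventually_elim (simp add: rho_def)
    ultimately show ?thesis using isCont_cong by fast
  qed
  then show ?thesis by (simp add: continuous_at_imp_continuous_on)
qed

lemma rho_inj: "inj_on rho {0..pi}"
proof -
  have less: "rho y < rho x" if "0 \<le> x" "x < y" "y \<le> pi" for x y
  proof (cases "x = 0")
    case True
    have "sin y / y < sin (y / 2) / (y / 2)" using that True by (intro sin_over_id_decreasing) auto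
    also have "\<dots> \<le> 1" using that True sin_x_le_x[of "y / 2"] by (simp add: divide_le_eq)
    finally show ?thesis using that True by (auto simp: rho_def)
  next
    case False
    then show ?thesis using that sin_over_id_decreasing[of x y] by (simp add: rho_def)
  qed
  show ?thesis
  proof (rule inj_onI)
    fix x y assume "x \<in> {0..pi}" "y \<in> {0..pi}" "rho x = rho y"
    then show "x = y" using less[of x y] less[of y x] by (cases x y rule: linorder_cases) auto
  qed
qed

lemma rho_image: "rho ` {0..pi} = {0..1}"
proof
  have "0 \<le> rho x \<and> rho x \<le> 1" if "0 \<le> x" "x \<le> pi" for x
    using that sin_ge_zero[of x] sin_x_le_x[of x] by (auto simp: rho_def divide_le_eq)
  then show "rho ` {0..pi} \<subseteq> {0..1}" by auto
  show "{0..1} \<subseteq> rho ` {0..pi}"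
  proof
    fix y :: real assume "y \<in> {0..1}"
    moreover have "rho 0 = 1" "rho pi = 0" by (simp_all add: rho_def)
    ultimately have "\<exists>x\<ge>0. x \<le> pi \<and> rho x = y"
      by (intro IVT2' continuous_on_rho) auto
    then show "y \<in> rho ` {0..pi}" by auto
  qed
qed

lemma inv_rho:
  assumes "0 \<le> x" "x \<le> 1"
  shows "0 \<le> inv_into {0..pi} rho x" "inv_into {0..pi} rho x \<le> pi" "rho (inv_into {0..pi} rho x) = x"
proof -
  have "x \<in> rho ` {0..pi}" using assms by (simp add: rho_image)
  from inv_into_into[OF this] f_inv_into_f[OF this]
  show "0 \<le> inv_into {0..pi} rho x" "inv_into {0..pi} rho x \<le> pi" "rho (inv_into {0..pi} rho x) = x"
    by auto
qed

lemma continuous_on_g_fun: "continuous_on {0..} g_fun"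
proof -
  have "continuous (at x within {0..}) g_fun" if "x \<ge> 0" for x
  proof (cases "x = 0")
    case True
    have "((\<lambda>\<phi>::real. (2 * \<phi> - sin (2 * \<phi>)) / (2 * \<phi>\<^sup>2)) \<longlongrightarrow> 0) (at_right 0)"
      by real_asymp
    then have "(g_fun \<longlongrightarrow> 0) (at_right 0)"
      by (rule Lim_transform_eventually) (auto simp: eventually_at_filter g_fun_def)
    then show ?thesis unfolding True continuous_within
      by (simp add: g_fun_def at_within_Ici_at_right)
  next
    case False
    have "isCont (\<lambda>\<phi>. (2 * \<phi> - sin (2 * \<phi>)) / (2 * \<phi>\<^sup>2)) x" using False by (intro continuous_intros) auto
    moreover have "\<forall>\<^sub>F y in nhds x. (2 * y - sin (2 * y)) / (2 * y\<^sup>2) = g_fun y"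
      using t1_space_nhds[OF False] by eventually_elim (simp add: g_fun_def)
    ultimately have "isCont g_fun x" using isCont_cong by fast
    then show ?thesis by (rule continuous_at_imp_continuous_at_within)
  qed
  then show ?thesis by (simp add: continuous_on_eq_continuous_within)
qed

lemma continuous_on_h_fun: "continuous_on {0..1} h_fun"
proof -
  have "continuous_on (rho ` {0..pi}) (inv_into {0..pi} rho)"
    by (rule continuous_on_inv) (auto intro: continuous_on_rho simp: inv_into_f_f[OF rho_inj])
  then have "continuous_on {0..1} (inv_into {0..pi} rho)" by (simp only: rho_image)
  then have "continuous_on {0..1} (\<lambda>x. g_fun (inv_into {0..pi} rho x))"
    by (rule continuous_on_compose2[OF continuous_on_g_fun]) (use inv_rho in auto)
  then show ?thesis by (simp add: h_fun_def[abs_def])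
qed

section \<open>Lengths and heights of arcs that start on the axis\<close>

lemma reach_from_axis:
  fixes z :: "(complex, 'n::finite) vec"
  assumes z: "z \<noteq> 0" and \<phi>: "0 < \<phi>" "\<phi> < pi" and \<sigma>: "\<bar>\<sigma>\<bar> = (1::real)"
  shows "reach (0, s) (z, s + \<sigma> * ((norm z)\<^sup>2 * ((2 * \<phi> - sin (2 * \<phi>)) / (2 * (sin \<phi>)\<^sup>2)))) (norm z * (\<phi> / sin \<phi>))"
proof -
  have sin: "sin \<phi> > 0" using \<phi> by (rule sin_gt_zero)
  \<comment> \<open>The radius for which the chord from the axis to \<open>z\<close> subtends the
    angle \<open>2 * \<phi>\<close> at the centre. The arc over it climbs four times the area
    between arc and chord.\<close>
  define R where "R = norm z / (2 * sin \<phi>)"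
  have R: "R > 0" using z sin by (simp add: R_def)
  define L where "L = 2 * R * \<phi>"
  define \<omega> where "\<omega> = - \<sigma> / R"
  have \<omega>L: "\<omega> * L = - \<sigma> * (2 * \<phi>)" using R by (simp add: \<omega>_def L_def)
  define a where "a = cis (\<omega> * L) - 1"
  have s1: "\<sigma> = 1 \<or> \<sigma> = -1" using \<sigma> by linarith
  have na: "norm a = 2 * sin \<phi>"
  proof -
    have "(norm a)\<^sup>2 = (cos (2 * \<phi>) - 1)\<^sup>2 + (sin (2 * \<phi>))\<^sup>2"
      using s1 by (auto simp: a_def \<omega>L cmod_power2)
    also have "\<dots> = (2 * sin \<phi>)\<^sup>2"
      using sin_cos_squared_add[of \<phi>] unfolding cos_double_sin sin_double by algebra
    finally show ?thesis by (rule power2_eq_imp_eq) (use sin in auto)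
  qed
  then have a0: "a \<noteq> 0" using sin by auto
  define w where "w = inverse a *s z"
  have nw: "norm w = R"
  proof -
    have "norm w = inverse (2 * sin \<phi>) * norm z"
      unfolding w_def norm_vector_scalar_mult norm_inverse na by (rule refl)
    then show ?thesis unfolding R_def divide_inverse_commute .
  qed
  have "reach (complex_of_real 0 *s w, s)
    ((complex_of_real (0 - 1) + cis (\<omega> * L)) *s w,
      s - 2 * (norm w)\<^sup>2 * (\<omega> * L + (0 - 1) * sin (\<omega> * L))) L"
  proof (rule reach_arc)
    show "0 \<le> L" using R \<phi> by (simp add: L_def)
    show "\<bar>\<omega>\<bar> * norm w = 1" unfolding nw \<omega>_def abs_divide using R \<sigma> by simp
  qed
  moreover have "(complex_of_real (0 - 1) + cis (\<omega> * L)) *s w = z"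
  proof -
    have "complex_of_real (0 - 1) + cis (\<omega> * L) = a" by (simp add: a_def)
    then show ?thesis using a0 by (simp add: w_def vector_smult_assoc)
  qed
  moreover have "s - 2 * (norm w)\<^sup>2 * (\<omega> * L + (0 - 1) * sin (\<omega> * L))
      = s + \<sigma> * ((norm z)\<^sup>2 * ((2 * \<phi> - sin (2 * \<phi>)) / (2 * (sin \<phi>)\<^sup>2)))"
    unfolding nw \<omega>L R_def using s1 sin by (auto simp: power_divide field_simps power2_eq_square)
  moreover have "L = norm z * (\<phi> / sin \<phi>)" by (simp add: L_def R_def)
  ultimately show ?thesis by (simp only: of_real_0 vector_smult_lzero)
qed

text \<open>Over a fixed chord the height is continuous in the half-angle and tends to 0 with it. So
  an arc of half-angle at most \<open>\<phi>\<close> has the prescribed height, and it is no longer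
  because \<open>x / sin x\<close> increases. Half-angle 0 stands for the straight segment.\<close>

lemma reach_from_axis_le:
  fixes z :: "(complex, 'n::finite) vec"
  assumes z: "z \<noteq> 0" and \<phi>: "0 < \<phi>" "\<phi> < pi"
    and ts: "\<bar>t - s\<bar> \<le> (norm z)\<^sup>2 * ((2 * \<phi> - sin (2 * \<phi>)) / (2 * (sin \<phi>)\<^sup>2))"
  shows "\<exists>L\<le>norm z * (\<phi> / sin \<phi>). reach (0, s) (z, t) L"
proof -
  define q where "q x = (2 * x - sin (2 * x)) / (2 * (sin x)\<^sup>2)" for x :: real
  have "continuous (at x within {0..\<phi>}) q" if x: "x \<in> {0..\<phi>}" for x
  proof (cases "x = 0")
    case True
    have "((\<lambda>x::real. (2 * x - sin (2 * x)) / (2 * (sin x)\<^sup>2)) \<longlongrightarrow> 0) (at_right 0)"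
      by real_asymp
    then have "(q \<longlongrightarrow> 0) (at 0 within {0..\<phi>})"
      unfolding q_def[abs_def] using \<phi> by (simp add: at_within_Icc_at_right)
    then show ?thesis unfolding True continuous_within by (simp add: q_def)
  next
    case False
    then have "sin x \<noteq> 0" using sin_gt_zero[of x] x \<phi> by auto
    then show ?thesis unfolding q_def[abs_def] by (intro continuous_intros) auto
  qed
  then have cont: "continuous_on {0..\<phi>} q" by (simp add: continuous_on_eq_continuous_within)
  have nz: "(norm z)\<^sup>2 > 0" using z by simp
  have "\<exists>x\<ge>0. x \<le> \<phi> \<and> q x = \<bar>t - s\<bar> / (norm z)\<^sup>2"
  proof (rule IVT'[OF _ _ _ cont])
    show "q 0 \<le> \<bar>t - s\<bar> / (norm z)\<^sup>2" by (simp add: q_def)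
    show "\<bar>t - s\<bar> / (norm z)\<^sup>2 \<le> q \<phi>"
      using ts nz unfolding q_def by (simp only: pos_divide_le_eq mult.commute)
  qed (use \<phi> in simp)
  then obtain x where x: "0 \<le> x" "x \<le> \<phi>" "q x = \<bar>t - s\<bar> / (norm z)\<^sup>2" by blast
  then have qx: "(norm z)\<^sup>2 * q x = \<bar>t - s\<bar>" using nz by simp
  show ?thesis
  proof (cases "x = 0")
    case True
    then have "t = s" using qx by (simp add: q_def)
    moreover have "1 \<le> \<phi> / sin \<phi>" using \<phi> sin_x_le_x[of \<phi>] sin_gt_zero[of \<phi>] by (simp add: field_simps)
    then have "norm z * 1 \<le> norm z * (\<phi> / sin \<phi>)" by (rule mult_left_mono) simp
    ultimately show ?thesis using reach_segment[of s z] by (intro exI[of _ "norm z"]) simp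
  next
    case False
    define \<sigma> where "\<sigma> = (if t < s then - 1 else 1 :: real)"
    have "reach (0, s) (z, s + \<sigma> * ((norm z)\<^sup>2 * q x)) (norm z * (x / sin x))"
      unfolding q_def using False x \<phi> by (intro reach_from_axis z) (auto simp: \<sigma>_def)
    moreover have "s + \<sigma> * ((norm z)\<^sup>2 * q x) = t" unfolding qx by (simp add: \<sigma>_def)
    moreover have "norm z * (x / sin x) \<le> norm z * (\<phi> / sin \<phi>)"
      using False x \<phi> by (intro mult_left_mono id_over_sin_mono) auto
    ultimately show ?thesis by metis
  qed
qed

text \<open>Radius and half-angle replace the chord as parameters, so that the full circle
  \<open>\<phi> = pi\<close>, which returns to the axis, is covered too.\<close>

lemma reach_from_axis_param:
  fixes z :: "(complex, 'n::finite) vec"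
  assumes R: "R > 0" and \<phi>: "0 \<le> \<phi>" "\<phi> \<le> pi" and z: "norm z = 2 * R * sin \<phi>"
    and ts: "\<bar>t - s\<bar> \<le> 2 * R\<^sup>2 * (2 * \<phi> - sin (2 * \<phi>))"
  shows "\<exists>L\<le>2 * R * \<phi>. reach (0, s) (z, t) L"
proof -
  consider "\<phi> = 0" | "\<phi> = pi" | "0 < \<phi>" "\<phi> < pi" using \<phi> by linarith
  then show ?thesis
  proof cases
    case 1
    then have "z = 0" "t = s" using z ts by auto
    then show ?thesis using 1 reach_refl by (intro exI[of _ 0]) simp
  next
    case 2
    then have "z = 0" "\<bar>t - s\<bar> \<le> 4 * pi * R\<^sup>2" using z ts by (auto simp: algebra_simps)
    then have "pi * \<bar>t - s\<bar> \<le> pi * (4 * pi * R\<^sup>2)" by (intro mult_left_mono) auto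
    also have "\<dots> = (2 * R * pi)\<^sup>2" by (simp add: power2_eq_square)
    finally have "sqrt (pi * \<bar>t - s\<bar>) \<le> 2 * R * pi" using R by (simp add: real_le_lsqrt)
    then show ?thesis using reach_vertical[of s t] 2 \<open>z = 0\<close> by blast
  next
    case 3
    have sin: "sin \<phi> > 0" using 3 by (rule sin_gt_zero)
    have "z \<noteq> 0" using z R sin by auto
    moreover have "\<bar>t - s\<bar> \<le> (norm z)\<^sup>2 * ((2 * \<phi> - sin (2 * \<phi>)) / (2 * (sin \<phi>)\<^sup>2))"
      using ts sin unfolding z by (simp add: power_mult_distrib)
    ultimately have "\<exists>L\<le>norm z * (\<phi> / sin \<phi>). reach (0, s) (z, t) L"
      using 3 by (intro reach_from_axis_le)
    then show ?thesis unfolding z using sin by (simp add: mult.assoc)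
  qed
qed

text \<open>A circle about the axis lifts to a horizontal curve that climbs at the rate \<open>2 \<parallel>z\<parallel>\<close>.\<close>

lemma reach_circle:
  fixes z :: "(complex, 'n::finite) vec"
  assumes "0 \<le> e" "\<bar>d\<bar> \<le> 2 * norm z * e"
  shows "\<exists>z' L. norm z' = norm z \<and> L \<le> e \<and> reach (z', t) (z, t + d) L"
proof (cases "z = 0")
  case True
  then show ?thesis using assms reach_refl by (intro exI[of _ z] exI[of _ 0]) simp
next
  case False
  define r where "r = norm z"
  have r: "r > 0" using False by (simp add: r_def)
  define L where "L = \<bar>d\<bar> / (2 * r)"
  define \<omega> where "\<omega> = (if d < 0 then 1 else - 1) / r"
  define w where "w = cis (- (\<omega> * L)) *s z"
  have nw: "norm w = r" by (simp add: w_def norm_vector_scalar_mult r_def)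
  have "reach (complex_of_real 1 *s w, t)
    ((complex_of_real (1 - 1) + cis (\<omega> * L)) *s w, t - 2 * (norm w)\<^sup>2 * (\<omega> * L + (1 - 1) * sin (\<omega> * L))) L"
    by (rule reach_arc) (use r nw in \<open>auto simp: L_def \<omega>_def abs_divide\<close>)
  moreover have "(complex_of_real (1 - 1) + cis (\<omega> * L)) *s w = z"
    by (simp add: w_def vector_smult_assoc cis_mult)
  moreover have "t - 2 * (norm w)\<^sup>2 * (\<omega> * L + (1 - 1) * sin (\<omega> * L)) = t + d"
    unfolding nw using r by (simp add: \<omega>_def L_def power2_eq_square)
  ultimately have "reach (w, t) (z, t + d) L" by (simp only: of_real_1 vector_smult_lid)
  moreover have "L \<le> e" using assms r by (simp add: L_def field_simps r_def)
  ultimately show ?thesis using nw by (intro exI[of _ w] exI[of _ L]) (simp add: r_def)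
qed

text \<open>The first curve takes as much of the height as \<open>h\<close> allows, and a circle
  about the axis takes the remainder \<open>d\<close>. This circle ends at \<open>z\<close> but
  starts elsewhere at the same distance, so the hypothesis speaks of all such
  \<open>z'\<close>.\<close>

lemma reach_from_axis_extend:
  fixes z :: "(complex, 'n::finite) vec"
  assumes reach: "\<And>(z' :: (complex, 'n) vec) s t. norm z' = norm z \<Longrightarrow> \<bar>t - s\<bar> \<le> h \<Longrightarrow> \<exists>L\<le>m. reach (0, s) (z', t) L"
    and h: "0 \<le> h" and e: "0 \<le> e" and ts: "\<bar>t - s\<bar> \<le> h + 2 * norm z * e"
  shows "\<exists>L\<le>m + e. reach (0, s) (z, t) L"
proof -
  define x where "x = max (- h) (min h (t - s))"
  define d where "d = t - s - x"
  have "0 \<le> 2 * norm z * e" using e by simp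
  then have d: "\<bar>d\<bar> \<le> 2 * norm z * e" and x: "\<bar>x\<bar> \<le> h"
    using ts h unfolding d_def x_def by linarith+
  obtain z' L where 1: "norm z' = norm z" "L \<le> e" "reach (z', s + x) (z, s + x + d) L"
    using reach_circle[OF e d] by blast
  obtain M where 2: "M \<le> m" "reach (0, s) (z', s + x) M"
    using reach[OF 1(1), of "s + x" s] x by auto
  have "reach (0, s) (z, s + x + d) (M + L)" by (rule reach_trans[OF 2(2) 1(3)])
  moreover have "s + x + d = t" by (simp add: d_def)
  ultimately show ?thesis using 1(2) 2(1) by (intro exI[of _ "M + L"]) simp
qed

text \<open>The two paths meet the axis at one height \<open>s\<close>, chosen so that the height
  difference splits into parts within \<open>h\<close> and \<open>h'\<close>.\<close>

lemma cc_dist_through_axis: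
  assumes z: "\<And>s t. \<bar>t - s\<bar> \<le> h \<Longrightarrow> \<exists>L\<le>m. reach (0, s) (z, t) L"
    and z': "\<And>s t. \<bar>t - s\<bar> \<le> h' \<Longrightarrow> \<exists>L\<le>m'. reach (0, s) (z', t) L"
    and h: "0 \<le> h" "0 \<le> h'" and ts: "\<bar>t - t'\<bar> \<le> h + h'"
  shows "cc_dist (z, t) (z', t') \<le> m + m'" "cc_dist (z', t') (z, t) \<le> m + m'"
proof -
  define x where "x = max (- h) (min h (t - t'))"
  define s where "s = t - x"
  have s: "\<bar>t - s\<bar> \<le> h" "\<bar>t' - s\<bar> \<le> h'" using ts h by (auto simp: s_def x_def)
  obtain L L' where L: "L \<le> m" "reach (0, s) (z, t) L" "L' \<le> m'" "reach (0, s) (z', t') L'"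
    using z[OF s(1)] z'[OF s(2)] by blast
  have "reach (z, t) (z', t') (L + L')" by (rule reach_trans[OF reach_sym[OF L(2)] L(4)])
  from cc_dist_le_reach[OF this] cc_dist_le_reach[OF reach_sym[OF this]] L
  show "cc_dist (z, t) (z', t') \<le> m + m'" "cc_dist (z', t') (z, t) \<le> m + m'" by auto
qed

text \<open>
  The right-hand side is the room left by the three-arc path between the points at distance
  \<open>2 sin x\<close> and \<open>2 sin y\<close> from the axis, and \<open>cos\<^sup>4\<close> is the shift in these coordinates.
\<close>

lemma cos_power4_bound:
  assumes "0 \<le> x" "x \<le> y" "y \<le> pi / 2"
  shows "\<bar>cos x ^ 4 - cos y ^ 4\<bar> \<le> 4 * (x - y) + 2 * sin (2 * y) - 2 * sin (2 * x) + 8 * sin y * (y - x)"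
proof -
  \<comment> \<open>\<open>D\<close> vanishes at \<open>y\<close>, so it is enough that it does not
    increase up to \<open>y\<close>.\<close>
  define D where "D x = 4 * (x - y) + 2 * sin (2 * y) - 2 * sin (2 * x) + 8 * sin y * (y - x) - (cos x ^ 4 - cos y ^ 4)" for x
  have "D y \<le> D x"
  proof (rule DERIV_nonpos_imp_nonincreasing[OF assms(2)])
    fix u assume u: "x \<le> u" "u \<le> y"
    have "(D has_real_derivative (4 - 4 * cos (2 * u) - 8 * sin y + 4 * cos u ^ 3 * sin u)) (at u)"
      unfolding D_def by (auto intro!: derivative_eq_intros)
    moreover have "4 - 4 * cos (2 * u) - 8 * sin y + 4 * cos u ^ 3 * sin u \<le> 0"
    proof -
      have su: "0 \<le> sin u" "sin u \<le> 1" using u assms by (auto intro: sin_ge_zero)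
      have cu: "0 \<le> cos u" "cos u \<le> 1" using u assms by (auto intro: cos_ge_zero)
      have "sin u \<le> sin y" using u assms by (intro sin_monotone_2pi_le) auto
      \<comment> \<open>The available slope \<open>8 * sin u * (1 - sin u)\<close> vanishes like
        \<open>(cos u)\<^sup>2\<close> at \<open>pi / 2\<close>. The cube from differentiating
        \<open>cos ^ 4\<close> fits below it; the slope of \<open>cos\<^sup>2\<close> would
        not.\<close>
      have "cos u ^ 3 \<le> (cos u)\<^sup>2" using cu by (intro power_decreasing) auto
      also have "\<dots> = (1 - sin u) * (1 + sin u)" using sin_cos_squared_add[of u] by (simp add: algebra_simps power2_eq_square)
      also have "\<dots> \<le> (1 - sin u) * 2" using su by (intro mult_left_mono) auto
      finally have "4 * cos u ^ 3 * sin u \<le> 4 * ((1 - sin u) * 2) * sin u" using su by (intro mult_right_mono) auto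
      moreover have "4 - 4 * cos (2 * u) = 8 * (sin u)\<^sup>2" by (simp add: cos_double_sin)
      ultimately show ?thesis using \<open>sin u \<le> sin y\<close> by (simp add: algebra_simps power2_eq_square)
    qed
    ultimately show "\<exists>y. (D has_real_derivative y) (at u) \<and> y \<le> 0" by blast
  qed
  moreover have "cos y \<le> cos x" using assms by (intro cos_monotone_0_pi_le) auto
  moreover have "0 \<le> cos y" using assms by (intro cos_ge_zero) auto
  ultimately have "cos y ^ 4 \<le> cos x ^ 4" "D y \<le> D x" by (auto intro: power_mono)
  then show ?thesis by (simp add: D_def)
qed

text \<open>The cut-off matters: without \<open>max\<close>, the square would grow again beyond
  \<open>r = 2\<close>.\<close>

definition bump :: "real \<Rightarrow> real" where
  "bump r = (max 0 (1 - r\<^sup>2 / 4))\<^sup>2"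

lemma bump_eq_0: "2 \<le> r \<Longrightarrow> bump r = 0"
  using power_mono[of 2 r 2] by (simp add: bump_def)

lemma bump_sin: "0 \<le> x \<Longrightarrow> x \<le> pi / 2 \<Longrightarrow> bump (2 * sin x) = cos x ^ 4"
proof -
  have "1 - (2 * sin x)\<^sup>2 / 4 = (cos x)\<^sup>2"
    by (simp add: power_mult_distrib cos_squared_eq)
  then show ?thesis by (simp add: bump_def flip: power_mult)
qed

lemma g_fun_nonneg: "0 \<le> x \<Longrightarrow> 0 \<le> g_fun x"
  using sin_x_le_x[of "2 * x"] by (simp add: g_fun_def)

lemma l_fun_nonneg:
  assumes "0 < lam" "0 \<le> r" "2 * r \<le> lam" shows "0 \<le> l_fun lam r"
proof -
  have "0 \<le> inv_into {0..pi} rho (r / (lam / 2))" using assms by (intro inv_rho) auto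
  then show ?thesis using assms by (simp add: l_fun_def h_scaled_def h_fun_def g_fun_nonneg)
qed

text \<open>For \<open>\<parallel>z\<parallel> \<ge> \<lambda>/\<pi>\<close> the profile \<open>l\<^sub>\<lambda>\<close> is that of the ball of radius \<open>\<lambda>/2\<close>.\<close>

lemma reach_from_axis_outer:
  fixes z :: "(complex, 'n::finite) vec"
  assumes z: "2 < norm z" "norm z \<le> pi" and ts: "\<bar>t - s\<bar> \<le> l_fun (2 * pi) (norm z)"
  shows "\<exists>L\<le>pi. reach (0, s) (z, t) L"
proof -
  define \<phi> where "\<phi> = inv_into {0..pi} rho (norm z / pi)"
  have \<phi>: "0 \<le> \<phi>" "\<phi> \<le> pi" "rho \<phi> = norm z / pi"
    unfolding \<phi>_def using z by (auto intro!: inv_rho)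
  have l: "l_fun (2 * pi) (norm z) = pi\<^sup>2 * g_fun \<phi>"
    using z by (simp add: l_fun_def h_scaled_def h_fun_def \<phi>_def)
  show ?thesis
  proof (cases "\<phi> = 0")
    case True
    then have "norm z = pi" "t = s" using \<phi>(3) ts unfolding l by (auto simp: rho_def g_fun_def)
    then show ?thesis using reach_segment[of s z] by (intro exI[of _ pi]) simp
  next
    case False
    \<comment> \<open>The arc of half-angle \<open>\<phi>\<close> then has length exactly
      \<open>pi\<close>.\<close>
    define R where "R = pi / (2 * \<phi>)"
    have "\<exists>L\<le>2 * R * \<phi>. reach (0, s) (z, t) L"
    proof (rule reach_from_axis_param[OF _ \<phi>(1,2)])
      show "R > 0" using False \<phi> by (simp add: R_def)
      show "norm z = 2 * R * sin \<phi>" using \<phi>(3) False by (simp add: rho_def R_def field_simps)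
      show "\<bar>t - s\<bar> \<le> 2 * R\<^sup>2 * (2 * \<phi> - sin (2 * \<phi>))"
        using ts False unfolding l by (simp add: g_fun_def R_def power_divide power_mult_distrib)
    qed
    then show ?thesis using False by (simp add: R_def)
  qed
qed

section \<open>Distances between points of the shifted slices\<close>

lemma arcsin_half:
  assumes "0 \<le> r" "r \<le> 2"
  shows "0 \<le> arcsin (r / 2)" "arcsin (r / 2) \<le> pi / 2" "r = 2 * sin (arcsin (r / 2))"
  using assms arcsin_bounded[of "r / 2"] arcsin_le_arcsin[of 0 "r / 2"] by auto

text \<open>The total length \<open>2 * pi\<close> is shared out. If
  \<open>norm z = 2 * sin x\<close> is at most 2, the nearer point gets \<open>2 * x\<close> and the
  farther one \<open>2 * pi - 2 * x\<close>, part of it for a circle about the axis. If both norms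
  exceed 2, the shift vanishes and each point gets \<open>pi\<close>.\<close>

lemma cc_dist_le_bumped:
  fixes z z' :: "(complex, 'n::finite) vec"
  assumes zz: "norm z \<le> norm z'" and z': "norm z' \<le> pi"
    and t: "\<bar>t - bump (norm z)\<bar> \<le> l_fun (2 * pi) (norm z)"
    and t': "\<bar>t' - bump (norm z')\<bar> \<le> l_fun (2 * pi) (norm z')"
  shows "cc_dist (z, t) (z', t') \<le> 2 * pi \<and> cc_dist (z', t') (z, t) \<le> 2 * pi"
proof (cases "norm z \<le> 2")
  case False
  then have b: "bump (norm z) = 0" "bump (norm z') = 0" using zz by (auto intro!: bump_eq_0)
  have "\<bar>t - t'\<bar> \<le> l_fun (2 * pi) (norm z) + l_fun (2 * pi) (norm z')" using t t' b by linarith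
  moreover have "0 \<le> l_fun (2 * pi) (norm z)" "0 \<le> l_fun (2 * pi) (norm z')"
    using zz z' by (auto intro!: l_fun_nonneg)
  moreover note reach_from_axis_outer[of z] reach_from_axis_outer[of z']
  ultimately have "cc_dist (z, t) (z', t') \<le> pi + pi" "cc_dist (z', t') (z, t) \<le> pi + pi"
    using False zz z' cc_dist_through_axis[of "l_fun (2 * pi) (norm z)" pi z "l_fun (2 * pi) (norm z')" pi z' t t'] by auto
  then show ?thesis by simp
next
  case True
  define x where "x = arcsin (norm z / 2)"
  have x: "0 \<le> x" "x \<le> pi / 2" "norm z = 2 * sin x"
    using arcsin_half[of "norm z"] True by (auto simp: x_def)
  define h where "h = 2 * (2 * x - sin (2 * x))"
  have h: "0 \<le> h" using sin_x_le_x[of "2 * x"] x by (simp add: h_def)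
  have near: "\<exists>L\<le>2 * x. reach (0, s) (z, t) L" if "\<bar>t - s\<bar> \<le> h" for s t
    using reach_from_axis_param[of 1 x z t s] x that by (simp add: h_def)
  have lz: "l_fun (2 * pi) (norm z) = 2 * pi" using True by (simp add: l_fun_def power2_eq_square)
  have bz: "bump (norm z) = cos x ^ 4" using x by (simp add: bump_sin)
  show ?thesis
  proof (cases "norm z' \<le> 2")
    case z'2: True
    define y where "y = arcsin (norm z' / 2)"
    have y: "0 \<le> y" "y \<le> pi / 2" "norm z' = 2 * sin y"
      using arcsin_half[of "norm z'"] z'2 by (auto simp: y_def)
    have xy: "x \<le> y" unfolding x_def y_def using zz z'2 True norm_ge_zero[of z] by (intro arcsin_le_arcsin) linarith+
    \<comment> \<open>The height of the longer of the two arcs of a unit circle from the axis to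
      \<open>z'\<close>, with half-angle \<open>pi - y\<close>. It leaves the length
      \<open>2 * (y - x)\<close> for the circle about the axis.\<close>
    define h' where "h' = 2 * (2 * (pi - y) - sin (2 * (pi - y)))"
    have h'_eq: "h' = 2 * (2 * pi - 2 * y + sin (2 * y))"
      by (simp add: h'_def right_diff_distrib sin_diff)
    have h': "0 \<le> h'" using sin_x_le_x[of "2 * (pi - y)"] y by (simp add: h'_def)
    have base: "\<exists>L\<le>2 * (pi - y). reach (0, s) (\<zeta>, t) L" if "norm \<zeta> = norm z'" "\<bar>t - s\<bar> \<le> h'"
      for \<zeta> :: "(complex, 'n) vec" and s t
      using reach_from_axis_param[of 1 "pi - y" \<zeta> t s] y that by (simp add: h'_def)
    have far: "\<exists>L\<le>2 * (pi - y) + 2 * (y - x). reach (0, s) (z', t) L"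
      if "\<bar>t - s\<bar> \<le> h' + 2 * norm z' * (2 * (y - x))" for s t
      by (rule reach_from_axis_extend[OF base h' _ that]) (use xy in auto)
    have lz': "l_fun (2 * pi) (norm z') = 2 * pi" using z'2 by (simp add: l_fun_def power2_eq_square)
    have bz': "bump (norm z') = cos y ^ 4" using y by (simp add: bump_sin)
    have "\<bar>t - t'\<bar> \<le> 4 * pi + \<bar>cos x ^ 4 - cos y ^ 4\<bar>" using t t' unfolding lz lz' bz bz' by linarith
    also have "\<dots> \<le> h + (h' + 2 * norm z' * (2 * (y - x)))"
      using cos_power4_bound[OF x(1) xy y(2)] unfolding h_def h'_eq y(3) by (simp add: algebra_simps)
    finally have "\<bar>t - t'\<bar> \<le> h + (h' + 2 * norm z' * (2 * (y - x)))" .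
    note cc_dist_through_axis[OF near far h _ this]
    moreover have "0 \<le> h' + 2 * norm z' * (2 * (y - x))" using h' xy by simp
    ultimately show ?thesis by (auto simp: algebra_simps)
  next
    case z'2: False
    define h' where "h' = l_fun (2 * pi) (norm z')"
    have h': "0 \<le> h'" unfolding h'_def using z' by (intro l_fun_nonneg) auto
    have base: "\<exists>L\<le>pi. reach (0, s) (\<zeta>, t) L" if "norm \<zeta> = norm z'" "\<bar>t - s\<bar> \<le> h'"
      for \<zeta> :: "(complex, 'n) vec" and s t
      using reach_from_axis_outer[of \<zeta> t s] z'2 z' that by (simp add: h'_def)
    have far: "\<exists>L\<le>pi + (pi - 2 * x). reach (0, s) (z', t) L"
      if "\<bar>t - s\<bar> \<le> h' + 2 * norm z' * (pi - 2 * x)" for s t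
      by (rule reach_from_axis_extend[OF base h' _ that]) (use x in auto)
    have bz': "bump (norm z') = 0" using z'2 by (simp add: bump_eq_0)
    \<comment> \<open>A circle about the axis through \<open>z'\<close> climbs faster than one of
      radius 2, so the estimate for \<open>y = pi / 2\<close> suffices;
      \<open>cos (pi / 2) ^ 4\<close> is the vanishing shift.\<close>
    have "\<bar>t - t'\<bar> \<le> 2 * pi + \<bar>cos x ^ 4 - cos (pi / 2) ^ 4\<bar> + h'"
    proof -
      have "0 \<le> cos x ^ 4" "cos (pi / 2) ^ 4 = (0::real)" by simp_all
      then show ?thesis using t t' unfolding lz bz bz' h'_def by linarith
    qed
    also have "\<dots> \<le> h + h' + 2 * 2 * (pi - 2 * x)"
      using cos_power4_bound[OF x(1,2) order_refl] unfolding h_def by (simp add: algebra_simps)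
    also have "2 * 2 * (pi - 2 * x) \<le> 2 * norm z' * (pi - 2 * x)"
      using z'2 x by (intro mult_right_mono) auto
    finally have "\<bar>t - t'\<bar> \<le> h + (h' + 2 * norm z' * (pi - 2 * x))" by simp
    note cc_dist_through_axis[OF near far h _ this]
    moreover have "0 \<le> h' + 2 * norm z' * (pi - 2 * x)" using h' x by simp
    ultimately show ?thesis by (auto simp: algebra_simps)
  qed
qed

section \<open>Slices of rotationally invariant sets\<close>

text \<open>The consequences of \<open>cc_dist p q \<le> lam\<close> for all \<open>\<phi>\<close>
  at once, in a form that is visibly closed in each point.\<close>

definition cc_close :: "real \<Rightarrow> 'n::finite heis \<Rightarrow> 'n heis \<Rightarrow> bool" where
  "cc_close lam p q \<longleftrightarrow> (\<forall>\<phi>. 0 < \<phi> \<and> \<phi> < pi \<longrightarrow>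
    \<bar>snd q - snd p - 2 * (rotJ (fst p) \<bullet> fst q)\<bar> \<le> lam\<^sup>2 / \<phi> - cot \<phi> * (norm (fst q - fst p))\<^sup>2)"

text \<open>Multiplied by \<open>\<phi>\<close>, the right-hand side tends to
  \<open>lam\<^sup>2 - r\<^sup>2\<close> as \<open>\<phi> \<rightarrow> 0\<close>, because
  \<open>\<phi> * cot \<phi>\<close> tends to 1.\<close>

lemma cc_close_norm:
  assumes "cc_close lam p q" "0 < lam"
  shows "norm (fst q - fst p) \<le> lam"
proof -
  define r where "r = norm (fst q - fst p)"
  have "0 \<le> lam\<^sup>2 - r\<^sup>2"
  proof (rule tendsto_lowerbound)
    have "((\<lambda>\<phi>::real. \<phi> * (cos \<phi> / sin \<phi>)) \<longlongrightarrow> 1) (at_right 0)" by real_asymp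
    from tendsto_diff[OF tendsto_const tendsto_mult[OF tendsto_const this], of "lam\<^sup>2" "r\<^sup>2"]
    show "((\<lambda>\<phi>. lam\<^sup>2 - r\<^sup>2 * (\<phi> * (cos \<phi> / sin \<phi>))) \<longlongrightarrow> lam\<^sup>2 - r\<^sup>2) (at_right 0)"
      by (simp only: mult_1_right)
    have "\<forall>\<^sub>F \<phi> in at_right (0::real). \<phi> \<in> {0<..<pi}"
      by (rule eventually_at_right_real) simp
    then show "\<forall>\<^sub>F \<phi> in at_right 0. 0 \<le> lam\<^sup>2 - r\<^sup>2 * (\<phi> * (cos \<phi> / sin \<phi>))"
    proof eventually_elim
      case (elim \<phi>)
      then have "0 \<le> lam\<^sup>2 / \<phi> - cot \<phi> * r\<^sup>2"
        using assms(1) unfolding cc_close_def r_def by (smt (verit) greaterThanLessThan_iff)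
      then have "0 \<le> \<phi> * (lam\<^sup>2 / \<phi> - cot \<phi> * r\<^sup>2)" using elim by simp
      then show ?case using elim by (simp add: cot_def field_simps)
    qed
  qed simp
  then have "r\<^sup>2 \<le> lam\<^sup>2" by simp
  then have "r \<le> lam" by (rule power2_le_imp_le) (use assms(2) in simp)
  then show ?thesis by (simp add: r_def)
qed

lemma rotJ_0: "rotJ 0 = 0"
  by (simp add: rotJ_def vec_eq_iff)

lemma rot_const: "rot (\<chi> j. \<alpha>) p = (cis \<alpha> *s fst p, snd p)"
  by (simp add: rot_def cis_conv_exp vec_eq_iff)

text \<open>The angles used below are \<open>\<alpha> = 0\<close>, \<open>\<alpha> = \<pi>\<close> and \<open>\<alpha> = \<pi> - \<phi>\<close>; the last one is critical.\<close>

lemma rotated_slice_bound: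
  assumes rot: "\<And>\<theta>. rot \<theta> ` G \<subseteq> G" and close: "\<And>p q. p \<in> G \<Longrightarrow> q \<in> G \<Longrightarrow> cc_close lam p q"
    and G: "(z, t) \<in> G" "(z, s) \<in> G" and \<phi>: "0 < \<phi>" "\<phi> < pi"
  shows "s - t + 2 * (norm z)\<^sup>2 * sin \<alpha> \<le> lam\<^sup>2 / \<phi> - cot \<phi> * (2 - 2 * cos \<alpha>) * (norm z)\<^sup>2"
proof -
  have "rot (\<chi> j. \<alpha>) (z, s) \<in> G" using rot G(2) by blast
  then have "cc_close lam (z, t) (cis \<alpha> *s z, s)" using close[OF G(1)] by (simp add: rot_const)
  then have "\<bar>s - t - 2 * (rotJ z \<bullet> (cis \<alpha> *s z))\<bar> \<le> lam\<^sup>2 / \<phi> - cot \<phi> * (norm (cis \<alpha> *s z - z))\<^sup>2"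
    using \<phi> by (simp add: cc_close_def)
  moreover have "rotJ z \<bullet> (cis \<alpha> *s z) = - sin \<alpha> * (norm z)\<^sup>2"
    using inner_rotJ_scalar_mult[of 1 z "cis \<alpha>"] by simp
  moreover have "(norm (cis \<alpha> *s z - z))\<^sup>2 = (2 - 2 * cos \<alpha>) * (norm z)\<^sup>2"
  proof -
    have "cis \<alpha> *s z - z = (cis \<alpha> - 1) *s z" by (simp add: vec_eq_iff algebra_simps)
    then have "(norm (cis \<alpha> *s z - z))\<^sup>2 = (cmod (cis \<alpha> - 1))\<^sup>2 * (norm z)\<^sup>2"
      by (simp only: norm_vector_scalar_mult power_mult_distrib)
    also have "(cmod (cis \<alpha> - 1))\<^sup>2 = 2 - 2 * cos \<alpha>"
      unfolding cmod_power2 using sin_cos_squared_add[of \<alpha>] by (simp add: power2_eq_square algebra_simps)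
    finally show ?thesis .
  qed
  ultimately show ?thesis by (simp add: algebra_simps)
qed

lemma inv_rho_eq:
  assumes "0 \<le> \<phi>" "\<phi> \<le> pi" "rho \<phi> = x" shows "inv_into {0..pi} rho x = \<phi>"
  using inv_into_f_f[OF rho_inj, of \<phi>] assms by auto

text \<open>At the critical angle and with \<open>\<phi> = 2 * \<psi>\<close>, the bound becomes
  \<open>2 * ((lam / 2)\<^sup>2 / \<psi> - cot \<psi> * r\<^sup>2)\<close>, twice that of a ball of
  radius \<open>lam / 2\<close>. The best \<open>\<psi>\<close> satisfies
  \<open>rho \<psi> = 2 * r / lam\<close>, and \<open>\<phi> < pi\<close> admits it only for
  \<open>r > lam / pi\<close>. For smaller \<open>r\<close> the limit
  \<open>\<phi> \<rightarrow> pi\<close> without rotation yields the constant part; the rim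
  \<open>2 * r = lam\<close> is a limit \<open>\<phi> \<rightarrow> 0\<close>.\<close>

lemma slice_height_le:
  assumes rot: "\<And>\<theta>. rot \<theta> ` G \<subseteq> G" and close: "\<And>p q. p \<in> G \<Longrightarrow> q \<in> G \<Longrightarrow> cc_close lam p q"
    and G: "(z, t) \<in> G" "(z, s) \<in> G" and lam: "0 < lam"
  shows "2 * norm z \<le> lam" "s - t \<le> 2 * l_fun lam (norm z)"
proof -
  define r where "r = norm z"
  note bound = rotated_slice_bound[OF rot close G, folded r_def]
  \<comment> \<open>The rotation by \<open>pi\<close> puts a point of \<open>G\<close> over
    \<open>- z\<close>, whose distance to \<open>z\<close> is \<open>2 * norm z\<close>.\<close>
  have "rot (\<chi> j. pi) (z, s) \<in> G" using rot G(2) by blast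
  from cc_close_norm[OF close[OF G(1) this] lam] have "norm (cis pi *s z - z) \<le> lam"
    by (simp only: rot_const fst_conv)
  moreover have "cis pi *s z - z = (- 2) *s z" by (simp add: vec_eq_iff)
  ultimately have "norm ((- 2 :: complex) *s z) \<le> lam" by (simp only:)
  then show r2: "2 * norm z \<le> lam" unfolding norm_vector_scalar_mult by simp
  show "s - t \<le> 2 * l_fun lam (norm z)"
  proof (cases "r \<le> lam / pi")
    case True
    have "s - t \<le> lam\<^sup>2 / pi"
    proof (rule tendsto_lowerbound)
      show "((\<lambda>\<phi>. lam\<^sup>2 / \<phi>) \<longlongrightarrow> lam\<^sup>2 / pi) (at_left pi)" by (auto intro!: tendsto_eq_intros)
      have "\<forall>\<^sub>F \<phi> in at_left pi. \<phi> \<in> {0<..<pi}" by (rule eventually_at_left_real) simp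
      then show "\<forall>\<^sub>F \<phi> in at_left pi. s - t \<le> lam\<^sup>2 / \<phi>"
        by eventually_elim (use bound[where \<alpha> = 0] in auto)
    qed simp
    then show ?thesis using True by (simp add: l_fun_def r_def)
  next
    case False
    define \<psi> where "\<psi> = inv_into {0..pi} rho (2 * r / lam)"
    have \<psi>: "0 \<le> \<psi>" "\<psi> \<le> pi" "rho \<psi> = 2 * r / lam"
      unfolding \<psi>_def using r2 lam by (auto intro!: inv_rho simp: r_def)
    have l: "2 * l_fun lam r = lam\<^sup>2 / 2 * g_fun \<psi>"
      using False by (simp add: l_fun_def h_scaled_def h_fun_def \<psi>_def power_divide mult.commute)
    \<comment> \<open>Makes \<open>\<phi> = 2 * \<psi>\<close> admissible;
      \<open>rho (pi / 2) = 2 / pi\<close> is the origin of the threshold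
      \<open>lam / pi\<close>.\<close>
    have "\<psi> < pi / 2"
    proof (rule ccontr)
      assume "\<not> \<psi> < pi / 2"
      then have "rho \<psi> \<le> rho (pi / 2)"
      proof (cases "\<psi> = pi / 2")
        case False
        then show ?thesis
          using \<open>\<not> \<psi> < pi / 2\<close> sin_over_id_decreasing[of "pi / 2" \<psi>] \<psi>(2) by (auto simp: rho_def)
      qed (simp only: order_refl)
      then show False using False lam unfolding \<psi>(3) by (simp add: rho_def field_simps)
    qed
    show ?thesis
    proof (cases "\<psi> = 0")
      case True
      then have r: "2 * r = lam" using \<psi>(3) lam by (simp add: rho_def field_simps)
      have "s - t \<le> lam\<^sup>2 * 0"
      proof (rule tendsto_lowerbound)
        have "((\<lambda>\<phi>::real. 1 / \<phi> - cos \<phi> / sin \<phi>) \<longlongrightarrow> 0) (at_right 0)" by real_asymp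
        then show "((\<lambda>\<phi>. lam\<^sup>2 * (1 / \<phi> - cos \<phi> / sin \<phi>)) \<longlongrightarrow> lam\<^sup>2 * 0) (at_right 0)"
          by (intro tendsto_intros)
        have "\<forall>\<^sub>F \<phi> in at_right (0::real). \<phi> \<in> {0<..<pi}" by (rule eventually_at_right_real) simp
        then show "\<forall>\<^sub>F \<phi> in at_right 0. s - t \<le> lam\<^sup>2 * (1 / \<phi> - cos \<phi> / sin \<phi>)"
        proof eventually_elim
          case (elim \<phi>)
          have "s - t \<le> lam\<^sup>2 / \<phi> - cot \<phi> * 4 * r\<^sup>2" using bound[where \<alpha> = pi, of \<phi>] elim by simp
          also have "\<dots> = lam\<^sup>2 * (1 / \<phi> - cos \<phi> / sin \<phi>)"
            by (simp add: cot_def r[symmetric] power_mult_distrib algebra_simps)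
          finally show ?case .
        qed
      qed simp
      then show ?thesis unfolding r_def[symmetric] l using True by (simp add: g_fun_def)
    next
      case False
      then have \<psi>0: "0 < \<psi>" "2 * \<psi> < pi" using \<psi> \<open>\<psi> < pi / 2\<close> by auto
      define S where "S = sin \<psi>"
      define C where "C = cos \<psi>"
      have S: "S > 0" unfolding S_def using \<psi>0 by (intro sin_gt_zero) auto
      have C: "C > 0" unfolding C_def using \<psi>0 by (intro cos_gt_zero) auto
      have SC: "S\<^sup>2 + C\<^sup>2 = 1" by (simp add: S_def C_def)
      have r: "r = lam * S / (2 * \<psi>)"
        using \<psi>(3) \<psi>0 lam by (simp add: rho_def S_def field_simps)
      have "s - t + 2 * r\<^sup>2 * sin (2 * \<psi>) \<le> lam\<^sup>2 / (2 * \<psi>) - cot (2 * \<psi>) * (2 + 2 * cos (2 * \<psi>)) * r\<^sup>2"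
        using bound[where \<alpha> = "pi - 2 * \<psi>" and \<phi> = "2 * \<psi>"] \<psi>0 by (simp add: cos_diff sin_diff)
      moreover have "cot (2 * \<psi>) * (2 + 2 * cos (2 * \<psi>)) = 2 * C * (C\<^sup>2 - S\<^sup>2) / S"
      proof -
        have "2 + 2 * cos (2 * \<psi>) = 4 * C\<^sup>2" by (simp add: cos_double_cos C_def)
        moreover have "cot (2 * \<psi>) = (C\<^sup>2 - S\<^sup>2) / (2 * S * C)"
          by (simp add: cot_def sin_double cos_double S_def C_def)
        ultimately show ?thesis using S C by (simp only:) (simp add: field_simps power2_eq_square)
      qed
      moreover have "sin (2 * \<psi>) = 2 * S * C" by (simp add: sin_double S_def C_def)
      ultimately have "s - t \<le> lam\<^sup>2 / (2 * \<psi>) - 2 * C * (C\<^sup>2 - S\<^sup>2) / S * r\<^sup>2 - 2 * r\<^sup>2 * (2 * S * C)" by simp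
      also have "\<dots> = lam\<^sup>2 / (2 * \<psi>\<^sup>2) * (\<psi> - S * C * (C\<^sup>2 + S\<^sup>2))"
        unfolding r using S \<psi>0 by (simp add: field_simps power2_eq_square)
      also have "\<dots> = lam\<^sup>2 / 2 * g_fun \<psi>"
      proof -
        have "g_fun \<psi> = (2 * \<psi> - 2 * S * C) / (2 * \<psi>\<^sup>2)"
          using False unfolding g_fun_def sin_double S_def C_def by simp
        moreover have "C\<^sup>2 + S\<^sup>2 = 1" using SC by simp
        ultimately show ?thesis using \<psi>0 by (simp only:) (simp add: field_simps)
      qed
      finally show ?thesis unfolding r_def[symmetric] l .
    qed
  qed
qed

lemma closed_cc_close_left: "closed {p. cc_close lam p q}"
  unfolding cc_close_def rotJ_def
  by (intro closed_Collect_all closed_Collect_imp open_Collect_const closed_Collect_le continuous_intros)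

lemma closed_cc_close_right: "closed {q. cc_close lam p q}"
  unfolding cc_close_def
  by (intro closed_Collect_all closed_Collect_imp open_Collect_const closed_Collect_le continuous_intros)

lemma cc_close_closure:
  assumes F: "\<And>p q. p \<in> F \<Longrightarrow> q \<in> F \<Longrightarrow> cc_close lam p q" and pq: "p \<in> closure F" "q \<in> closure F"
  shows "cc_close lam p q"
proof -
  have "cc_close lam p q" if "p \<in> F" for p
    using closure_minimal[OF _ closed_cc_close_right, of F lam p] F[OF that] pq(2) by blast
  then show ?thesis
    using closure_minimal[OF _ closed_cc_close_left, of F lam q] pq(1) by blast
qed

lemma linear_rot: "linear (rot \<theta>)"
  by (rule linearI) (simp_all add: rot_def vec_eq_iff algebra_simps)

lemma rot_closure:
  assumes "F \<in> rot_inv" shows "rot \<theta> ` closure F \<subseteq> closure F"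
proof -
  have "rot \<theta> ` closure F \<subseteq> closure (rot \<theta> ` F)"
    using linear_rot[of \<theta>] by (simp add: closure_bounded_linear_image_subset linear_conv_bounded_linear)
  also have "\<dots> \<subseteq> closure F" using assms by (intro closure_mono) (auto simp: rot_inv_def)
  finally show ?thesis .
qed

section \<open>Volumes\<close>

definition slice_length :: "real \<Rightarrow> (complex, 'n::finite) vec \<Rightarrow> ennreal" where
  "slice_length lam z = (if 2 * norm z \<le> lam then ennreal (2 * l_fun lam (norm z)) else 0)"

lemma emeasure_le_diameter:
  fixes T :: "real set"
  assumes "\<And>s t. s \<in> T \<Longrightarrow> t \<in> T \<Longrightarrow> s - t \<le> d"
  shows "emeasure lborel T \<le> ennreal d"
proof (cases "T = {}")
  case False
  then obtain x where x: "x \<in> T" by blast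
  have bd: "bdd_below T" by (rule bdd_belowI[of _ "x - d"]) (use assms[OF x] in force)
  have "T \<subseteq> {Inf T..Inf T + d}"
  proof
    fix y assume y: "y \<in> T"
    have "y - d \<le> Inf T" by (rule cInf_greatest[OF False]) (use assms[OF y] in force)
    then show "y \<in> {Inf T..Inf T + d}" using cInf_lower[OF y bd] by auto
  qed
  then have "emeasure lborel T \<le> emeasure lborel {Inf T..Inf T + d}" by (intro emeasure_mono) auto
  also have "\<dots> \<le> ennreal d" using assms[OF x x] by simp
  finally show ?thesis .
qed simp

lemma emeasure_lborel_slices:
  fixes G :: "'n::finite heis set"
  assumes "G \<in> sets borel"
  shows "emeasure lborel G = (\<integral>\<^sup>+z. emeasure lborel (Pair z -` G) \<partial>lborel)"
    "(\<lambda>z. emeasure lborel (Pair z -` G)) \<in> borel_measurable lborel"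
proof -
  have "G \<in> sets lborel" using assms by simp
  then have G: "G \<in> sets (lborel \<Otimes>\<^sub>M lborel)" by (simp only: lborel_prod)
  show "emeasure lborel G = (\<integral>\<^sup>+z. emeasure lborel (Pair z -` G) \<partial>lborel)"
    using lborel.emeasure_pair_measure_alt[OF G] by (simp add: lborel_prod)
  show "(\<lambda>z. emeasure lborel (Pair z -` G)) \<in> borel_measurable lborel"
    by (rule lborel.measurable_emeasure_Pair[OF G])
qed

lemma outer_measure_le_slice_length:
  fixes F :: "'n::finite heis set"
  assumes F: "F \<in> rot_inv" "cc_diam F \<le> ennreal lam" and lam: "0 < lam"
  shows "outer_measure_of lebesgue F \<le> (\<integral>\<^sup>+z. slice_length lam (z :: (complex, 'n) vec) \<partial>lborel)"
proof -
  have "cc_close lam p q" if "p \<in> F" "q \<in> F" for p q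
  proof -
    have "ennreal (cc_dist p q) \<le> cc_diam F"
      unfolding cc_diam_def using that by (meson SUP_upper order_trans)
    then have "cc_dist p q \<le> lam" using F(2) lam by (metis ennreal_le_iff less_imp_le order_trans)
    then show ?thesis unfolding cc_close_def using cc_dist_le_imp[OF _ lam] by blast
  qed
  then have close: "cc_close lam p q" if "p \<in> closure F" "q \<in> closure F" for p q
    using cc_close_closure[OF _ that] by blast
  note slice = slice_height_le[OF rot_closure[OF F(1)] close _ _ lam]
  \<comment> \<open>\<open>F\<close> may fail to be measurable; its closure is Borel, rotationally
    invariant and subject to the same inequalities.\<close>
  have "outer_measure_of lebesgue F \<le> outer_measure_of lebesgue (closure F)"
    by (rule outer_measure_of_mono[OF closure_subset])
  also have "\<dots> = emeasure lborel (closure F)" by simp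
  also have "\<dots> = (\<integral>\<^sup>+z. emeasure lborel (Pair z -` closure F) \<partial>lborel)"
    by (rule emeasure_lborel_slices) simp
  also have "\<dots> \<le> (\<integral>\<^sup>+z. slice_length lam (z :: (complex, 'n) vec) \<partial>lborel)"
  proof (rule nn_integral_mono)
    fix z :: "(complex, 'n) vec"
    show "emeasure lborel (Pair z -` closure F) \<le> slice_length lam z"
    proof (cases "2 * norm z \<le> lam")
      case True
      then show ?thesis unfolding slice_length_def using slice(2)
        by (auto intro!: emeasure_le_diameter)
    next
      case False
      then have "Pair z -` closure F = {}" using slice(1) by fastforce
      then show ?thesis by simp
    qed
  qed
  finally show ?thesis .
qed

lemma l_fun_scale:
  assumes "0 < c" shows "l_fun (c * lam) (c * r) = c\<^sup>2 * l_fun lam r"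
proof -
  have "c * r \<le> c * lam / pi \<longleftrightarrow> r \<le> lam / pi" using assms by (simp flip: times_divide_eq_right)
  then show ?thesis using assms by (simp add: l_fun_def h_scaled_def power_mult_distrib power_divide)
qed

lemma slice_length_scale:
  assumes "0 < c" shows "slice_length (c * lam) (c *\<^sub>R z) = ennreal (c\<^sup>2) * slice_length lam z"
proof -
  have "2 * (c * norm z) \<le> c * lam \<longleftrightarrow> 2 * norm z \<le> lam"
    using assms mult_le_cancel_left_pos[of c "2 * norm z" lam] by (simp add: mult_ac)
  moreover have "ennreal (2 * (c\<^sup>2 * x)) = ennreal (c\<^sup>2) * ennreal (2 * x)" for x
    by (simp add: ennreal_mult' mult.left_commute flip: ennreal_mult')
  ultimately show ?thesis using assms by (simp add: slice_length_def l_fun_scale)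
qed

text \<open>The effect of the dilation \<open>(z, t) \<mapsto> (c z, c\<^sup>2 t)\<close>: a factor
  \<open>c\<^sup>2\<close> from the slices, the rest from the base of real dimension
  \<open>2 * CARD('n)\<close>. Measurability passes from one scale to the other.\<close>

lemma nn_integral_slice_length_scale:
  assumes c: "0 < c" and meas: "slice_length lam \<in> borel_measurable (lborel :: (complex, 'n::finite) vec measure)"
  shows "(\<integral>\<^sup>+z. slice_length (c * lam) (z :: (complex, 'n) vec) \<partial>lborel) =
    ennreal (c ^ (2 * CARD('n) + 2)) * (\<integral>\<^sup>+z. slice_length lam (z :: (complex, 'n) vec) \<partial>lborel)"
proof -
  let ?f = "slice_length (c * lam) :: (complex, 'n) vec \<Rightarrow> ennreal"
  have f: "?f \<in> borel_measurable borel"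
  proof -
    have "?f = (\<lambda>z. ennreal (c\<^sup>2) * slice_length lam ((1 / c) *\<^sub>R z))"
    proof
      fix z show "?f z = ennreal (c\<^sup>2) * slice_length lam ((1 / c) *\<^sub>R z)"
        using slice_length_scale[OF c, of lam "(1 / c) *\<^sub>R z"] c by simp
    qed
    moreover have "slice_length lam \<in> borel_measurable (borel :: (complex, 'n) vec measure)" using meas by simp
    ultimately show ?thesis by simp
  qed
  have "(\<integral>\<^sup>+z. ?f z \<partial>lborel) = (\<integral>\<^sup>+z. ?f z \<partial>density (distr lborel borel (\<lambda>x. 0 + c *\<^sub>R x)) (\<lambda>_. \<bar>c\<bar> ^ DIM((complex, 'n) vec)))"
    using lborel_affine[of c "0 :: (complex, 'n) vec"] c by simp
  also have "\<dots> = (\<integral>\<^sup>+z. ennreal (\<bar>c\<bar> ^ DIM((complex, 'n) vec)) * ?f (c *\<^sub>R z) \<partial>lborel)"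
    using f by (simp add: nn_integral_density nn_integral_distr)
  also have "\<dots> = (\<integral>\<^sup>+z. ennreal (c ^ (2 * CARD('n) + 2)) * slice_length lam (z :: (complex, 'n) vec) \<partial>lborel)"
  proof (rule nn_integral_cong)
    fix z :: "(complex, 'n) vec"
    have d: "DIM((complex, 'n) vec) = 2 * CARD('n)" by simp
    have "ennreal (c ^ (2 * CARD('n))) * ennreal (c\<^sup>2) = ennreal (c ^ (2 * CARD('n) + 2))"
      unfolding power_add by (rule ennreal_mult[symmetric]) (use c in auto)
    then show "ennreal (\<bar>c\<bar> ^ DIM((complex, 'n) vec)) * ?f (c *\<^sub>R z)
        = ennreal (c ^ (2 * CARD('n) + 2)) * slice_length lam z"
      unfolding slice_length_scale[OF c] d using c by (metis abs_of_pos mult.assoc)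
  qed
  also have "\<dots> = ennreal (c ^ (2 * CARD('n) + 2)) * (\<integral>\<^sup>+z. slice_length lam (z :: (complex, 'n) vec) \<partial>lborel)"
    by (rule nn_integral_cmult[OF meas])
  finally show ?thesis .
qed

section \<open>A maximiser that is not symmetric\<close>

definition bumped_set :: "'n::finite heis set" where
  "bumped_set = {p. norm (fst p) \<le> pi \<and> \<bar>snd p - bump (norm (fst p))\<bar> \<le> l_fun (2 * pi) (norm (fst p))}"

text \<open>The two branches agree at \<open>r = 2\<close>, so continuity can be glued from closed
  intervals that share this point.\<close>

lemma l_fun_2pi_outer: "2 \<le> r \<Longrightarrow> l_fun (2 * pi) r = pi\<^sup>2 * h_fun (r / pi)"
proof (cases "r = 2")
  case True
  have "inv_into {0..pi} rho (2 / pi) = pi / 2" by (rule inv_rho_eq) (auto simp: rho_def)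
  then have "h_fun (2 / pi) = g_fun (pi / 2)" by (simp only: h_fun_def)
  also have "\<dots> = 2 / pi" by (simp add: g_fun_def power2_eq_square)
  finally have "h_fun (2 / pi) = 2 / pi" .
  then show ?thesis using True by (simp add: l_fun_def power2_eq_square)
qed (simp add: l_fun_def h_scaled_def)

lemma l_fun_2pi_inner: "r \<le> 2 \<Longrightarrow> l_fun (2 * pi) r = 2 * pi"
  by (simp add: l_fun_def power2_eq_square)

lemma l_fun_2pi_rim: "l_fun (2 * pi) pi = 0"
proof -
  have "inv_into {0..pi} rho 1 = 0" by (rule inv_rho_eq) (auto simp: rho_def)
  then show ?thesis using pi_gt3 by (simp add: l_fun_2pi_outer h_fun_def g_fun_def)
qed

lemma continuous_on_l_fun_2pi: "continuous_on {0..pi} (l_fun (2 * pi))"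
proof -
  have "continuous_on {2..pi} (\<lambda>r. pi\<^sup>2 * h_fun (r / pi))"
    by (intro continuous_intros continuous_on_compose2[OF continuous_on_h_fun]) auto
  then have "continuous_on {2..pi} (l_fun (2 * pi))"
    by (rule continuous_on_eq) (simp add: l_fun_2pi_outer)
  moreover have "continuous_on {0..2} (l_fun (2 * pi))"
    by (rule continuous_on_eq[of _ "\<lambda>_. 2 * pi"]) (auto simp: l_fun_2pi_inner)
  moreover have "{0..2} \<union> {2..pi} = {0..pi}" using pi_gt3 by auto
  ultimately show ?thesis using continuous_on_closed_Un[of "{0..2}" "{2..pi}"] by auto
qed

lemma compact_bumped_set: "compact (bumped_set :: 'n::finite heis set)"
proof -
  have cont: "continuous_on {p :: 'n heis. norm (fst p) \<le> pi} (\<lambda>p. l_fun (2 * pi) (norm (fst p)))"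
    by (rule continuous_on_compose2[OF continuous_on_l_fun_2pi]) (auto intro!: continuous_intros)
  have cl: "closed {p :: 'n heis. norm (fst p) \<le> pi}"
    by (intro closed_Collect_le continuous_intros)
  have "closed {p \<in> {p :: 'n heis. norm (fst p) \<le> pi}. \<bar>snd p - bump (norm (fst p))\<bar> \<le> l_fun (2 * pi) (norm (fst p))}"
    by (rule continuous_on_closed_Collect_le[OF _ cont cl]) (unfold bump_def, intro continuous_intros, simp)
  then have "closed (bumped_set :: 'n heis set)" by (simp add: bumped_set_def)
  moreover have "bounded (bumped_set :: 'n heis set)"
  proof -
    have "compact (l_fun (2 * pi) ` {0..pi})"
      by (intro compact_continuous_image continuous_on_l_fun_2pi) simp
    then obtain M where M: "\<And>r. r \<in> {0..pi} \<Longrightarrow> \<bar>l_fun (2 * pi) r\<bar> \<le> M"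
      using compact_imp_bounded bounded_real by (metis (no_types, lifting) image_eqI)
    have "norm p \<le> pi + (1 + M)" if "p \<in> bumped_set" for p :: "'n heis"
    proof -
      have p: "norm (fst p) \<le> pi" "\<bar>snd p - bump (norm (fst p))\<bar> \<le> l_fun (2 * pi) (norm (fst p))"
        using that by (auto simp: bumped_set_def)
      have "0 \<le> bump (norm (fst p))" "bump (norm (fst p)) \<le> 1"
        unfolding bump_def by (auto intro!: power_le_one)
      then have "\<bar>snd p\<bar> \<le> 1 + M" using p M[of "norm (fst p)"] by auto
      then show ?thesis using norm_Pair_le[of "fst p" "snd p"] p(1) by simp
    qed
    then show ?thesis unfolding bounded_iff by blast
  qed
  ultimately show ?thesis by (simp add: compact_eq_bounded_closed)
qed

lemma rot_inv_bumped_set: "bumped_set \<in> rot_inv"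
proof -
  have "norm (fst (rot \<theta> p)) = norm (fst p)" "snd (rot \<theta> p) = snd p" for \<theta> and p :: "'a heis"
    by (simp_all add: rot_def norm_vec_def norm_mult)
  then show ?thesis by (auto simp: rot_inv_def bumped_set_def)
qed

lemma slice_length_bumped_set:
  "emeasure lborel (Pair z -` bumped_set) = slice_length (2 * pi) z"
proof (cases "norm z \<le> pi")
  case True
  define c where "c = bump (norm z)"
  define l where "l = l_fun (2 * pi) (norm z)"
  have "0 \<le> l" unfolding l_def using True by (intro l_fun_nonneg) auto
  moreover have "Pair z -` bumped_set = {c - l..c + l}"
    using True by (auto simp: bumped_set_def c_def l_def abs_le_iff)
  ultimately show ?thesis using True by (simp add: slice_length_def l_def)
next
  case False
  then have "Pair z -` bumped_set = {}" by (auto simp: bumped_set_def)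
  then show ?thesis using False by (simp add: slice_length_def)
qed

text \<open>Measurability of \<open>slice_length (2 * pi)\<close> is a by-product, as it gives the
  slice lengths of a Borel set.\<close>

lemma outer_measure_bumped_set:
  "outer_measure_of lebesgue (bumped_set :: 'n::finite heis set) =
    (\<integral>\<^sup>+z. slice_length (2 * pi) (z :: (complex, 'n) vec) \<partial>lborel)"
  "slice_length (2 * pi) \<in> borel_measurable (lborel :: (complex, 'n) vec measure)"
proof -
  have E: "(bumped_set :: 'n heis set) \<in> sets borel"
    using compact_bumped_set by (intro borel_closed compact_imp_closed)
  then have "outer_measure_of lebesgue (bumped_set :: 'n heis set) = emeasure lborel (bumped_set :: 'n heis set)"
    by simp
  then show "outer_measure_of lebesgue (bumped_set :: 'n heis set) =
      (\<integral>\<^sup>+z. slice_length (2 * pi) (z :: (complex, 'n) vec) \<partial>lborel)"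
    using emeasure_lborel_slices(1)[OF E] by (simp add: slice_length_bumped_set)
  show "slice_length (2 * pi) \<in> borel_measurable (lborel :: (complex, 'n) vec measure)"
    using emeasure_lborel_slices(2)[OF E] by (simp add: slice_length_bumped_set)
qed

lemma rim_in_bumped_set: "norm z = pi \<Longrightarrow> (z, 0) \<in> bumped_set"
  using pi_gt3 by (simp add: bumped_set_def bump_eq_0 l_fun_2pi_rim)

text \<open>The lower bound comes from antipodal points of the rim, whose projections are
  \<open>2 * pi\<close> apart.\<close>

lemma cc_diam_bumped_set: "cc_diam (bumped_set :: 'n::finite heis set) = ennreal (2 * pi)"
proof (rule antisym)
  have "cc_dist p q \<le> 2 * pi" if "p \<in> bumped_set" "q \<in> bumped_set" for p q :: "'n heis"
    using that cc_dist_le_bumped[of "fst p" "fst q" "snd p" "snd q"]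
      cc_dist_le_bumped[of "fst q" "fst p" "snd q" "snd p"]
    by (cases "norm (fst p) \<le> norm (fst q)") (auto simp: bumped_set_def)
  then show "cc_diam (bumped_set :: 'n heis set) \<le> ennreal (2 * pi)"
    unfolding cc_diam_def by (intro SUP_least ennreal_leI)
  obtain z :: "(complex, 'n) vec" where z: "norm z = pi" using vector_choose_size[of pi] by auto
  have "2 * pi \<le> cc_dist (z, 0) (- z, 0)"
  proof (rule ccontr)
    assume "\<not> 2 * pi \<le> cc_dist (z, 0) (- z, 0)"
    \<comment> \<open>The maximum with 1 secures the positive bound that
      \<open>cc_dist_le_imp\<close> asks for.\<close>
    then obtain lam where lam: "0 < lam" "cc_dist (z, 0) (- z, 0) \<le> lam" "lam < 2 * pi"
      using that[of "max 1 (cc_dist (z, 0) (- z, 0))"] pi_gt3 by (auto simp: max_def split: if_splits)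
    have "cc_close lam (z, 0) (- z, 0)"
      unfolding cc_close_def using cc_dist_le_imp[OF lam(2,1)] by blast
    from cc_close_norm[OF this lam(1)] have "norm (2 *\<^sub>R z) \<le> lam"
      by (simp add: scaleR_2 norm_minus_commute[of "- z" z])
    then show False using lam(3) z by simp
  qed
  then have "ennreal (2 * pi) \<le> ennreal (cc_dist (z, 0) (- z, 0))" by (rule ennreal_leI)
  also have "\<dots> \<le> cc_diam (bumped_set :: 'n heis set)"
    unfolding cc_diam_def
  proof (rule SUP_upper2[OF rim_in_bumped_set[OF z]])
    have "(- z, 0) \<in> bumped_set" using z by (intro rim_in_bumped_set) simp
    then show "ennreal (cc_dist (z, 0) (- z, 0)) \<le> (SUP q\<in>bumped_set. ennreal (cc_dist (z, 0) q))"
      by (rule SUP_upper)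
  qed
  finally show "ennreal (2 * pi) \<le> cc_diam (bumped_set :: 'n heis set)" .
qed

text \<open>The slice integral at any diameter is a dilate of the one at \<open>2 * pi\<close>, so
  the bound on the quotient does not depend on the diameter, and \<open>bumped_set\<close> attains
  it.\<close>

lemma isodiam_const_rot_eq:
  "isodiam_const_rot TYPE('n::finite) =
    outer_measure_of lebesgue (bumped_set :: 'n heis set) / ennreal (2 * pi) ^ (2 * CARD('n) + 2)"
  (is "_ = ?V / _ ^ ?N")
proof (rule antisym)
  show "isodiam_const_rot TYPE('n) \<le> ?V / ennreal (2 * pi) ^ ?N"
    unfolding isodiam_const_rot_def
  proof (rule SUP_least)
    fix F :: "'n heis set" assume "F \<in> {F. F \<in> rot_inv \<and> 0 < cc_diam F \<and> cc_diam F < \<infinity>}"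
    then have F: "F \<in> rot_inv" "0 < cc_diam F" "cc_diam F < \<infinity>" by auto
    define lam where "lam = enn2real (cc_diam F)"
    have lam: "cc_diam F = ennreal lam" "0 < lam"
      using F by (auto simp: lam_def enn2real_positive_iff)
    define c where "c = lam / (2 * pi)"
    have c: "0 < c" "lam = c * (2 * pi)" using lam by (auto simp: c_def)
    have "outer_measure_of lebesgue F \<le> (\<integral>\<^sup>+z. slice_length lam (z :: (complex, 'n) vec) \<partial>lborel)"
      by (rule outer_measure_le_slice_length[OF F(1) eq_refl[OF lam(1)] lam(2)])
    also have "\<dots> = ennreal (c ^ ?N) * ?V"
      unfolding c(2) outer_measure_bumped_set(1)
      by (rule nn_integral_slice_length_scale[OF c(1) outer_measure_bumped_set(2)])
    finally have "outer_measure_of lebesgue F \<le> ennreal (c ^ ?N) * ?V" .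
    moreover have "cc_diam F ^ ?N = ennreal (lam ^ ?N)"
      unfolding lam(1) by (rule ennreal_power) (use lam(2) in simp)
    ultimately have "outer_measure_of lebesgue F / cc_diam F ^ ?N \<le> ennreal (c ^ ?N) * ?V / ennreal (lam ^ ?N)"
      by (simp only: divide_right_mono_ennreal)
    also have "\<dots> = (ennreal (c ^ ?N) / ennreal (lam ^ ?N)) * ?V"
      by (simp add: divide_ennreal_def mult_ac)
    also have "ennreal (c ^ ?N) / ennreal (lam ^ ?N) = ennreal (1 / (2 * pi) ^ ?N)"
    proof -
      have "c ^ ?N / lam ^ ?N = 1 / (2 * pi) ^ ?N"
        using c(1) unfolding c(2) power_mult_distrib by simp
      then show ?thesis using c lam(2) by (simp add: divide_ennreal)
    qed
    also have "ennreal (1 / (2 * pi) ^ ?N) = inverse (ennreal ((2 * pi) ^ ?N))"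
      by (simp add: inverse_ennreal inverse_eq_divide)
    also have "ennreal ((2 * pi) ^ ?N) = ennreal (2 * pi) ^ ?N"
      by (rule ennreal_power[symmetric]) simp
    also have "inverse (ennreal (2 * pi) ^ ?N) * ?V = ?V / ennreal (2 * pi) ^ ?N"
      by (simp only: divide_ennreal_def mult.commute)
    finally show "outer_measure_of lebesgue F / cc_diam F ^ ?N \<le> ?V / ennreal (2 * pi) ^ ?N" .
  qed
  show "?V / ennreal (2 * pi) ^ ?N \<le> isodiam_const_rot TYPE('n)"
    unfolding isodiam_const_rot_def
    by (rule SUP_upper2[of bumped_set]) (auto simp: rot_inv_bumped_set cc_diam_bumped_set)
qed

lemma bumped_set_isodiam_rot: "(bumped_set :: 'n::finite heis set) \<in> isodiam_rot"
proof -
  define x where "x = ennreal (2 * pi) ^ (2 * CARD('n) + 2)"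
  have "x = ennreal ((2 * pi) ^ (2 * CARD('n) + 2))" unfolding x_def by (rule ennreal_power) simp
  moreover have "(2 * pi) ^ (2 * CARD('n) + 2) > 0" by (rule zero_less_power) simp
  ultimately have "x \<noteq> 0" "x \<noteq> top" by (metis ennreal_eq_0_iff not_le, metis ennreal_neq_top)
  then have "y / x * x = y" for y by (simp add: ennreal_divide_times less_top)
  then show ?thesis
    unfolding isodiam_rot_def
    by (simp add: rot_inv_bumped_set compact_bumped_set cc_diam_bumped_set isodiam_const_rot_eq
        del: power_Suc power_add add_2_eq_Suc' flip: x_def)
qed

theorem corollary4p6:
  shows "\<exists>E :: 'n::finite heis set. E \<in> isodiam_rot \<and>
           (\<forall>p :: 'n heis. (\<lambda>q. p \<odot> q) ` E \<noteq> A_set (enn2real (cc_diam E)))"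
proof (intro exI conjI allI notI)
  show "(bumped_set :: 'n heis set) \<in> isodiam_rot" by (rule bumped_set_isodiam_rot)
  fix p :: "'n heis"
  assume "(\<lambda>q. p \<odot> q) ` bumped_set = A_set (enn2real (cc_diam (bumped_set :: 'n heis set)))"
  then have in_A: "p \<odot> q \<in> A_set (2 * pi)" if "q \<in> bumped_set" for q
    using that by (auto simp: cc_diam_bumped_set)
  obtain z0 :: "(complex, 'n) vec" where z0: "norm z0 = pi" using vector_choose_size[of pi] by auto
  \<comment> \<open>Otherwise the rim point in the direction of \<open>fst p\<close> would leave the
    region \<open>norm (fst q) \<le> pi\<close>.\<close>
  have "fst p = 0"
  proof (rule ccontr)
    assume p: "fst p \<noteq> 0"
    define z where "z = (pi / norm (fst p)) *\<^sub>R fst p"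
    have "norm z = pi" using p by (simp add: z_def)
    then have "norm (fst p + z) \<le> pi"
      using in_A[OF rim_in_bumped_set] by (simp add: A_set_def heis_mult_rotJ)
    moreover have "fst p + z = (1 + pi / norm (fst p)) *\<^sub>R fst p"
      by (simp add: z_def scaleR_add_left)
    then have "norm (fst p + z) = norm (fst p) + pi"
      using p by (simp add: distrib_right)
    ultimately show False using p by simp
  qed
  \<comment> \<open>Over the rim the slices of both sets consist of the height 0 alone.\<close>
  moreover from this have "snd p = 0"
    using in_A[OF rim_in_bumped_set[OF z0]] z0 by (simp add: A_set_def heis_mult_rotJ l_fun_2pi_rim rotJ_0)
  \<comment> \<open>The top of the slice over the axis: \<open>bump 0 = 1\<close> lifts it above the
    height \<open>2 * pi\<close> of \<open>A_set\<close>.\<close>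
  moreover have "(0, 2 * pi + 1) \<in> bumped_set"
    by (simp add: bumped_set_def bump_def l_fun_2pi_inner)
  ultimately show False
    using in_A[of "(0, 2 * pi + 1)"] by (simp add: A_set_def heis_mult_rotJ l_fun_2pi_inner)
qed

end
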